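(* Let $\Omega\subset\mathbb{R}^2$ be a bounded open convex set containing the origin in its interior, and suppose $$\sup_{\theta\in S^1}\sup_{\delta>0}\delta^{-1/2}\mu(\theta,\delta)<\infty.$$ Then there is a constant $C_\Omega$ such that for all $R\ge2$ and all $h$ with $R^{1/2}\le h\le R$, $$\mathcal{G}_\Omega(R,h)\le C_\Omega R^{1/2}.$$
   Context: For $t>0$ let $\mathcal{N}_\Omega(t)=\mathrm{card}(t\Omega\cap\mathbb{Z}^2)$, $E_\Omega(t)=\mathcal{N}_\Omega(t)-t^2\,\mathrm{area}(\Omega)$, and $\mathcal{G}_\Omega(R,h)=\big(\frac1h\int_R^{R+h}|E_\Omega(t)|^2dt\big)^{1/2}$. Let $\rho^*(\xi)=\sup\{\langle x,\xi\rangle:x\in\Omega\}$ for $\xi\in\mathbb{R}^2$. For $\theta\in S^1$ and $\delta>0$ let $\mathcal{C}(\theta,\delta)=\{x\in\partial\Omega:\langle x,\theta\rangle=\rho^*(\theta)-\delta\}$ and $\mu(\theta,\delta)=\mathrm{diam}(\mathcal{C}(\theta,\delta))$ (with $\mathrm{diam}(\emptyset)=0$). *)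

theory Defs
  imports "HOL-Analysis.Analysis"
begin

definition lattice2 :: "(real ^ 2) set" where
  "lattice2 = {x. \<forall>i. x $ i \<in> \<int>}"

definition lattice_count :: "(real ^ 2) set \<Rightarrow> real \<Rightarrow> nat" where
  "lattice_count \<Omega> t = card ((\<lambda>x. t *\<^sub>R x) ` \<Omega> \<inter> lattice2)"

definition lattice_error :: "(real ^ 2) set \<Rightarrow> real \<Rightarrow> real" where
  "lattice_error \<Omega> t = real (lattice_count \<Omega> t) - t\<^sup>2 * measure lebesgue \<Omega>"

definition mean_error :: "(real ^ 2) set \<Rightarrow> real \<Rightarrow> real \<Rightarrow> real" where
  "mean_error \<Omega> R h = sqrt ((1 / h) * integral {R..R+h} (\<lambda>t. \<bar>lattice_error \<Omega> t\<bar>\<^sup>2))"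

definition support_fn :: "(real ^ 2) set \<Rightarrow> real ^ 2 \<Rightarrow> real" where
  "support_fn \<Omega> \<xi> = Sup {x \<bullet> \<xi> | x. x \<in> \<Omega>}"

definition chord_set :: "(real ^ 2) set \<Rightarrow> real ^ 2 \<Rightarrow> real \<Rightarrow> (real ^ 2) set" where
  "chord_set \<Omega> \<theta> \<delta> = {x \<in> frontier \<Omega>. x \<bullet> \<theta> = support_fn \<Omega> \<theta> - \<delta>}"

text \<open>Isabelle's diameter of the empty set is 0, matching the convention.\<close>
definition chord_diam :: "(real ^ 2) set \<Rightarrow> real ^ 2 \<Rightarrow> real \<Rightarrow> real" where
  "chord_diam \<Omega> \<theta> \<delta> = diameter (chord_set \<Omega> \<theta> \<delta>)"

end

theory Submission
  imports Defs
begin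

text \<open>
  Let \<open>\<rho>\<close> be the support function of \<open>\<Omega>\<close>. Smoothing the indicator of \<open>t \<Omega>\<close> at scale \<open>R\<^sup>-\<^sup>1\<^sup>/\<^sup>2\<close> and summing over the
  lattice turns the error into a sum over \<open>k \<noteq> 0\<close> of damped Fourier coefficients of the indicator of \<open>t \<Omega>\<close>. The length
  of the slices of \<open>\<Omega>\<close> orthogonal to \<open>k\<close> is concave, so its second derivative is a measure; the hypothesis on
  chords bounds this measure near the two ends, and up to a small remainder the coefficient is
  \<open>e(t \<rho>(k)) P\<^sub>k(t) + e(-t \<rho>(-k)) Q\<^sub>k(t)\<close> with amplitudes of size \<open>R\<^sup>1\<^sup>/\<^sup>2 |k|\<^sup>-\<^sup>3\<^sup>/\<^sup>2\<close> that hardly vary on windows of length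
  \<open>R\<^sup>1\<^sup>/\<^sup>2\<close>. In the mean square only pairs \<open>k, l\<close> with \<open>|\<rho>(k) - \<rho>(l)| \<le> R\<^sup>-\<^sup>1\<^sup>/\<^sup>2\<close> matter.

  The trivial count of such pairs loses a logarithm. To save a power of \<open>|k| \<sim> q\<^sup>1\<^sup>2\<close>, consider vectors \<open>d\<close> of
  length at most \<open>q\<close> with \<open>|\<rho>(k + d) - \<rho>(k)| \<le> R\<^sup>-\<^sup>1\<^sup>/\<^sup>2\<close>. If there is none, then the points \<open>l\<close> of this kind with
  nearly the same frequency are \<open>q\<close>-separated in a thin annulus, and there are few. If the second
  difference of \<open>\<rho>\<close> at \<open>k\<close> in direction \<open>d\<close> is small, then the slices near the boundary are short, and the amplitude is
  small. Since \<open>\<rho>\<close> is convex along lines, few \<open>k\<close> have a large second difference.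
\<close>

section \<open>Exponentials and oscillatory integrals\<close>

text \<open>The kernel is a trigonometric polynomial, so pairing it with a dilate is a finite sum of
  Fourier coefficients and no question of convergence arises. The price is a small mass
  \<open>\<eta>\<close> away from the lattice, which is chosen after \<open>R\<close>. The trivial
  count only just fails: a shell \<open>|k| ~ q^12\<close> holds about \<open>q^24\<close> points,
  at most about \<open>q^12\<close> in a frequency cluster, with squared amplitudes of order
  \<open>R q^-36\<close>. The powers cancel, and each of about \<open>log R\<close> undamped shells
  contributes equally. One more power of \<open>q\<close> suffices, and each of three classes of
  \<open>k\<close> gains it in another factor. Exponents: let \<open>|k| ~ q^e\<close> and call a
  second difference large above \<open>R^(-1/2) q^-a\<close>. There are about \<open>q^2\<close>
  vectors \<open>d\<close>, \<open>q^(e+2)\<close> representatives of lines for each and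
  \<open>q^a\<close> steep points on a line, so \<open>e + 4 + a \<le> 2 e - 1\<close> is wanted;
  for small second differences the amplitude \<open>R^(1/2) q^(-a-e)\<close> wants
  \<open>2 a \<ge> e + 1\<close>. For even \<open>e\<close>, which makes \<open>|k|^(3/2)\<close> an
  integer power of \<open>q\<close>, the first solution is \<open>e = 12\<close>,
  \<open>a = 7\<close>.\<close>

definition ee :: "real \<Rightarrow> complex" where
  "ee x = cis (2 * pi * x)"

lemma ee_0 [simp]: "ee 0 = 1" by (simp add: ee_def)
lemma norm_ee [simp]: "norm (ee x) = 1" by (simp add: ee_def)
lemma ee_add: "ee (x + y) = ee x * ee y" by (simp add: ee_def cis_mult distrib_left)
lemma ee_diff: "ee (x - y) = ee x * ee (- y)" using ee_add[of x "-y"] by simp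
lemma cnj_ee: "cnj (ee x) = ee (- x)" by (simp add: ee_def cis_cnj)

lemma has_vector_derivative_ee:
  "((\<lambda>t. ee (t * c)) has_vector_derivative (2 * pi * c) *\<^sub>R (\<i> * ee (t * c))) (at t within S)"
proof -
  have "((\<lambda>t. cis (2 * pi * (t * c))) has_derivative (\<lambda>t. (2 * pi * (t * c)) *\<^sub>R (\<i> * cis (2 * pi * (x * c))))) (at x within S)" for x
    by (rule has_derivative_cis) (auto intro!: derivative_eq_intros)
  from this[of t] show ?thesis
    by (simp add: ee_def has_vector_derivative_def algebra_simps)
qed

lemma continuous_on_ee [continuous_intros]:
  "continuous_on S g \<Longrightarrow> continuous_on S (\<lambda>x. ee (g x))"
  unfolding ee_def by (intro continuous_intros)

lemma norm_1_minus_ee: "norm (1 - ee x) = 2 * \<bar>sin (pi * x)\<bar>"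
  using dist_exp_i_1[of "2 * pi * x"] by (simp add: ee_def cis_conv_exp norm_minus_commute)

lemma norm_1_minus_ee_le: "norm (1 - ee x) \<le> 2 * pi * \<bar>x\<bar>"
  using abs_sin_x_le_abs_x[of "pi * x"] by (simp add: norm_1_minus_ee abs_mult)

lemma norm_1_minus_ee_le_2: "norm (1 - ee x) \<le> 2"
  using norm_triangle_ineq4[of 1 "ee x"] by simp

text \<open>An amplitude of size \<open>\<beta>\<close> that hardly varies on time windows of length
  \<open>sqrt R\<close>: each derivative costs a factor \<open>R^(-1/2)\<close>. Two derivatives are
  what two integrations by parts consume, and they yield the decay \<open>1 / (1 + R f^2)\<close>.
  The range \<open>4 R\<close> contains the enlarged time window around \<open>R\<close>.\<close>

definition slow :: "real \<Rightarrow> real \<Rightarrow> (real \<Rightarrow> complex) \<Rightarrow> bool" where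
  "slow R \<beta> P \<longleftrightarrow> (\<exists>P1 P2. \<forall>t. (P has_vector_derivative P1 t) (at t) \<and>
     (P1 has_vector_derivative P2 t) (at t) \<and>
     (\<bar>t\<bar> \<le> 4 * R \<longrightarrow> norm (P t) \<le> \<beta> \<and> norm (P1 t) \<le> \<beta> / sqrt R \<and> norm (P2 t) \<le> \<beta> / R))"

lemma slow_mono: "slow R \<beta> P \<Longrightarrow> \<beta> \<le> \<gamma> \<Longrightarrow> R > 0 \<Longrightarrow> slow R \<gamma> P"
  unfolding slow_def
  by (meson divide_right_mono order.trans real_sqrt_ge_0_iff less_imp_le)

lemma slow_continuous: "slow R \<beta> P \<Longrightarrow> continuous_on S P"
  unfolding slow_def
  by (meson continuous_at_imp_continuous_on has_vector_derivative_continuous)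

lemma slow_cnj: "slow R \<beta> P \<Longrightarrow> slow R \<beta> (\<lambda>t. cnj (P t))"
proof -
  assume "slow R \<beta> P"
  then obtain P1 P2 where "\<forall>t. (P has_vector_derivative P1 t) (at t) \<and>
     (P1 has_vector_derivative P2 t) (at t) \<and>
     (\<bar>t\<bar> \<le> 4 * R \<longrightarrow> norm (P t) \<le> \<beta> \<and> norm (P1 t) \<le> \<beta> / sqrt R \<and> norm (P2 t) \<le> \<beta> / R)"
    by (auto simp: slow_def)
  then show ?thesis unfolding slow_def
    by (intro exI[of _ "\<lambda>t. cnj (P1 t)"] exI[of _ "\<lambda>t. cnj (P2 t)"])
      (auto intro!: has_vector_derivative_cnj)
qed

lemma slow_scale: "slow R \<beta> P \<Longrightarrow> slow R (\<bar>c\<bar> * \<beta>) (\<lambda>t. of_real c * P t)"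
proof -
  assume "slow R \<beta> P"
  then obtain P1 P2 where "\<forall>t. (P has_vector_derivative P1 t) (at t) \<and>
     (P1 has_vector_derivative P2 t) (at t) \<and>
     (\<bar>t\<bar> \<le> 4 * R \<longrightarrow> norm (P t) \<le> \<beta> \<and> norm (P1 t) \<le> \<beta> / sqrt R \<and> norm (P2 t) \<le> \<beta> / R)"
    by (auto simp: slow_def)
  then show ?thesis unfolding slow_def
    by (intro exI[of _ "\<lambda>t. of_real c * P1 t"] exI[of _ "\<lambda>t. of_real c * P2 t"])
      (auto intro!: has_vector_derivative_mult_right simp: norm_mult mult_left_mono
        simp flip: times_divide_eq_right)
qed

text \<open>Two integrations by parts; \<open>\<phi>\<close> and its first derivative vanish at both
  ends, so there are no boundary terms.\<close>

lemma oscillation_bound: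
  fixes \<phi> :: "real \<Rightarrow> complex"
  assumes d1: "\<And>t. (\<phi> has_vector_derivative \<phi>1 t) (at t)"
    and d2: "\<And>t. (\<phi>1 has_vector_derivative \<phi>2 t) (at t)"
    and ends: "\<phi> a = 0" "\<phi> b = 0" "\<phi>1 a = 0" "\<phi>1 b = 0"
    and ab: "a \<le> b" and f: "f \<noteq> 0"
    and bd: "\<And>t. t \<in> {a..b} \<Longrightarrow> norm (\<phi>2 t) \<le> Q"
  shows "norm (integral {a..b} (\<lambda>t. \<phi> t * ee (t * f))) \<le> (b - a) * Q / (2 * pi * f)\<^sup>2"
proof -
  define g where "g = complex_of_real (2 * pi * f) * \<i>"
  have g0: "g \<noteq> 0" using f by (simp add: g_def)
  have g2: "norm g ^ 2 = (2 * pi * f)\<^sup>2" by (simp add: g_def norm_mult power_mult_distrib)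
  \<comment> \<open>Both integrations by parts in one antiderivative: the derivative of
    \<open>\<Psi>\<close> is the integrand minus the integrand with \<open>\<phi>2 / g^2\<close> in
    place of \<open>\<phi>\<close>.\<close>
  define \<Psi> where "\<Psi> t = (\<phi> t / g - \<phi>1 t / g\<^sup>2) * ee (t * f)" for t
  have de: "((\<lambda>t. ee (t * f)) has_vector_derivative g * ee (t * f)) (at t)" for t
    using has_vector_derivative_ee[of f t UNIV] by (simp add: g_def scaleR_conv_of_real mult_ac)
  have "(\<Psi> has_vector_derivative (\<phi> t * ee (t * f) - \<phi>2 t / g\<^sup>2 * ee (t * f))) (at t)" for t
  proof -
    have "(\<Psi> has_vector_derivative ((\<phi> t / g - \<phi>1 t / g\<^sup>2) * (g * ee (t * f)) +
        (\<phi>1 t / g - \<phi>2 t / g\<^sup>2) * ee (t * f))) (at t)"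
      unfolding \<Psi>_def
      by (intro has_vector_derivative_mult de has_vector_derivative_diff has_vector_derivative_divide d1 d2)
    moreover have "(\<phi> t / g - \<phi>1 t / g\<^sup>2) * (g * ee (t * f)) + (\<phi>1 t / g - \<phi>2 t / g\<^sup>2) * ee (t * f)
      = \<phi> t * ee (t * f) - \<phi>2 t / g\<^sup>2 * ee (t * f)"
      using g0 by (simp add: field_simps power2_eq_square)
    ultimately show ?thesis by simp
  qed
  then have hi: "((\<lambda>t. \<phi> t * ee (t * f) - \<phi>2 t / g\<^sup>2 * ee (t * f)) has_integral (\<Psi> b - \<Psi> a)) {a..b}"
    by (intro fundamental_theorem_of_calculus[OF ab]) (auto intro: has_vector_derivative_at_within)
  have z: "\<Psi> b - \<Psi> a = 0" using ends by (simp add: \<Psi>_def)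
  have c: "continuous_on {a..b} \<phi>"
    using d1 by (meson continuous_at_imp_continuous_on has_vector_derivative_continuous)
  have i1: "(\<lambda>t. \<phi> t * ee (t * f)) integrable_on {a..b}"
    by (intro integrable_continuous_real continuous_intros c)
  from has_integral_diff[OF integrable_integral[OF i1] hi]
  have h2: "((\<lambda>t. \<phi>2 t / g\<^sup>2 * ee (t * f)) has_integral integral {a..b} (\<lambda>t. \<phi> t * ee (t * f))) {a..b}"
    unfolding z by simp
  have Q: "Q \<ge> 0" using bd[of a] ab by (auto intro: order.trans[OF norm_ge_zero])
  have "norm (integral {a..b} (\<lambda>t. \<phi> t * ee (t * f))) \<le> Q / norm g ^ 2 * measure lborel {a..b}"
    by (rule has_integral_bound_real[OF _ finite.emptyI h2])
      (use Q bd in \<open>auto simp: norm_mult norm_divide norm_power intro!: divide_right_mono\<close>)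
  also have "\<dots> = (b - a) * Q / (2 * pi * f)\<^sup>2"
    using ab unfolding g2 by (simp add: algebra_simps)
  finally show ?thesis .
qed

text \<open>A time cutoff of length \<open>4 sqrt R\<close> that vanishes with its derivative at
  both ends and is at least 1/2 on the middle half. That half contains
  \<open>R - 1/2 .. R + sqrt R + 1/2\<close>; the margin 1/2 leaves room for the later shifts of
  \<open>t\<close> by the smoothing.\<close>

definition bump :: "real \<Rightarrow> real \<Rightarrow> real" where
  "bump R t = (sin (pi * (t - (R - 3/2 * sqrt R)) / (4 * sqrt R)))\<^sup>2"

lemma bump_nonneg: "0 \<le> bump R t" by (simp add: bump_def)

lemma bump_ge_half:
  assumes "R \<ge> 2" "t \<in> {R - 1/2 .. R + sqrt R + 1/2}"
  shows "bump R t \<ge> 1/2"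
proof -
  define y where "y = pi * (t - (R - 3/2 * sqrt R)) / (4 * sqrt R)"
  have s: "sqrt R \<ge> 1" "sqrt R > 0" using assms by auto
  define s where "s = sqrt R"
  have s': "s > 0" "s \<ge> 1" "t \<ge> R - 1/2" "t \<le> R + s + 1/2" using s assms by (auto simp: s_def)
  have c: "cos (2 * y) \<le> 0"
  proof -
    have "2 * y = pi * ((t - (R - 3/2 * sqrt R)) / (2 * sqrt R))" by (simp add: y_def)
    moreover have "(t - (R - 3/2 * sqrt R)) / (2 * sqrt R) \<ge> 1/2" "(t - (R - 3/2 * sqrt R)) / (2 * sqrt R) \<le> 3/2"
      unfolding s_def[symmetric] using s' by (auto simp: field_simps)
    ultimately have "2 * y \<ge> pi * (1/2)" "2 * y \<le> pi * (3/2)"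
      by (metis mult_left_mono pi_ge_zero)+
    then have "cos (2 * y - pi) \<ge> 0" by (intro cos_ge_zero) auto
    then show ?thesis by (simp add: cos_diff)
  qed
  have "cos (2 * y) = 1 - 2 * (sin y)\<^sup>2" by (simp add: cos_double_sin)
  then show ?thesis using c by (simp add: bump_def y_def)
qed

text \<open>An off-diagonal term of a mean square. Cutoff and amplitudes together vary on the scale
  \<open>sqrt R\<close>, so two integrations by parts give decay once \<open>f\<close> exceeds
  \<open>R^(-1/2)\<close>; for smaller \<open>f\<close> the length of the window is the
  bound.\<close>

lemma slow_pair:
  assumes R: "R \<ge> 2" and P: "slow R \<beta> P" and Q: "slow R \<gamma> Q"
  defines "I \<equiv> {R - 3/2 * sqrt R .. R + 5/2 * sqrt R}"
  shows "norm (integral I (\<lambda>t. of_real (bump R t) * (P t * Q t) * ee (t * f)))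
    \<le> 8 * sqrt R * \<beta> * \<gamma> / (1 + R * f\<^sup>2)"
proof -
  define s where "s = sqrt R"
  have s: "s > 0" "R = s * s" "s\<^sup>2 = R" using R by (auto simp: s_def)
  have s1: "sqrt R = s" by (simp add: s_def)
  have s14: "s \<ge> 14/10" unfolding s_def by (rule real_le_rsqrt) (use R in \<open>simp add: power2_eq_square\<close>)
  obtain P1 P2 where P12: "\<And>t. (P has_vector_derivative P1 t) (at t)"
    "\<And>t. (P1 has_vector_derivative P2 t) (at t)"
    "\<And>t. \<bar>t\<bar> \<le> 4 * R \<Longrightarrow> norm (P t) \<le> \<beta> \<and> norm (P1 t) \<le> \<beta> / s \<and> norm (P2 t) \<le> \<beta> / R"
    using P unfolding slow_def s1 by metis
  obtain Q1 Q2 where Q12: "\<And>t. (Q has_vector_derivative Q1 t) (at t)"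
    "\<And>t. (Q1 has_vector_derivative Q2 t) (at t)"
    "\<And>t. \<bar>t\<bar> \<le> 4 * R \<Longrightarrow> norm (Q t) \<le> \<gamma> \<and> norm (Q1 t) \<le> \<gamma> / s \<and> norm (Q2 t) \<le> \<gamma> / R"
    using Q unfolding slow_def s1 by metis
  define A where "A = R - 3/2 * s"
  have I: "I = {A .. A + 4 * s}" by (simp add: I_def A_def s_def)
  have tI: "\<bar>t\<bar> \<le> 4 * R" if "t \<in> I" for t
  proof -
    have "s * s \<ge> 14/10 * s" using s14 s by (intro mult_right_mono) auto
    moreover have "R - 3/2 * s \<le> t" "t \<le> R + 5/2 * s" using that by (auto simp: I A_def)
    ultimately show ?thesis using s14 unfolding s(2) abs_le_iff by linarith
  qed
  define y where "y t = pi * (t - A) / (4 * s)" for t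
  define w where "w t = complex_of_real ((sin (y t))\<^sup>2)" for t
  define w1 where "w1 t = complex_of_real (pi / (4 * s) * sin (2 * y t))" for t
  define w2 where "w2 t = complex_of_real (2 * (pi / (4 * s))\<^sup>2 * cos (2 * y t))" for t
  have wb: "complex_of_real (bump R t) = w t" for t by (simp add: bump_def w_def y_def A_def s_def)
  have dy: "(y has_real_derivative (pi / (4 * s))) (at t)" for t
  proof -
    have "y = (\<lambda>t. pi / (4 * s) * (t - A))" by (simp add: y_def fun_eq_iff)
    moreover have "((\<lambda>t. pi / (4 * s) * (t - A)) has_real_derivative pi / (4 * s) * 1) (at t)"
      by (intro DERIV_cmult) (auto intro!: derivative_eq_intros)
    ultimately show ?thesis by (simp only: mult_1_right)
  qed
  have dw: "(w has_vector_derivative w1 t) (at t)" for t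
    unfolding w_def w1_def
    by (intro has_vector_derivative_of_real)
      (auto intro!: derivative_eq_intros dy simp: sin_double simp flip: has_real_derivative_iff_has_vector_derivative)
  have dw1: "(w1 has_vector_derivative w2 t) (at t)" for t
    unfolding w1_def w2_def
    by (intro has_vector_derivative_of_real)
      (use s(1) in \<open>auto intro!: derivative_eq_intros dy simp: power2_eq_square simp flip: has_real_derivative_iff_has_vector_derivative\<close>)
  have nw: "norm (w t) \<le> 1" for t by (simp add: w_def norm_power power_le_one_iff abs_square_le_1)
  have nw1: "norm (w1 t) \<le> 1 / s" for t
  proof -
    have "norm (w1 t) = pi / (4 * s) * \<bar>sin (2 * y t)\<bar>" unfolding w1_def norm_of_real using s(1) by (simp add: abs_mult)
    also have "\<dots> \<le> 4 / (4 * s) * 1"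
      using s pi_less_4 by (intro mult_mono divide_right_mono) auto
    finally show ?thesis using s by simp
  qed
  have nw2: "norm (w2 t) \<le> 2 / R" for t
  proof -
    have "norm (w2 t) = 2 * (pi / (4 * s))\<^sup>2 * \<bar>cos (2 * y t)\<bar>" unfolding w2_def norm_of_real using s(1) by (simp add: abs_mult)
    also have "\<dots> \<le> 2 * (4 / (4 * s))\<^sup>2 * 1"
      using s pi_less_4 by (intro mult_mono power_mono divide_right_mono) auto
    finally show ?thesis using s by (simp add: power2_eq_square)
  qed
  \<comment> \<open>The product rule in two rounds, first cutoff times \<open>P\<close>, then the
    result times \<open>Q\<close>; the constants 5 and 10 below add up the terms of the second
    derivatives.\<close>
  define U where "U t = w t * P t" for t
  define U1 where "U1 t = w t * P1 t + w1 t * P t" for t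
  define U2 where "U2 t = (w t * P2 t + w1 t * P1 t) + (w1 t * P1 t + w2 t * P t)" for t
  have dU: "(U has_vector_derivative U1 t) (at t)" for t
    unfolding U_def U1_def by (intro has_vector_derivative_mult dw P12)
  have dU1: "(U1 has_vector_derivative U2 t) (at t)" for t
    unfolding U1_def U2_def by (intro has_vector_derivative_add has_vector_derivative_mult dw dw1 P12)
  define V where "V t = U t * Q t" for t
  define V1 where "V1 t = U t * Q1 t + U1 t * Q t" for t
  define V2 where "V2 t = (U t * Q2 t + U1 t * Q1 t) + (U1 t * Q1 t + U2 t * Q t)" for t
  have dV: "(V has_vector_derivative V1 t) (at t)" for t
    unfolding V_def V1_def by (intro has_vector_derivative_mult dU Q12)
  have dV1: "(V1 has_vector_derivative V2 t) (at t)" for t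
    unfolding V1_def V2_def by (intro has_vector_derivative_add has_vector_derivative_mult dU dU1 Q12)
  have ends: "V A = 0" "V (A + 4 * s) = 0" "V1 A = 0" "V1 (A + 4 * s) = 0"
    using s by (auto simp: V_def V1_def U_def U1_def w_def w1_def y_def)
  have bg: "\<beta> \<ge> 0" "\<gamma> \<ge> 0"
    using P12(3)[of 0] Q12(3)[of 0] R by (auto intro: order.trans[OF norm_ge_zero])
  have nU: "norm (U t) \<le> \<beta>" "norm (U1 t) \<le> 2 * \<beta> / s" "norm (U2 t) \<le> 5 * \<beta> / R" if t: "t \<in> I" for t
  proof -
    note p = P12(3)[OF tI[OF t]]
    show "norm (U t) \<le> \<beta>" unfolding U_def
      using mult_mono[OF nw[of t], of "norm (P t)" \<beta>] p by (simp add: norm_mult)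
    have "norm (U1 t) \<le> 1 * (\<beta> / s) + 1 / s * \<beta>" unfolding U1_def
      by (intro norm_triangle_le add_mono; unfold norm_mult; intro mult_mono nw nw1) (use p s bg in auto)
    then show "norm (U1 t) \<le> 2 * \<beta> / s" by simp
    have "norm (U2 t) \<le> (1 * (\<beta> / R) + 1 / s * (\<beta> / s)) + (1 / s * (\<beta> / s) + 2 / R * \<beta>)" unfolding U2_def
      by (intro norm_triangle_le add_mono; unfold norm_mult; intro mult_mono nw nw1 nw2) (use p s(1) R bg in auto)
    then show "norm (U2 t) \<le> 5 * \<beta> / R" using s by (simp add: field_simps)
  qed
  have nV: "norm (V t) \<le> \<beta> * \<gamma>" "norm (V2 t) \<le> 10 * \<beta> * \<gamma> / R" if t: "t \<in> I" for t
  proof -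
    note q = Q12(3)[OF tI[OF t]]
    show "norm (V t) \<le> \<beta> * \<gamma>" unfolding V_def
      using nU[OF t] q bg by (auto simp: norm_mult intro!: mult_mono)
    have "norm (V2 t) \<le> (\<beta> * (\<gamma> / R) + 2 * \<beta> / s * (\<gamma> / s)) + (2 * \<beta> / s * (\<gamma> / s) + 5 * \<beta> / R * \<gamma>)"
      unfolding V2_def 
      by (intro norm_triangle_le add_mono; unfold norm_mult; intro mult_mono) (use q s(1) R bg nU[OF t] in auto)
    then show "norm (V2 t) \<le> 10 * \<beta> * \<gamma> / R" using s by (simp add: field_simps)
  qed
  have eq: "of_real (bump R t) * (P t * Q t) * ee (t * f) = V t * ee (t * f)" for t
    by (simp add: wb V_def U_def)
  have cV: "continuous_on I V"
    using dV by (meson continuous_at_imp_continuous_on has_vector_derivative_continuous)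
  have iV: "(\<lambda>t. V t * ee (t * f)) integrable_on cbox A (A + 4 * s)"
    using cV unfolding I cbox_interval by (intro integrable_continuous_real continuous_intros)
  have triv: "norm (integral I (\<lambda>t. V t * ee (t * f))) \<le> 4 * s * (\<beta> * \<gamma>)"
    using has_integral_bound[OF _ integrable_integral[OF iV], of "\<beta> * \<gamma>"] bg nV s
    by (auto simp: I norm_mult mult_ac)
  have osc: "norm (integral I (\<lambda>t. V t * ee (t * f))) \<le> 4 * s * (10 * \<beta> * \<gamma> / R) / (2 * pi * f)\<^sup>2" if "f \<noteq> 0"
    using oscillation_bound[OF dV dV1 ends _ that, of "10 * \<beta> * \<gamma> / R"] nV s
    unfolding I by auto
  have "norm (integral I (\<lambda>t. V t * ee (t * f))) * (1 + R * f\<^sup>2) \<le> 8 * s * \<beta> * \<gamma>"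
  \<comment> \<open>The trivial bound serves where \<open>R f^2 \<le> 1\<close>, the oscillatory one
    elsewhere; in the latter \<open>80 / (2 pi)^2\<close> is below 8.\<close>
  proof (cases "R * f\<^sup>2 \<le> 1")
    case True
    have "norm (integral I (\<lambda>t. V t * ee (t * f))) * (1 + R * f\<^sup>2) \<le> (4 * s * (\<beta> * \<gamma>)) * 2"
      using True triv R bg s by (intro mult_mono) auto
    then show ?thesis by (simp add: mult_ac)
  next
    case False
    then have f: "f \<noteq> 0" by auto
    have pp: "(2 * pi)\<^sup>2 \<ge> 36" using pi_gt3 power_mono[of 6 "2*pi" 2] by simp
    have "norm (integral I (\<lambda>t. V t * ee (t * f))) * (1 + R * f\<^sup>2) \<le>
       4 * s * (10 * \<beta> * \<gamma> / R) / (2 * pi * f)\<^sup>2 * (2 * (R * f\<^sup>2))"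
      using False osc[OF f] R bg s by (intro mult_mono) auto
    also have "\<dots> = 80 * s * \<beta> * \<gamma> / (2 * pi)\<^sup>2" using R f by (simp add: power_mult_distrib)
    also have "\<dots> \<le> 80 * s * \<beta> * \<gamma> / 36" using pp s bg by (intro divide_left_mono) auto
    also have "\<dots> \<le> 8 * s * \<beta> * \<gamma>" using s bg by (simp add: divide_simps mult_nonneg_nonneg)
    finally show ?thesis .
  qed
  moreover have "1 + R * f\<^sup>2 > 0" using R by (intro add_pos_nonneg) auto
  ultimately show ?thesis unfolding eq s1 by (simp add: field_simps)
qed

section \<open>Frequency clusters and the mean square of a sum of slow waves\<close>

lemma sum_inverse_square_le:
  fixes c :: real
  assumes c: "c > 0"
  shows "(\<Sum>m<n. 1 / (1 + c\<^sup>2 * (real m)\<^sup>2)) \<le> 1 + 2 / c\<^sup>2"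
proof -
  have c2: "c\<^sup>2 > 0" using c by simp
  have "(\<Sum>m<Suc n. 1 / (1 + c\<^sup>2 * (real m)\<^sup>2)) \<le> 1 + (2 - 2 / (real n + 1)) / c\<^sup>2" for n
  proof (induction n)
    case (Suc n)
    \<comment> \<open>With \<open>m = n + 1\<close>, \<open>1 / m^2\<close> is at most
      \<open>2 / (m (m + 1))\<close>, whose sum telescopes.\<close>
    have "1 / (1 + c\<^sup>2 * (real (Suc n))\<^sup>2) \<le> 1 / (c\<^sup>2 * (real (Suc n) * (real n + 2) / 2))"
    proof (intro divide_left_mono)
      have "real (Suc n) * (real n + 2) / 2 \<le> (real (Suc n))\<^sup>2" by (simp add: power2_eq_square field_simps)
      then show "c\<^sup>2 * (real (Suc n) * (real n + 2) / 2) \<le> 1 + c\<^sup>2 * (real (Suc n))\<^sup>2"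
        using c2 mult_left_mono[of "real (Suc n) * (real n + 2) / 2" "(real (Suc n))\<^sup>2" "c\<^sup>2"] by linarith
      have "c\<^sup>2 * (real (Suc n) * (real n + 2) / 2) > 0" using c2 by auto
      moreover have "1 + c\<^sup>2 * (real (Suc n))\<^sup>2 > 0" using c2 by (intro add_pos_nonneg) auto
      ultimately show "0 < (1 + c\<^sup>2 * (real (Suc n))\<^sup>2) * (c\<^sup>2 * (real (Suc n) * (real n + 2) / 2))"
        by (rule mult_pos_pos[OF _ , rotated])
    qed simp
    also have "\<dots> = (2 / (real n + 1) - 2 / (real (Suc n) + 1)) / c\<^sup>2"
      using c by (simp add: field_simps)
    finally have "1 / (1 + c\<^sup>2 * (real (Suc n))\<^sup>2) \<le> (2 / (real n + 1) - 2 / (real (Suc n) + 1)) / c\<^sup>2" .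
    with Suc.IH show ?case unfolding sum.lessThan_Suc[of _ "Suc n"] diff_divide_distrib by linarith
  qed simp
  note * = this
  show ?thesis
  proof (cases n)
    case 0
    then show ?thesis using c2 by simp
  next
    case (Suc k)
    have "(2 - 2 / (real k + 1)) / c\<^sup>2 \<le> 2 / c\<^sup>2" using c2 by (intro divide_right_mono) auto
    with *[of k] show ?thesis unfolding Suc by linarith
  qed
qed

text \<open>Bins of width \<open>c / sqrt R\<close>, counted from \<open>x\<close>, hold at most
  \<open>D\<close> points each, and a bin \<open>m\<close> steps away has weight at most
  \<open>1 / (1 + c^2 m^2)\<close>.\<close>

lemma cluster_sum:
  fixes g :: "'a \<Rightarrow> real"
  assumes fin: "finite Z" and R: "R > 0" and c: "c > 0"
    and cnt: "\<And>y. real (card {l\<in>Z. y \<le> g l \<and> g l < y + c / sqrt R}) \<le> D"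
  shows "(\<Sum>l\<in>Z. 1 / (1 + R * (x - g l)\<^sup>2)) \<le> D * (2 + 4 / c\<^sup>2)"
proof -
  define s where "s = sqrt R"
  have s: "s > 0" "R = s\<^sup>2" using R by (auto simp: s_def)
  define b where "b l = \<lfloor>(g l - x) * s / c\<rfloor>" for l
  \<comment> \<open>The number of whole bins between bin \<open>j\<close> and \<open>x\<close>: bin
    \<open>-1\<close> touches \<open>x\<close> just as bin \<open>0\<close> does, hence the shift by
    one, and both sides give the same sum.\<close>
  define m where "m j = (if j \<ge> 0 then nat j else nat (- j - 1))" for j :: int
  define h where "h j = 1 / (1 + c\<^sup>2 * (real (m j))\<^sup>2)" for j
  have D: "D \<ge> 0" using cnt[of 0] by (meson of_nat_0_le_iff order.trans)
  obtain n :: nat where n: "\<And>l. l \<in> Z \<Longrightarrow> b l \<in> {- int n..<int n}"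
  proof -
    define n where "n = nat (Max (insert 0 ((\<lambda>l. \<bar>b l\<bar> + 1) ` Z)))"
    have "\<bar>b l\<bar> + 1 \<le> int n" if "l \<in> Z" for l
    proof -
      have "\<bar>b l\<bar> + 1 \<le> Max (insert 0 ((\<lambda>l. \<bar>b l\<bar> + 1) ` Z))" using fin that by (intro Max_ge) auto
      then show ?thesis unfolding n_def by linarith
    qed
    then show ?thesis by (intro that[of n]) force
  qed
  have le: "1 / (1 + R * (x - g l)\<^sup>2) \<le> h (b l)" for l
  proof -
    define u where "u = (g l - x) * s / c"
    have u: "u \<ge> b l" "u < b l + 1" by (auto simp: b_def u_def)
    have "real (m (b l)) \<le> \<bar>u\<bar>"
    proof (cases "b l \<ge> 0")
      case True then show ?thesis using u by (simp add: m_def)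
    next
      case False
      then have "real (nat (- b l - 1)) = - real_of_int (b l) - 1" by simp
      with False u show ?thesis by (simp add: m_def)
    qed
    then have "c\<^sup>2 * (real (m (b l)))\<^sup>2 \<le> c\<^sup>2 * u\<^sup>2"
      by (intro mult_left_mono) (auto simp: abs_le_square_iff[symmetric])
    also have "\<dots> = R * (x - g l)\<^sup>2"
      using c s by (simp add: u_def power2_eq_square field_simps)
    finally show ?thesis unfolding h_def using R c
      by (intro divide_left_mono) (auto intro!: mult_pos_pos add_pos_nonneg)
  qed
  have fibre: "real (card {l\<in>Z. b l = j}) \<le> D" for j
  proof -
    have "{l\<in>Z. b l = j} = {l\<in>Z. x + j * c / s \<le> g l \<and> g l < x + j * c / s + c / sqrt R}"
      using c s(1) unfolding b_def floor_eq_iff s_def[symmetric] by (auto simp: field_simps)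
    then show ?thesis using cnt by simp
  qed
  have "(\<Sum>l\<in>Z. 1 / (1 + R * (x - g l)\<^sup>2)) \<le> (\<Sum>l\<in>Z. h (b l))" by (intro sum_mono le)
  also have "\<dots> = (\<Sum>j\<in>{- int n..<int n}. \<Sum>l\<in>{l\<in>Z. b l = j}. h (b l))"
    by (rule sum.group[symmetric]) (use fin n in auto)
  also have "\<dots> = (\<Sum>j\<in>{- int n..<int n}. real (card {l\<in>Z. b l = j}) * h j)"
    by (intro sum.cong) auto
  also have "\<dots> \<le> (\<Sum>j\<in>{- int n..<int n}. D * h j)"
    by (intro sum_mono mult_right_mono fibre) (auto simp: h_def)
  also have "\<dots> = D * ((\<Sum>j\<in>{- int n..<0}. h j) + (\<Sum>j\<in>{0..<int n}. h j))"
    by (subst sum.union_disjoint[symmetric]) (auto simp: sum_distrib_left intro!: sum.cong)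
  also have "(\<Sum>j\<in>{- int n..<0}. h j) = (\<Sum>i<n. 1 / (1 + c\<^sup>2 * (real i)\<^sup>2))"
    by (rule sum.reindex_bij_witness[of _ "\<lambda>i. - int i - 1" "\<lambda>j. nat (- j - 1)"]) (auto simp: h_def m_def)
  also have "(\<Sum>j\<in>{0..<int n}. h j) = (\<Sum>i<n. 1 / (1 + c\<^sup>2 * (real i)\<^sup>2))"
    by (rule sum.reindex_bij_witness[of _ int nat]) (auto simp: h_def m_def)
  also have "D * ((\<Sum>i<n. 1 / (1 + c\<^sup>2 * (real i)\<^sup>2)) + (\<Sum>i<n. 1 / (1 + c\<^sup>2 * (real i)\<^sup>2)))
      \<le> D * ((1 + 2 / c\<^sup>2) + (1 + 2 / c\<^sup>2))"
    by (intro mult_left_mono add_mono sum_inverse_square_le c D)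
  also have "\<dots> = D * (2 + 4 / c\<^sup>2)" by (simp add: algebra_simps)
  finally show ?thesis .
qed

text \<open>Almost orthogonality: the square is expanded under the cutoff, \<open>slow_pair\<close>
  bounds each pair and \<open>cluster_sum\<close> each row of pairs. The outcome is squared
  amplitude times number of frequencies times cluster size, and later each of these three factors is
  improved for some class of frequencies.\<close>

lemma slow_mean_square:
  fixes g :: "'a \<Rightarrow> real"
  assumes R: "R \<ge> 2" and fin: "finite Z" and c: "c > 0"
    and P: "\<And>k. k \<in> Z \<Longrightarrow> slow R \<beta> (P k)"
    and cnt: "\<And>y. real (card {l\<in>Z. y \<le> g l \<and> g l < y + c / sqrt R}) \<le> D"
  shows "integral {R - 1/2 .. R + sqrt R + 1/2} (\<lambda>t. (norm (\<Sum>k\<in>Z. ee (t * g k) * P k t))\<^sup>2)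
    \<le> (32 + 64 / c\<^sup>2) * sqrt R * \<beta>\<^sup>2 * real (card Z) * D"
proof -
  define I where "I = {R - 3/2 * sqrt R .. R + 5/2 * sqrt R}"
  define J where "J = {R - 1/2 .. R + sqrt R + 1/2}"
  define F where "F t = (\<Sum>k\<in>Z. ee (t * g k) * P k t)" for t
  define T where "T k l t = of_real (bump R t) * (P k t * cnj (P l t)) * ee (t * (g k - g l))" for k l t
  have s14: "sqrt R \<ge> 14/10" by (rule real_le_rsqrt) (use R in \<open>simp add: power2_eq_square\<close>)
  have JI: "J \<subseteq> I" using s14 by (auto simp: I_def J_def)
  have cF: "continuous_on S F" for S
    unfolding F_def by (intro continuous_intros slow_continuous[OF P])
  have cb: "continuous_on S (bump R)" for S
    unfolding bump_def by (cases "R = 0") (use R in \<open>auto intro!: continuous_intros\<close>)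
  have cT: "continuous_on S (T k l)" if "k \<in> Z" "l \<in> Z" for k l S
    unfolding T_def using cb by (intro continuous_intros slow_continuous[OF P] that)
  have iT: "T k l integrable_on I" if "k \<in> Z" "l \<in> Z" for k l
    unfolding I_def by (intro integrable_continuous_real cT that)
  have eq: "complex_of_real (bump R t * (norm (F t))\<^sup>2) = (\<Sum>k\<in>Z. \<Sum>l\<in>Z. T k l t)" for t
  proof -
    have "complex_of_real ((norm (F t))\<^sup>2) = F t * cnj (F t)" by (rule complex_norm_square)
    also have "\<dots> = (\<Sum>k\<in>Z. \<Sum>l\<in>Z. (ee (t * g k) * P k t) * cnj (ee (t * g l) * P l t))"
      by (simp add: F_def cnj_sum sum_product)
    finally show ?thesis
      by (simp add: T_def sum_distrib_left right_diff_distrib ee_diff cnj_ee mult_ac)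
  qed
  have "integral J (\<lambda>t. (norm (F t))\<^sup>2) \<le> integral J (\<lambda>t. 2 * (bump R t * (norm (F t))\<^sup>2))"
  proof (intro integral_le)
    show "(norm (F t))\<^sup>2 \<le> 2 * (bump R t * (norm (F t))\<^sup>2)" if "t \<in> J" for t
    proof -
      have "1 * (norm (F t))\<^sup>2 \<le> (2 * bump R t) * (norm (F t))\<^sup>2"
        using bump_ge_half[OF R that[unfolded J_def]] by (intro mult_right_mono) simp_all
      then show ?thesis by simp
    qed
  qed (auto simp: J_def intro!: integrable_continuous_real continuous_intros cF cb)
  also have "\<dots> \<le> integral I (\<lambda>t. 2 * (bump R t * (norm (F t))\<^sup>2))"
    by (intro integral_subset_le JI)
      (auto simp: I_def J_def bump_nonneg intro!: integrable_continuous_real continuous_intros cF cb)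
  also have "\<dots> = 2 * integral I (\<lambda>t. bump R t * (norm (F t))\<^sup>2)" by simp
  also have "integral I (\<lambda>t. bump R t * (norm (F t))\<^sup>2) = Re (integral I (\<lambda>t. complex_of_real (bump R t * (norm (F t))\<^sup>2)))"
    using integral_linear[OF _ bounded_linear_Re, of "\<lambda>t. complex_of_real (bump R t * (norm (F t))\<^sup>2)" I]
    by (simp add: o_def I_def integrable_continuous_real continuous_intros cF cb del: of_real_mult of_real_power)
  also have "\<dots> \<le> norm (integral I (\<lambda>t. complex_of_real (bump R t * (norm (F t))\<^sup>2)))"
    by (rule complex_Re_le_cmod)
  also have "integral I (\<lambda>t. complex_of_real (bump R t * (norm (F t))\<^sup>2)) = (\<Sum>k\<in>Z. \<Sum>l\<in>Z. integral I (T k l))"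
    unfolding eq using iT by (subst integral_sum) (auto intro!: fin integrable_sum sum.cong integral_sum)
  also have "norm \<dots> \<le> (\<Sum>k\<in>Z. \<Sum>l\<in>Z. 8 * sqrt R * \<beta> * \<beta> / (1 + R * (g k - g l)\<^sup>2))"
    unfolding T_def I_def
    by (intro sum_norm_le slow_pair R P slow_cnj) 
  also have "\<dots> = 8 * sqrt R * \<beta>\<^sup>2 * (\<Sum>k\<in>Z. \<Sum>l\<in>Z. 1 / (1 + R * (g k - g l)\<^sup>2))"
    by (simp add: sum_distrib_left power2_eq_square mult.assoc)
  also have "\<dots> \<le> 8 * sqrt R * \<beta>\<^sup>2 * (\<Sum>k\<in>Z. D * (2 + 4 / c\<^sup>2))"
    using R by (intro mult_left_mono sum_mono cluster_sum[OF fin _ c cnt]) auto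
  finally show ?thesis unfolding J_def F_def by (simp add: algebra_simps)
qed

section \<open>Fourier integrals of concave functions\<close>

text \<open>The Green function of \<open>-d\<^sup>2/du\<^sup>2\<close> on \<open>{0..D}\<close> with Dirichlet conditions. Nonnegative combinations
  of the functions \<open>green D v\<close> approximate every concave function vanishing at the ends.\<close>
definition green :: "real \<Rightarrow> real \<Rightarrow> real \<Rightarrow> real" where
  "green D v u = min u v - u * v / D"

lemma green_sym: "D > 0 \<Longrightarrow> green D v (D - a) = green D (D - v) a"
  by (simp add: green_def min_def field_simps)

text \<open>In the left half the correction \<open>a v / D\<close> removes at most half of
  \<open>min a v\<close>. A bound for a combination of Green functions thus bounds its masses near
  the end.\<close>

lemma green_ge:
  assumes "0 \<le> a" "a \<le> D / 2" "0 \<le> v" "v \<le> D / 2" "D > 0"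
  shows "min a v \<le> 2 * green D v a"
proof -
  have "a * v = min a v * max a v" by (simp add: min_def max_def)
  also have "\<dots> \<le> min a v * (D / 2)" using assms by (intro mult_left_mono) auto
  finally have "a * v / D \<le> min a v * (D / 2) / D"
    using assms by (intro divide_right_mono) auto
  also have "\<dots> = min a v / 2" using assms by simp
  finally have "a * v / D \<le> min a v / 2" .
  moreover have "m \<le> 2 * (m - x)" if "x \<le> m / 2" for m x :: real using that by simp
  ultimately show ?thesis unfolding green_def by blast
qed

lemma green_affine:
  assumes "v \<le> a \<or> b \<le> v" "a \<le> b" "0 \<le> l" "l \<le> 1"
  shows "green D v ((1 - l) * a + l * b) = (1 - l) * green D v a + l * green D v b"
proof -
  have ge: "a \<le> (1 - l) * a + l * b" using assms mult_left_mono[of a b l] by (simp add: algebra_simps)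
  have le: "(1 - l) * a + l * b \<le> b" using assms mult_left_mono[of a b "1 - l"] by (simp add: algebra_simps)
  have "min ((1 - l) * a + l * b) v = (1 - l) * min a v + l * min b v"
    using assms(1)
  proof
    assume "v \<le> a"
    with ge assms have "min ((1 - l) * a + l * b) v = v" "min a v = v" "min b v = v"
      by (auto simp: min_absorb2)
    then show ?thesis by (simp add: algebra_simps)
  next
    assume "b \<le> v"
    with le assms show ?thesis by (simp add: min_def)
  qed
  then show ?thesis unfolding green_def by (simp only:) (simp add: add_divide_distrib diff_divide_distrib algebra_simps)
qed

text \<open>Used with \<open>g\<close> the discrete Green function, whose negative second difference
  is a unit mass at one node: the identity then recovers \<open>F\<close> there from the second
  differences of \<open>F\<close>.\<close>

lemma summation_by_parts:
  fixes F g :: "nat \<Rightarrow> real"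
  shows "(\<Sum>i<m. (2 * F (i+1) - F i - F (i+2)) * g (i+1)) =
    (\<Sum>i<m. F (i+1) * (2 * g (i+1) - g i - g (i+2))) + (F m * g (m+1) - F (m+1) * g m) + (F 1 * g 0 - F 0 * g 1)"
  by (induction m) (simp_all add: algebra_simps)

text \<open>The combination is the piecewise linear interpolation of \<open>f\<close> at equally
  spaced nodes. Concavity makes its masses nonnegative and puts its chords below \<open>f\<close>;
  uniform continuity gives \<open>\<epsilon>\<close>.\<close>

lemma concave_green_approx:
  fixes f :: "real \<Rightarrow> real"
  assumes D: "D > 0" and conc: "concave_on {0..D} f" and f0: "f 0 = 0" and fD: "f D = 0"
    and cont: "continuous_on {0..D} f" and \<epsilon>: "\<epsilon> > 0"
  obtains I :: "nat set" and \<nu> v where "finite I" "\<And>i. i \<in> I \<Longrightarrow> \<nu> i \<ge> 0"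
    "\<And>i. i \<in> I \<Longrightarrow> 0 < v i \<and> v i < D"
    "\<And>u. u \<in> {0..D} \<Longrightarrow> (\<Sum>i\<in>I. \<nu> i * green D (v i) u) \<le> f u"
    "\<And>u. u \<in> {0..D} \<Longrightarrow> f u \<le> (\<Sum>i\<in>I. \<nu> i * green D (v i) u) + \<epsilon>"
proof -
  have "uniformly_continuous_on {0..D} f" by (rule compact_uniformly_continuous[OF cont]) simp
  then obtain \<delta> where \<delta>: "\<delta> > 0" "\<And>x y. x \<in> {0..D} \<Longrightarrow> y \<in> {0..D} \<Longrightarrow> dist y x < \<delta> \<Longrightarrow> dist (f y) (f x) < \<epsilon>"
    unfolding uniformly_continuous_on_def using \<epsilon> by metis
  obtain n0 :: nat where n0: "D / \<delta> < n0" using reals_Archimedean2 by blast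
  define n where "n = Suc n0"
  have n: "n > 0" "D / n < \<delta>"
  proof -
    have "D / \<delta> < n" using n0 by (simp add: n_def)
    then show "D / n < \<delta>" using \<delta> by (simp add: field_simps n_def)
  qed (simp add: n_def)
  define x where "x j = real j * (D / n)" for j :: nat
  define F where "F j = f (x j)" for j
  \<comment> \<open>The drop of slope of the interpolation at the node \<open>v i\<close>.\<close>
  define \<nu> where "\<nu> i = (n / D) * (2 * F (i+1) - F i - F (i+2))" for i
  define v where "v i = x (i + 1)" for i
  define S where "S u = (\<Sum>i<n0. \<nu> i * green D (v i) u)" for u
  have xin: "x j \<in> {0..D}" if "j \<le> n" for j
    using that n D by (auto simp: x_def field_simps)
  have nu: "\<nu> i \<ge> 0" if "i < n0" for i
  proof -
    have "F (i+1) \<ge> (1 - 1/2) * F i + 1/2 * F (i+2)"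
    proof -
      have "x (i+1) = (1 - 1/2) *\<^sub>R x i + (1/2) *\<^sub>R x (i+2)" using n by (simp add: x_def field_simps)
      then show ?thesis unfolding F_def
        using concave_onD[OF conc, of "1/2" "x i" "x (i+2)"] xin[of i] xin[of "i+2"] that n_def by simp
    qed
    then show ?thesis using D by (simp add: \<nu>_def)
  qed
  have v: "0 < v i \<and> v i < D" if "i < n0" for i
  proof -
    have "real (i+1) < real n" using that by (simp add: n_def)
    then have "x (i + 1) < real n * (D / n)" unfolding x_def using D n by (intro mult_strict_right_mono) auto
    then show ?thesis using D n by (auto simp: v_def x_def)
  qed
  have node: "S (x j) = F j" if "j \<le> n" for j
  proof (cases "j = 0 \<or> j = n")
    case True
    have "green D (v i) (x j) = 0" if "i < n0" for i
      using True v[OF that] D n by (auto simp: green_def x_def)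
    then have "S (x j) = 0" by (simp add: S_def)
    moreover have "F j = 0" using True f0 fD n by (auto simp: F_def x_def)
    ultimately show ?thesis by simp
  next
    case False
    then have j: "j \<ge> 1" "j < n" using that by auto
    define g where "g i = min (real i) (real j) - real i * real j / n" for i :: nat
    have gx: "green D (v i) (x j) = (D / n) * g (i+1)" for i
    proof -
      have "min (x j) (x (i+1)) = min (real (i+1)) (real j) * (D / n)"
        unfolding x_def using D by (subst min_mult_distrib_right) (auto simp: min.commute)
      moreover have "x j * x (i+1) / D = real (i+1) * real j / n * (D / n)"
        unfolding x_def using D n by (simp add: field_simps)
      ultimately show ?thesis unfolding green_def v_def g_def by (simp only: left_diff_distrib mult.commute[of "D / n"])
    qed
    have sum: "S (x j) = (\<Sum>i<n0. (2 * F (i+1) - F i - F (i+2)) * g (i+1))"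
      unfolding S_def gx \<nu>_def using D n by (intro sum.cong) auto
    have g2: "2 * g (i+1) - g i - g (i+2) = (if i + 1 = j then 1 else 0)" for i
      using n j by (auto simp: g_def min_def field_simps)
    have b: "F n0 * g (n0+1) - F (n0+1) * g n0 = 0" "F 1 * g 0 - F 0 * g 1 = 0"
      using f0 fD n j by (auto simp: F_def x_def g_def n_def)
    have "S (x j) = (\<Sum>i<n0. F (i+1) * (if i + 1 = j then 1 else 0))"
      unfolding sum summation_by_parts b g2 by simp
    also have "\<dots> = (\<Sum>i<n0. if i = j - 1 then F j else 0)"
      using j by (intro sum.cong) auto
    also have "\<dots> = F j" using j n_def by auto
    finally show ?thesis .
  qed
  have main: "S u \<le> f u \<and> f u \<le> S u + \<epsilon>" if u: "u \<in> {0..D}" for u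
  proof -
    \<comment> \<open>The index of the mesh interval that contains \<open>u\<close>; the minimum
      puts \<open>u = D\<close> into the last one.\<close>
    define j where "j = min n0 (nat \<lfloor>u * n / D\<rfloor>)"
    have un: "0 \<le> u * n / D" "u * n / D \<le> n" using u D n by (auto simp: field_simps)
    have jj: "real j \<le> u * n / D" "u * n / D \<le> j + 1"
    proof -
      have "real (nat \<lfloor>u * n / D\<rfloor>) \<le> u * n / D" using un by linarith
      then show "real j \<le> u * n / D" unfolding j_def by linarith
      show "u * n / D \<le> j + 1"
      proof (cases "nat \<lfloor>u * n / D\<rfloor> \<le> n0")
        case True
        then have "real j = real (nat \<lfloor>u * n / D\<rfloor>)" by (simp add: j_def)
        then show ?thesis by linarith
      next
        case False
        then have "j = n0" by (simp add: j_def)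
        then show ?thesis using un by (simp add: n_def)
      qed
    qed
    have jn: "j + 1 \<le> n" by (simp add: j_def n_def)
    define l where "l = u * n / D - j"
    have l: "0 \<le> l" "l \<le> 1" using jj by (auto simp: l_def)
    have ueq: "u = (1 - l) * x j + l * x (j + 1)"
      using D n by (simp add: l_def x_def field_simps)
    have xs: "x j \<le> x (j + 1)" using D by (simp add: x_def divide_right_mono)
    have "S u = (1 - l) * S (x j) + l * S (x (j+1))"
    proof -
      have gr: "green D (v i) u = (1 - l) * green D (v i) (x j) + l * green D (v i) (x (j+1))" for i
      proof -
        have "v i \<le> x j \<or> x (j + 1) \<le> v i"
        proof (cases "i + 1 \<le> j")
          case True
          then have "real (i+1) * (D/n) \<le> real j * (D/n)" using D by (intro mult_right_mono) auto
          then show ?thesis by (simp add: v_def x_def)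
        next
          case False
          then have "real (j+1) * (D/n) \<le> real (i+1) * (D/n)" using D by (intro mult_right_mono) auto
          then show ?thesis by (simp add: v_def x_def)
        qed
        then show ?thesis unfolding ueq by (rule green_affine[OF _ xs l])
      qed
      show ?thesis unfolding S_def gr sum_distrib_left sum.distrib[symmetric] by (intro sum.cong) (auto simp: algebra_simps)
    qed
    also have "\<dots> = (1 - l) * F j + l * F (j+1)" using node jn by simp
    finally have Su: "S u = (1 - l) * F j + l * F (j+1)" .
    have "f ((1 - l) *\<^sub>R x j + l *\<^sub>R x (j+1)) \<ge> (1 - l) * F j + l * F (j+1)"
      unfolding F_def using concave_onD[OF conc, of l "x j" "x (j+1)"] l xin[of j] xin[of "j+1"] jn by simp
    then have le: "S u \<le> f u" unfolding Su using ueq by simp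
    have ux: "x j \<le> u" "u \<le> x (j+1)"
    proof -
      have "real j * D \<le> u * n" using jj(1) D by (simp add: field_simps)
      then show "x j \<le> u" using n by (simp add: x_def field_simps)
      have "u * n \<le> (j + 1) * D" using jj(2) D by (simp add: field_simps)
      then show "u \<le> x (j+1)" using n by (simp add: x_def field_simps)
    qed
    moreover have "x (j+1) - x j = D / n" by (simp add: x_def add_divide_distrib algebra_simps)
    ultimately have "dist u (x j) < \<delta>" "dist u (x (j+1)) < \<delta>" using n(2) by (auto simp: dist_real_def)
    then have d: "f u \<le> F j + \<epsilon>" "f u \<le> F (j+1) + \<epsilon>"
      using \<delta>(2)[of "x j" u] \<delta>(2)[of "x (j+1)" u] xin[of j] xin[of "j+1"] jn u by (auto simp: F_def dist_real_def)
    have "f u = (1 - l) * f u + l * f u" by (simp add: algebra_simps)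
    also have "\<dots> \<le> (1 - l) * (F j + \<epsilon>) + l * (F (j+1) + \<epsilon>)" using d l by (intro add_mono mult_left_mono) auto
    also have "\<dots> = S u + \<epsilon>" by (simp add: Su algebra_simps)
    finally show ?thesis using le by simp
  qed
  show thesis
    by (rule that[of "{..<n0}" \<nu> v]) (use nu v main S_def in auto)
qed

section \<open>Transforms of the Green function and of its combinations\<close>

lemma integral_affine_ee:
  assumes t: "t \<noteq> 0" and ab: "a \<le> b"
  defines "c \<equiv> - (of_real (2 * pi * t) * \<i>)"
  shows "((\<lambda>u. of_real (p + q * u) * ee (- (t * u))) has_integral
    (of_real (p + q * b) / c - of_real q / c\<^sup>2) * ee (- (t * b)) - (of_real (p + q * a) / c - of_real q / c\<^sup>2) * ee (- (t * a))) {a..b}"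
proof -
  have c: "c \<noteq> 0" using t by (simp add: c_def)
  have de: "((\<lambda>u. ee (- (t * u))) has_vector_derivative c * ee (- (t * u))) (at u within {a..b})" for u
    using has_vector_derivative_ee[of "-t" u "{a..b}"]
    by (simp add: c_def scaleR_conv_of_real mult_ac)
  have "((\<lambda>u. (of_real (p + q * u) / c - of_real q / c\<^sup>2) * ee (- (t * u))) has_vector_derivative
     of_real (p + q * u) * ee (- (t * u))) (at u within {a..b})" for u
  proof -
    have "((\<lambda>u. of_real (p + q * u)) has_vector_derivative complex_of_real q) (at u within {a..b})"
      by (intro has_vector_derivative_of_real) (auto intro!: derivative_eq_intros simp flip: has_real_derivative_iff_has_vector_derivative)
    then have "((\<lambda>u. (of_real (p + q * u) / c - of_real q / c\<^sup>2) * ee (- (t * u))) has_vector_derivative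
       ((of_real (p + q * u) / c - of_real q / c\<^sup>2) * (c * ee (- (t * u))) + (of_real q / c - 0) * ee (- (t * u)))) (at u within {a..b})"
      by (intro has_vector_derivative_mult de has_vector_derivative_diff has_vector_derivative_divide has_vector_derivative_const)
    moreover have "(of_real (p + q * u) / c - of_real q / c\<^sup>2) * (c * ee (- (t * u))) + (of_real q / c - 0) * ee (- (t * u))
       = of_real (p + q * u) * ee (- (t * u))"
      using c by (simp add: field_simps power2_eq_square)
    ultimately show ?thesis by simp
  qed
  then show ?thesis by (intro fundamental_theorem_of_calculus[OF ab])
qed

text \<open>Extended by zero, \<open>green D v\<close> has as second derivative a mass -1 at
  \<open>v\<close> and masses \<open>1 - v / D\<close> at 0 and \<open>v / D\<close> at
  \<open>D\<close>; the right-hand side is minus the transform of these three masses.\<close>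

lemma green_fourier:
  assumes t: "t \<noteq> 0" and v: "0 < v" "v < D"
  shows "of_real (4 * pi\<^sup>2 * t\<^sup>2) * integral {0..D} (\<lambda>u. of_real (green D v u) * ee (- (t * u)))
    = of_real (v / D) * (1 - ee (- (t * D))) - (1 - ee (- (t * v)))"
proof -
  define c where "c = - (of_real (2 * pi * t) * \<i>)"
  have c: "c \<noteq> 0" using t by (simp add: c_def)
  have c2: "c\<^sup>2 = - of_real (4 * pi\<^sup>2 * t\<^sup>2)" by (simp add: c_def power_mult_distrib)
  have D: "D > 0" using v by simp
  have "((\<lambda>u. of_real (green D v u) * ee (- (t * u))) has_integral
      (of_real (0 + (1 - v/D) * v) / c - of_real (1 - v/D) / c\<^sup>2) * ee (- (t * v)) - (of_real (0 + (1 - v/D) * 0) / c - of_real (1 - v/D) / c\<^sup>2) * ee (- (t * 0))) {0..v}"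
    by (rule has_integral_eq[OF _ integral_affine_ee[OF t, of 0 v 0 "1 - v/D", folded c_def]])
      (use v in \<open>auto simp: green_def field_simps\<close>)
  moreover have "((\<lambda>u. of_real (green D v u) * ee (- (t * u))) has_integral
      (of_real (v + (- (v/D)) * D) / c - of_real (- (v/D)) / c\<^sup>2) * ee (- (t * D)) - (of_real (v + (- (v/D)) * v) / c - of_real (- (v/D)) / c\<^sup>2) * ee (- (t * v))) {v..D}"
    by (rule has_integral_eq[OF _ integral_affine_ee[OF t, of v D v "- (v/D)", folded c_def]])
      (use v in \<open>auto simp: green_def field_simps\<close>)
  ultimately have "((\<lambda>u. of_real (green D v u) * ee (- (t * u))) has_integral
     ((of_real (0 + (1 - v/D) * v) / c - of_real (1 - v/D) / c\<^sup>2) * ee (- (t * v)) - (of_real (0 + (1 - v/D) * 0) / c - of_real (1 - v/D) / c\<^sup>2) * ee (- (t * 0)))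
   + ((of_real (v + (- (v/D)) * D) / c - of_real (- (v/D)) / c\<^sup>2) * ee (- (t * D)) - (of_real (v + (- (v/D)) * v) / c - of_real (- (v/D)) / c\<^sup>2) * ee (- (t * v)))) {0..D}"
    by (rule has_integral_combine[rotated 2]) (use v in auto)
  then have "integral {0..D} (\<lambda>u. of_real (green D v u) * ee (- (t * u))) =
     ((of_real (0 + (1 - v/D) * v) / c - of_real (1 - v/D) / c\<^sup>2) * ee (- (t * v)) - (of_real (0 + (1 - v/D) * 0) / c - of_real (1 - v/D) / c\<^sup>2) * ee (- (t * 0)))
   + ((of_real (v + (- (v/D)) * D) / c - of_real (- (v/D)) / c\<^sup>2) * ee (- (t * D)) - (of_real (v + (- (v/D)) * v) / c - of_real (- (v/D)) / c\<^sup>2) * ee (- (t * v)))"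
    by (rule integral_unique)
  also have "\<dots> = (1 - of_real (v/D) + of_real (v/D) * ee (- (t * D)) - ee (- (t * v))) / c\<^sup>2"
    using c D by (simp add: field_simps power2_eq_square)
  finally have i: "integral {0..D} (\<lambda>u. of_real (green D v u) * ee (- (t * u))) =
    (1 - of_real (v/D) + of_real (v/D) * ee (- (t * D)) - ee (- (t * v))) / - of_real (4 * pi\<^sup>2 * t\<^sup>2)"
    unfolding c2 .
  have nz: "complex_of_real (4 * pi\<^sup>2 * t\<^sup>2) \<noteq> 0" using t by (simp only: of_real_eq_0_iff) simp
  have "z * (Y / - z) = - Y" if "z \<noteq> 0" for z Y :: complex using that by simp
  from this[OF nz] show ?thesis unfolding i by (simp only:) (simp add: algebra_simps)
qed

text \<open>All masses sit within \<open>r / sqrt R\<close> of the end, so each derivative in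
  \<open>t\<close> costs at most \<open>R^(-1/2)\<close>. For \<open>|t| \<le> 4 R\<close>,
  \<open>ee (t w) - 1\<close> is at most of order \<open>R / r\<close> times
  \<open>min (r / R) |w|\<close>, and the value of a concave function at depth \<open>r / R\<close>
  controls the sum of these minima.\<close>

lemma slow_atoms:
  assumes R: "R \<ge> 1" and r: "0 < r" "r \<le> 1" and I: "finite I"
    and nu: "\<And>i. i \<in> I \<Longrightarrow> \<nu> i \<ge> 0" and w: "\<And>i. i \<in> I \<Longrightarrow> \<bar>w i\<bar> \<le> r / sqrt R"
    and F: "(\<Sum>i\<in>I. \<nu> i * min (r / R) \<bar>w i\<bar>) \<le> 2 * F"
  shows "slow R (32 * pi * R / r * F) (\<lambda>t. \<Sum>i\<in>I. of_real (\<nu> i) * (ee (t * w i) - 1))"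
proof -
  define s where "s = sqrt R"
  have s: "s \<ge> 1" "R = s * s" using R by (auto simp: s_def)
  define P where "P t = (\<Sum>i\<in>I. of_real (\<nu> i) * (ee (t * w i) - 1))" for t
  define P1 where "P1 t = (\<Sum>i\<in>I. of_real (\<nu> i) * ((2 * pi * w i) *\<^sub>R (\<i> * ee (t * w i))))" for t
  define P2 where "P2 t = (\<Sum>i\<in>I. of_real (\<nu> i) * ((2 * pi * w i) *\<^sub>R (\<i> * ((2 * pi * w i) *\<^sub>R (\<i> * ee (t * w i))))))" for t
  have d1: "(P has_vector_derivative P1 t) (at t)" for t
  proof -
    have "(P has_vector_derivative (\<Sum>i\<in>I. of_real (\<nu> i) * ((2 * pi * w i) *\<^sub>R (\<i> * ee (t * w i)) - 0))) (at t)"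
      unfolding P_def by (intro has_vector_derivative_sum has_vector_derivative_mult_right has_vector_derivative_diff has_vector_derivative_ee has_vector_derivative_const)
    then show ?thesis by (simp add: P1_def)
  qed
  have d2: "(P1 has_vector_derivative P2 t) (at t)" for t
    unfolding P1_def P2_def
    by (intro has_vector_derivative_sum has_vector_derivative_mult_right
      bounded_linear.has_vector_derivative[OF bounded_linear_scaleR_right
        has_vector_derivative_mult_right[OF has_vector_derivative_ee]])
  define m where "m i = min (r / R) \<bar>w i\<bar>" for i
  have m0: "m i \<ge> 0" for i using R r by (simp add: m_def)
  have sm: "(\<Sum>i\<in>I. K * (\<nu> i * m i)) \<le> K * (2 * F)" if "K \<ge> 0" for K
    unfolding sum_distrib_left[symmetric] using F that by (intro mult_left_mono) (auto simp: m_def)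
  have ws: "\<bar>w i\<bar> \<le> s * m i" "(w i)\<^sup>2 \<le> m i" if i: "i \<in> I" for i
  proof -
    have ws: "\<bar>w i\<bar> \<le> r / s" using w[OF i] by (simp add: s_def)
    have "s * (r / R) = r / s" using s by (simp add: field_simps)
    moreover have "1 * \<bar>w i\<bar> \<le> s * \<bar>w i\<bar>" using s by (intro mult_right_mono) auto
    ultimately show "\<bar>w i\<bar> \<le> s * m i" using ws by (simp add: m_def min_def)
    have "\<bar>w i\<bar> * \<bar>w i\<bar> \<le> r / s * (r / s)" using ws s r by (intro mult_mono) auto
    also have "\<dots> \<le> 1 * (r / R)" unfolding s(2) using s r by (auto simp: divide_simps mult_left_le_one_le)
    finally have 1: "(w i)\<^sup>2 \<le> r / R" by (simp add: power2_eq_square)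
    have "r / s \<le> 1" using s r by (simp add: divide_simps)
    then have "\<bar>w i\<bar> * \<bar>w i\<bar> \<le> 1 * \<bar>w i\<bar>" using ws by (intro mult_right_mono) auto
    then have "(w i)\<^sup>2 \<le> \<bar>w i\<bar>" by (simp add: power2_eq_square)
    with 1 show "(w i)\<^sup>2 \<le> m i" by (simp add: m_def)
  qed
  have F0: "F \<ge> 0"
  proof -
    have "0 \<le> (\<Sum>i\<in>I. \<nu> i * m i)" using nu m0 by (intro sum_nonneg mult_nonneg_nonneg) auto
    then show ?thesis using F by (simp add: m_def)
  qed
  have nP: "norm (P t) \<le> 32 * pi * R / r * F" if t: "\<bar>t\<bar> \<le> 4 * R" for t
  proof -
    have "norm (P t) \<le> (\<Sum>i\<in>I. 8 * pi * R / r * (\<nu> i * m i))"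
      unfolding P_def
    proof (intro sum_norm_le)
      fix i assume i: "i \<in> I"
      have "norm (ee (t * w i) - 1) \<le> 8 * pi * R / r * m i"
      proof (cases "\<bar>w i\<bar> \<le> r / R")
        case True
        have "norm (ee (t * w i) - 1) \<le> 2 * pi * (\<bar>t\<bar> * \<bar>w i\<bar>)"
          using norm_1_minus_ee_le[of "t * w i"] by (simp add: norm_minus_commute abs_mult)
        also have "\<dots> \<le> 2 * pi * (4 * R * \<bar>w i\<bar>)"
          using t by (intro mult_left_mono mult_right_mono) auto
        also have "\<dots> = 8 * pi * R / 1 * \<bar>w i\<bar>" by simp
        also have "\<dots> \<le> 8 * pi * R / r * \<bar>w i\<bar>"
          using r R by (intro mult_right_mono divide_left_mono) auto
        finally show ?thesis using True by (simp add: m_def)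
      next
        case False
        have "norm (ee (t * w i) - 1) \<le> 2" using norm_1_minus_ee_le_2 by (simp add: norm_minus_commute)
        also have "\<dots> \<le> 8 * pi" using pi_gt3 by simp
        also have "\<dots> = 8 * pi * R / r * (r / R)" using r R by simp
        finally show ?thesis using False by (simp add: m_def)
      qed
      then have "\<nu> i * norm (ee (t * w i) - 1) \<le> \<nu> i * (8 * pi * R / r * m i)"
        using nu[OF i] by (intro mult_left_mono)
      then show "norm (of_real (\<nu> i) * (ee (t * w i) - 1)) \<le> 8 * pi * R / r * (\<nu> i * m i)"
        using nu[OF i] by (simp add: norm_mult mult_ac)
    qed
    also have "\<dots> \<le> 8 * pi * R / r * (2 * F)" using R r by (intro sm) auto
    also have "\<dots> \<le> 32 * pi * R / r * F" using R r F0 by (simp add: divide_right_mono)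
    finally show ?thesis .
  qed
  have nP1: "norm (P1 t) \<le> 32 * pi * R / r * F / sqrt R" for t
  proof -
    have "norm (P1 t) \<le> (\<Sum>i\<in>I. 2 * pi * s * (\<nu> i * m i))"
      unfolding P1_def
    proof (intro sum_norm_le)
      fix i assume i: "i \<in> I"
      have "\<nu> i * (2 * pi * \<bar>w i\<bar>) \<le> \<nu> i * (2 * pi * (s * m i))"
        using nu[OF i] ws[OF i] by (intro mult_left_mono) auto
      then show "norm (of_real (\<nu> i) * ((2 * pi * w i) *\<^sub>R (\<i> * ee (t * w i)))) \<le> 2 * pi * s * (\<nu> i * m i)"
        using nu[OF i] by (simp add: norm_mult abs_mult mult_ac)
    qed
    also have "\<dots> \<le> 2 * pi * s * (2 * F)" using s by (intro sm) auto
    also have "\<dots> \<le> 32 * pi * s * F / 1" using s F0 by simp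
    also have "\<dots> \<le> 32 * pi * s * F / r" using s F0 r by (intro divide_left_mono) auto
    also have "\<dots> = 32 * pi * R / r * F / sqrt R" unfolding s_def[symmetric] using s(1) by (simp add: s(2))
    finally show ?thesis .
  qed
  have nP2: "norm (P2 t) \<le> 32 * pi * R / r * F / R" for t
  proof -
    have "norm (P2 t) \<le> (\<Sum>i\<in>I. 4 * pi\<^sup>2 * (\<nu> i * m i))"
      unfolding P2_def
    proof (intro sum_norm_le)
      fix i assume i: "i \<in> I"
      have "\<nu> i * (4 * pi\<^sup>2 * (w i)\<^sup>2) \<le> \<nu> i * (4 * pi\<^sup>2 * m i)"
        using nu[OF i] ws[OF i] by (intro mult_left_mono) auto
      then show "norm (of_real (\<nu> i) * ((2 * pi * w i) *\<^sub>R (\<i> * ((2 * pi * w i) *\<^sub>R (\<i> * ee (t * w i)))))) \<le> 4 * pi\<^sup>2 * (\<nu> i * m i)"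
        using nu[OF i] by (simp add: norm_mult abs_mult power2_eq_square mult_ac)
    qed
    also have "\<dots> \<le> 4 * pi\<^sup>2 * (2 * F)" by (intro sm) auto
    also have "\<dots> = 8 * pi * (pi * F)" by (simp add: power2_eq_square)
    also have "\<dots> \<le> 8 * pi * (4 * F)" using F0 pi_less_4 by (intro mult_left_mono mult_right_mono) auto
    also have "\<dots> = 32 * pi * F / 1" by simp
    also have "\<dots> \<le> 32 * pi * F / r" using F0 r by (intro divide_left_mono) auto
    also have "\<dots> = 32 * pi * R / r * F / R" using R by simp
    finally show ?thesis .
  qed
  show ?thesis unfolding slow_def P_def[symmetric] using d1 d2 nP nP1 nP2 by blast
qed

lemma green_nonneg:
  assumes "u \<in> {0..D}" "v \<in> {0..D}" "D > 0"
  shows "green D v u \<ge> 0"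
proof -
  have "u * v = min u v * max u v" by (simp add: min_def max_def)
  also have "\<dots> \<le> min u v * D" using assms by (intro mult_left_mono) auto
  finally show ?thesis using assms unfolding green_def by (simp add: divide_simps)
qed

text \<open>Atoms of \<open>-f''\<close> within \<open>1 / sqrt R\<close> of an end of the interval oscillate in phase with that end over a
  time window of length \<open>sqrt R\<close>; the total mass of the remaining atoms is small.\<close>
lemma concave_fourier_structure:
  fixes f :: "real \<Rightarrow> real"
  assumes R: "R \<ge> 1" and r: "0 < r" "r \<le> 1" and D: "2 * r \<le> D"
    and conc: "concave_on {0..D} f" and f0: "f 0 = 0" and fD: "f D = 0"
    and cont: "continuous_on {0..D} f" and \<epsilon>: "\<epsilon> > 0"
  obtains P Q where "slow R (32 * pi * R / r * f (r / R)) P" "slow R (32 * pi * R / r * f (D - r / R)) Q"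
    "\<And>t. 0 < t \<Longrightarrow> t \<le> 4 * R \<Longrightarrow>
      norm (of_real (4 * pi\<^sup>2 * t\<^sup>2) * integral {0..D} (\<lambda>u. of_real (f u) * ee (- (t * u))) - P t - ee (- (t * D)) * Q t)
      \<le> 8 * sqrt R / r * (f (r / sqrt R) + f (D - r / sqrt R)) + \<epsilon>"
proof -
  have D0: "D > 0" using D r by simp
  \<comment> \<open>The error is integrated over length \<open>D\<close> and multiplied by
    \<open>4 pi^2 t^2\<close>, which is at most \<open>64 pi^2 R^2\<close>.\<close>
  define \<epsilon>' where "\<epsilon>' = \<epsilon> / (64 * pi\<^sup>2 * R\<^sup>2 * D)"
  have \<epsilon>': "\<epsilon>' > 0" using \<epsilon> R D0 by (simp add: \<epsilon>'_def)
  obtain I :: "nat set" and \<nu> v where I: "finite I" and nu: "\<And>i. i \<in> I \<Longrightarrow> \<nu> i \<ge> 0"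
    and v: "\<And>i. i \<in> I \<Longrightarrow> 0 < v i \<and> v i < D"
    and le: "\<And>u. u \<in> {0..D} \<Longrightarrow> (\<Sum>i\<in>I. \<nu> i * green D (v i) u) \<le> f u"
    and ge: "\<And>u. u \<in> {0..D} \<Longrightarrow> f u \<le> (\<Sum>i\<in>I. \<nu> i * green D (v i) u) + \<epsilon>'"
    by (rule concave_green_approx[OF D0 conc f0 fD cont \<epsilon>']) (rule that)
  define L where "L = {i \<in> I. v i \<le> D / 2}"
  define H where "H = {i \<in> I. \<not> v i \<le> D / 2}"
  have fin: "finite L" "finite H" and IL: "I = L \<union> H" "L \<inter> H = {}" "L \<subseteq> I" "H \<subseteq> I"
    using I by (auto simp: L_def H_def)
  have gn: "0 \<le> \<nu> i * (2 * green D (v i) y)" if "i \<in> I - X" "y \<in> {0..D}" for i y X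
    using nu[of i] v[of i] that D0 green_nonneg[of y D "v i"] by simp
  \<comment> \<open>Adding the atoms of the other half only increases the combination of Green
    functions, so \<open>f y\<close> bounds the masses in this half, weighted by
    \<open>min y v\<close>.\<close>
  have low: "(\<Sum>i\<in>L. \<nu> i * min y (v i)) \<le> 2 * f y" if y: "0 \<le> y" "y \<le> D / 2" for y
  proof -
    have "(\<Sum>i\<in>L. \<nu> i * min y (v i)) \<le> (\<Sum>i\<in>L. \<nu> i * (2 * green D (v i) y))"
      using y D0 v nu by (intro sum_mono mult_left_mono green_ge) (auto simp: L_def less_imp_le)
    also have "\<dots> \<le> (\<Sum>i\<in>I. \<nu> i * (2 * green D (v i) y))"
      by (rule sum_mono2[OF I IL(3) gn]) (use y D0 in auto)
    also have "\<dots> = 2 * (\<Sum>i\<in>I. \<nu> i * green D (v i) y)" by (simp add: sum_distrib_left mult_ac)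
    also have "\<dots> \<le> 2 * f y" using le[of y] y D0 by auto
    finally show ?thesis .
  qed
  have high: "(\<Sum>i\<in>H. \<nu> i * min y (D - v i)) \<le> 2 * f (D - y)" if y: "0 \<le> y" "y \<le> D / 2" for y
  proof -
    have "(\<Sum>i\<in>H. \<nu> i * min y (D - v i)) \<le> (\<Sum>i\<in>H. \<nu> i * (2 * green D (D - v i) y))"
      using y D0 v nu by (intro sum_mono mult_left_mono green_ge) (auto simp: H_def less_imp_le)
    also have "\<dots> = (\<Sum>i\<in>H. \<nu> i * (2 * green D (v i) (D - y)))" by (simp add: green_sym D0)
    also have "\<dots> \<le> (\<Sum>i\<in>I. \<nu> i * (2 * green D (v i) (D - y)))"
      by (rule sum_mono2[OF I IL(4) gn]) (use y D0 in auto)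
    also have "\<dots> = 2 * (\<Sum>i\<in>I. \<nu> i * green D (v i) (D - y))" by (simp add: sum_distrib_left mult_ac)
    also have "\<dots> \<le> 2 * f (D - y)" using le[of "D - y"] y D0 by auto
    finally show ?thesis .
  qed
  define a where "a = r / R"
  define b where "b = r / sqrt R"
  have sR: "sqrt R \<ge> 1" using R by simp
  have ab: "0 < a" "a \<le> D / 2" "0 < b" "b \<le> D / 2" "2 * b \<le> D"
  proof -
    have "r / R \<le> r / 1" using r R by (intro divide_left_mono) auto
    moreover have "r / sqrt R \<le> r / 1" using r sR by (intro divide_left_mono) auto
    ultimately show "a \<le> D / 2" "b \<le> D / 2" "2 * b \<le> D" using D unfolding a_def b_def by linarith+
  qed (use r R in \<open>auto simp: a_def b_def\<close>)
  \<comment> \<open>Atoms within \<open>b\<close> of their end keep their oscillation inside the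
    amplitude; the others go into the remainder.\<close>
  define L' where "L' = {i \<in> L. v i \<le> b}"
  define H' where "H' = {i \<in> H. D - v i \<le> b}"
  have fin': "finite L'" "finite H'" using I by (auto simp: L'_def H'_def L_def H_def)
  define P where "P t = (\<Sum>i\<in>L'. of_real (\<nu> i) * (ee (t * (- v i)) - 1))" for t
  define Q where "Q t = (\<Sum>i\<in>H'. of_real (\<nu> i) * (ee (t * (D - v i)) - 1))" for t
  have sP: "slow R (32 * pi * R / r * f a) P" unfolding P_def
  proof (intro slow_atoms R r)
    have "(\<Sum>i\<in>L'. \<nu> i * min (r / R) \<bar>- v i\<bar>) = (\<Sum>i\<in>L'. \<nu> i * min a (v i))"
      by (intro sum.cong) (auto simp: L'_def L_def a_def abs_of_pos v)
    also have "\<dots> \<le> (\<Sum>i\<in>L. \<nu> i * min a (v i))"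
      using fin nu v ab by (intro sum_mono2) (auto simp: L'_def L_def less_imp_le)
    also have "\<dots> \<le> 2 * f a" using ab by (intro low) auto
    finally show "(\<Sum>i\<in>L'. \<nu> i * min (r / R) \<bar>- v i\<bar>) \<le> 2 * f a" .
  qed (rule fin', use nu in \<open>auto simp: L'_def L_def b_def abs_of_pos v\<close>)
  have sQ: "slow R (32 * pi * R / r * f (D - a)) Q" unfolding Q_def
  proof (intro slow_atoms R r)
    have "(\<Sum>i\<in>H'. \<nu> i * min (r / R) \<bar>D - v i\<bar>) = (\<Sum>i\<in>H'. \<nu> i * min a (D - v i))"
      by (intro sum.cong) (auto simp: H'_def H_def a_def abs_of_pos v)
    also have "\<dots> \<le> (\<Sum>i\<in>H. \<nu> i * min a (D - v i))"
      using fin nu v ab by (intro sum_mono2) (auto simp: H'_def H_def less_imp_le)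
    also have "\<dots> \<le> 2 * f (D - a)" using ab by (intro high) auto
    finally show "(\<Sum>i\<in>H'. \<nu> i * min (r / R) \<bar>D - v i\<bar>) \<le> 2 * f (D - a)" .
  qed (rule fin', use nu in \<open>auto simp: H'_def H_def b_def abs_of_pos v\<close>)
  have "norm (of_real (4 * pi\<^sup>2 * t\<^sup>2) * integral {0..D} (\<lambda>u. of_real (f u) * ee (- (t * u))) - P t - ee (- (t * D)) * Q t)
      \<le> 8 * sqrt R / r * (f (r / sqrt R) + f (D - r / sqrt R)) + \<epsilon>" if t: "0 < t" "t \<le> 4 * R" for t
  proof -
    define E where "E = ee (- (t * D))"
    define S where "S u = (\<Sum>i\<in>I. \<nu> i * green D (v i) u)" for u
    define \<tau> where "\<tau> i = of_real (v i / D) * (1 - E) - (1 - ee (- (t * v i)))" for i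
    have cg: "continuous_on X (\<lambda>u. green D w u)" for X w
      unfolding green_def using D0 by (auto intro!: continuous_intros)
    have cS: "continuous_on X S" for X unfolding S_def by (intro continuous_intros cg)
    have iS: "(\<lambda>u. of_real (S u) * ee (- (t * u))) integrable_on {0..D}"
      by (intro integrable_continuous_real continuous_intros cS)
    have if': "(\<lambda>u. of_real (f u) * ee (- (t * u))) integrable_on {0..D}"
      by (intro integrable_continuous_real continuous_intros cont)
    have intS: "of_real (4 * pi\<^sup>2 * t\<^sup>2) * integral {0..D} (\<lambda>u. of_real (S u) * ee (- (t * u))) = (\<Sum>i\<in>I. of_real (\<nu> i) * \<tau> i)"
    proof -
      have "integral {0..D} (\<lambda>u. of_real (S u) * ee (- (t * u))) =
         integral {0..D} (\<lambda>u. \<Sum>i\<in>I. of_real (\<nu> i) * (of_real (green D (v i) u) * ee (- (t * u))))"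
        by (simp add: S_def sum_distrib_right mult.assoc)
      also have "\<dots> = (\<Sum>i\<in>I. of_real (\<nu> i) * integral {0..D} (\<lambda>u. of_real (green D (v i) u) * ee (- (t * u))))"
        by (subst integral_sum) (auto intro!: I integrable_continuous_real continuous_intros cg)
      finally show ?thesis unfolding \<tau>_def E_def
        using green_fourier[of t] t v by (simp add: sum_distrib_left mult.left_commute[of "of_real (4 * pi\<^sup>2 * t\<^sup>2)"] del: of_real_mult of_real_power of_real_divide)
    qed
    have appr: "norm (of_real (4 * pi\<^sup>2 * t\<^sup>2) * integral {0..D} (\<lambda>u. of_real (f u) * ee (- (t * u))) - (\<Sum>i\<in>I. of_real (\<nu> i) * \<tau> i)) \<le> \<epsilon>"
    proof -
      have "norm (integral {0..D} (\<lambda>u. of_real (f u) * ee (- (t * u)) - of_real (S u) * ee (- (t * u)))) \<le> \<epsilon>' * measure lborel {0..D}"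
      proof (rule has_integral_bound_real[OF _ finite.emptyI integrable_integral[OF integrable_diff[OF if' iS]]])
        show "norm (of_real (f u) * ee (- (t * u)) - of_real (S u) * ee (- (t * u))) \<le> \<epsilon>'" if "u \<in> {0..D} - {}" for u
        proof -
          have "norm (of_real (f u) * ee (- (t * u)) - of_real (S u) * ee (- (t * u))) = norm (of_real (f u - S u) * ee (- (t * u)))"
            by (simp add: algebra_simps)
          also have "\<dots> = \<bar>f u - S u\<bar>" unfolding norm_mult norm_of_real by simp
          also have "\<dots> \<le> \<epsilon>'" using le[of u] ge[of u] that by (auto simp: S_def)
          finally show ?thesis .
        qed
      qed (use \<epsilon>' in auto)
      then have d: "norm (integral {0..D} (\<lambda>u. of_real (f u) * ee (- (t * u))) - integral {0..D} (\<lambda>u. of_real (S u) * ee (- (t * u)))) \<le> \<epsilon>' * D"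
        using D0 by (simp add: integral_diff[OF if' iS])
      have "t\<^sup>2 \<le> (4 * R)\<^sup>2" using t by (intro power_mono) auto
      then have "4 * pi\<^sup>2 * t\<^sup>2 * (\<epsilon>' * D) \<le> 4 * pi\<^sup>2 * (4 * R)\<^sup>2 * (\<epsilon>' * D)" using \<epsilon>' D0 by (intro mult_right_mono mult_left_mono) auto
      also have "\<dots> = \<epsilon>" using R D0 by (simp add: \<epsilon>'_def power_mult_distrib)
      finally have "4 * pi\<^sup>2 * t\<^sup>2 * (\<epsilon>' * D) \<le> \<epsilon>" .
      moreover have "4 * pi\<^sup>2 * t\<^sup>2 * norm (integral {0..D} (\<lambda>u. of_real (f u) * ee (- (t * u))) - integral {0..D} (\<lambda>u. of_real (S u) * ee (- (t * u)))) \<le> 4 * pi\<^sup>2 * t\<^sup>2 * (\<epsilon>' * D)"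
        using d by (intro mult_left_mono) auto
      ultimately have *: "4 * pi\<^sup>2 * t\<^sup>2 * norm (integral {0..D} (\<lambda>u. of_real (f u) * ee (- (t * u))) - integral {0..D} (\<lambda>u. of_real (S u) * ee (- (t * u)))) \<le> \<epsilon>"
        by (rule order.trans[rotated])
      have "\<bar>4 * pi\<^sup>2 * t\<^sup>2\<bar> = 4 * pi\<^sup>2 * t\<^sup>2" by simp
      then show ?thesis unfolding intS[symmetric] right_diff_distrib[symmetric] norm_mult norm_of_real using * by (simp only:)
    qed
    have nE: "norm E = 1" by (simp add: E_def)
    have n1E: "norm (1 - E) \<le> 2" using norm_1_minus_ee_le_2 by (simp add: E_def)
    \<comment> \<open>A close atom leaves only the multiple \<open>v i / D\<close> of
      \<open>1 - E\<close>. A distant one is at most 3, while the right-hand side is then 4.\<close>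
    have tL: "norm (\<tau> i - (if v i \<le> b then ee (t * (- v i)) - 1 else 0)) \<le> 4 / b * min b (v i)" if "i \<in> L" for i
    proof -
      have vi: "0 < v i" "v i \<le> D / 2" using that v by (auto simp: L_def)
      have n1: "norm (of_real (v i / D) * (1 - E)) \<le> v i / D * 2"
        unfolding norm_mult norm_of_real using vi D0 n1E by (intro mult_mono) auto
      show ?thesis
      proof (cases "v i \<le> b")
        case True
        have "v i / D * 2 \<le> v i / (2 * b) * 2" using ab vi by (intro mult_right_mono divide_left_mono) auto
        also have "\<dots> \<le> 4 / b * min b (v i)" using True ab vi by (simp add: divide_simps)
        finally show ?thesis using n1 True by (simp add: \<tau>_def algebra_simps)
      next
        case False
        have "norm (\<tau> i) \<le> v i / D * 2 + 2" unfolding \<tau>_def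
          using n1 norm_1_minus_ee_le_2[of "- (t * v i)"]
            norm_triangle_ineq4[of "of_real (v i / D) * (1 - E)" "1 - ee (- (t * v i))"] by linarith
        also have "v i / D * 2 \<le> 1" using vi D0 by (simp add: divide_simps)
        finally show ?thesis using False ab by simp
      qed
    qed
    \<comment> \<open>The same seen from the far end: in terms of \<open>w = D - v i\<close> the
      phase \<open>E\<close> factors out.\<close>
    have tH: "norm (\<tau> i - (if D - v i \<le> b then E * (ee (t * (D - v i)) - 1) else 0)) \<le> 4 / b * min b (D - v i)" if "i \<in> H" for i
    proof -
      define w where "w = D - v i"
      have w: "0 < w" "w \<le> D / 2" using that v by (auto simp: H_def w_def)
      have "ee (- (t * v i)) = E * ee (t * w)" unfolding E_def ee_add[symmetric] by (simp add: w_def algebra_simps)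
      moreover have "v i / D = 1 - w / D" using D0 by (simp add: w_def field_simps)
      then have "complex_of_real (v i / D) = 1 - of_real (w / D)" by (simp only: of_real_diff of_real_1)
      ultimately have \<tau>w: "\<tau> i = E * (ee (t * w) - 1) - of_real (w / D) * (1 - E)"
        unfolding \<tau>_def by (simp only:) (simp add: algebra_simps del: of_real_divide)
      have n1: "norm (of_real (w / D) * (1 - E)) \<le> w / D * 2"
        unfolding norm_mult norm_of_real using w D0 n1E by (intro mult_mono) auto
      show ?thesis
      proof (cases "w \<le> b")
        case True
        have "w / D * 2 \<le> w / (2 * b) * 2" using ab w by (intro mult_right_mono divide_left_mono) auto
        also have "\<dots> \<le> 4 / b * min b w" using True ab w by (simp add: divide_simps)
        finally show ?thesis using n1 True by (simp add: \<tau>w w_def[symmetric] norm_minus_commute)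
      next
        case False
        have "norm (E * (ee (t * w) - 1)) \<le> 2"
          using norm_1_minus_ee_le_2[of "t * w"] nE by (simp add: norm_mult norm_minus_commute)
        then have "norm (\<tau> i) \<le> 2 + w / D * 2" unfolding \<tau>w
          using n1 norm_triangle_ineq4[of "E * (ee (t * w) - 1)" "of_real (w / D) * (1 - E)"] by linarith
        also have "w / D * 2 \<le> 1" using w D0 by (simp add: divide_simps)
        finally show ?thesis using False ab by (simp add: w_def[symmetric])
      qed
    qed
    have PL: "P t = (\<Sum>i\<in>L. of_real (\<nu> i) * (if v i \<le> b then ee (t * (- v i)) - 1 else 0))"
      unfolding P_def L'_def using fin by (simp add: sum.inter_filter if_distrib cong: if_cong)
    have QH: "E * Q t = (\<Sum>i\<in>H. of_real (\<nu> i) * (if D - v i \<le> b then E * (ee (t * (D - v i)) - 1) else 0))"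
      unfolding Q_def H'_def using fin by (simp add: sum.inter_filter if_distrib sum_distrib_left mult.left_commute cong: if_cong)
    have split: "(\<Sum>i\<in>I. of_real (\<nu> i) * \<tau> i) = (\<Sum>i\<in>L. of_real (\<nu> i) * \<tau> i) + (\<Sum>i\<in>H. of_real (\<nu> i) * \<tau> i)"
      unfolding IL(1) by (rule sum.union_disjoint) (use fin IL in auto)
    have bf: "4 / b * (2 * x) = 8 * sqrt R / r * x" for x using r by (simp add: b_def)
    have e1: "norm ((\<Sum>i\<in>L. of_real (\<nu> i) * \<tau> i) - P t) \<le> 8 * sqrt R / r * f b"
    proof -
      have "norm ((\<Sum>i\<in>L. of_real (\<nu> i) * \<tau> i) - P t) \<le> (\<Sum>i\<in>L. 4 / b * (\<nu> i * min b (v i)))"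
        unfolding PL sum_subtractf[symmetric] right_diff_distrib[symmetric]
      proof (intro sum_norm_le)
        fix i assume i: "i \<in> L"
        have "\<nu> i * norm (\<tau> i - (if v i \<le> b then ee (t * (- v i)) - 1 else 0)) \<le> \<nu> i * (4 / b * min b (v i))"
          using nu i by (intro mult_left_mono tL) (auto simp: L_def)
        then show "norm (of_real (\<nu> i) * (\<tau> i - (if v i \<le> b then ee (t * (- v i)) - 1 else 0))) \<le> 4 / b * (\<nu> i * min b (v i))"
          using nu i by (simp add: norm_mult L_def mult.left_commute)
      qed
      also have "\<dots> \<le> 4 / b * (2 * f b)" unfolding sum_distrib_left[symmetric] using ab by (intro mult_left_mono low) auto
      finally show ?thesis unfolding bf .
    qed
    have e2: "norm ((\<Sum>i\<in>H. of_real (\<nu> i) * \<tau> i) - E * Q t) \<le> 8 * sqrt R / r * f (D - b)"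
    proof -
      have "norm ((\<Sum>i\<in>H. of_real (\<nu> i) * \<tau> i) - E * Q t) \<le> (\<Sum>i\<in>H. 4 / b * (\<nu> i * min b (D - v i)))"
        unfolding QH sum_subtractf[symmetric] right_diff_distrib[symmetric]
      proof (intro sum_norm_le)
        fix i assume i: "i \<in> H"
        have "\<nu> i * norm (\<tau> i - (if D - v i \<le> b then E * (ee (t * (D - v i)) - 1) else 0)) \<le> \<nu> i * (4 / b * min b (D - v i))"
          using nu i by (intro mult_left_mono tH) (auto simp: H_def)
        then show "norm (of_real (\<nu> i) * (\<tau> i - (if D - v i \<le> b then E * (ee (t * (D - v i)) - 1) else 0))) \<le> 4 / b * (\<nu> i * min b (D - v i))"
          using nu i by (simp add: norm_mult H_def mult.left_commute)
      qed
      also have "\<dots> \<le> 4 / b * (2 * f (D - b))" unfolding sum_distrib_left[symmetric] using ab by (intro mult_left_mono high) auto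
      finally show ?thesis unfolding bf .
    qed
    define X where "X = of_real (4 * pi\<^sup>2 * t\<^sup>2) * integral {0..D} (\<lambda>u. complex_of_real (f u) * ee (- (t * u)))"
    define Y where "Y = (\<Sum>i\<in>L. of_real (\<nu> i) * \<tau> i)"
    define Z where "Z = (\<Sum>i\<in>H. of_real (\<nu> i) * \<tau> i)"
    have "X - P t - E * Q t = (X - (Y + Z)) + (Y - P t) + (Z - E * Q t)" by simp
    then have "norm (X - P t - E * Q t) \<le> norm (X - (Y + Z)) + norm (Y - P t) + norm (Z - E * Q t)"
      by (metis (no_types, lifting) norm_triangle_ineq norm_triangle_mono order_refl)
    also have "\<dots> \<le> \<epsilon> + 8 * sqrt R / r * f b + 8 * sqrt R / r * f (D - b)"
      using appr e1 e2 unfolding X_def Y_def Z_def split by (intro add_mono)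
    finally show ?thesis by (simp add: X_def E_def b_def algebra_simps add_divide_distrib)
  qed
  then show thesis using that sP sQ unfolding a_def by blast
qed

section \<open>Slices of a convex domain\<close>

definition perp :: "real \<times> real \<Rightarrow> real \<times> real" where
  "perp k = (- snd k, fst k)"

text \<open>The first coordinate of a point is its inner product with \<open>k\<close>, the second
  its position along \<open>perp k\<close> in units of \<open>norm k\<close>. Slice lengths below
  are therefore divided by \<open>norm k\<close>.\<close>

definition frame :: "real \<times> real \<Rightarrow> real \<times> real \<Rightarrow> real \<times> real" where
  "frame k z = (fst z / (norm k)\<^sup>2) *\<^sub>R k + snd z *\<^sub>R perp k"

lemma inner_perp [simp]: "k \<bullet> perp k = 0" "perp k \<bullet> k = 0"
  by (simp_all add: perp_def inner_prod_def)

lemma norm_perp [simp]: "norm (perp k) = norm k"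
  by (simp add: perp_def norm_Pair norm_prod_def add.commute)

lemma inner_frame [simp]: "k \<noteq> 0 \<Longrightarrow> frame k (s, y) \<bullet> k = s"
  by (simp add: frame_def inner_add_left dot_square_norm)

lemma linear_frame: "linear (frame k)"
  by (rule linearI) (simp_all add: frame_def algebra_simps add_divide_distrib)

lemma continuous_on_frame: "continuous_on S (frame k)"
  by (rule linear_continuous_on) (simp add: linear_frame linear_conv_bounded_linear[symmetric])

lemma measurable_frame [measurable]: "frame k \<in> borel_measurable borel"
  by (rule borel_measurable_continuous_onI[OF continuous_on_frame])

lemma frame_coords: "frame k (s, y) = (s * fst k / (norm k)\<^sup>2 - y * snd k, s * snd k / (norm k)\<^sup>2 + y * fst k)"
  by (simp add: frame_def perp_def prod_eq_iff)

text \<open>The frame \<open>k / |k|\<^sup>2, perp k\<close> spans a parallelogram of area 1.\<close>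
lemma distr_frame:
  assumes k: "k \<noteq> 0"
  shows "distr lborel borel (frame k) = lborel"
proof (rule measure_eqI)
  fix A assume "A \<in> sets (distr lborel borel (frame k))"
  then have A[measurable]: "A \<in> sets borel" by simp
  obtain a b where kab: "k = (a, b)" by (cases k)
  define n where "n = a\<^sup>2 + b\<^sup>2"
  have n: "(norm k)\<^sup>2 = n" by (simp add: kab n_def norm_Pair)
  have n0: "n > 0" using k n by (metis zero_less_norm_iff zero_less_power)
  define F where "F x y = (indicator A (x, y) :: ennreal)" for x y
  have F[measurable]: "(\<lambda>(x,y). F x y) \<in> borel_measurable (borel \<Otimes>\<^sub>M borel)"
  proof -
    have "(\<lambda>z. indicator A z :: ennreal) \<in> borel_measurable borel" by simp
    then show ?thesis unfolding F_def borel_prod by (simp add: case_prod_beta)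
  qed
  have F1: "(\<lambda>x. F (g x) (h x)) \<in> borel_measurable N" if "g \<in> borel_measurable N" "h \<in> borel_measurable N" for g h N
    using measurable_compose[OF measurable_Pair[OF that] F] by simp
  have "emeasure (distr lborel borel (frame k)) A = (\<integral>\<^sup>+ z. indicator A (frame k z) \<partial>lborel)"
    by (subst nn_integral_indicator[symmetric]) (simp_all add: nn_integral_distr del: nn_integral_indicator)
  also have "\<dots> = (\<integral>\<^sup>+ z. indicator A (frame k z) \<partial>(lborel \<Otimes>\<^sub>M lborel))" by (simp add: lborel_prod)
  also have "\<dots> = (\<integral>\<^sup>+ s. \<integral>\<^sup>+ y. F (s * a / n - y * b) (s * b / n + y * a) \<partial>lborel \<partial>lborel)"
  proof (subst lborel.nn_integral_fst[symmetric])
    have "(\<lambda>z. indicator A (frame k z) :: ennreal) \<in> borel_measurable borel"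
      by measurable
    then show "(\<lambda>z. indicator A (frame k z) :: ennreal) \<in> borel_measurable (lborel \<Otimes>\<^sub>M lborel)"
      by (simp add: lborel_prod)
  qed (simp add: frame_coords n F_def, simp add: kab)
  also have "\<dots> = (\<integral>\<^sup>+ x. \<integral>\<^sup>+ y. F x y \<partial>lborel \<partial>lborel)"
  \<comment> \<open>For nonzero \<open>a\<close> the inner variable is replaced by the second
    coordinate and then, with the integrals exchanged, \<open>s\<close> by the first. This divides
    by \<open>a\<close>, so \<open>a = 0\<close> is done separately, with the roles of the
    coordinates swapped.\<close>
  proof (cases "a = 0")
    case True
    then have b: "b \<noteq> 0" "n = b * b" using n0 by (auto simp: n_def power2_eq_square)
    have "(\<integral>\<^sup>+ s. \<integral>\<^sup>+ y. F (s * a / n - y * b) (s * b / n + y * a) \<partial>lborel \<partial>lborel)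
       = (\<integral>\<^sup>+ s. \<integral>\<^sup>+ y. F (0 + (- b) * y) (0 + (1 / b) * s) \<partial>lborel \<partial>lborel)"
      using True b by (simp add: field_simps)
    also have "\<dots> = (\<integral>\<^sup>+ y. \<integral>\<^sup>+ s. F (0 + (- b) * y) (0 + (1 / b) * s) \<partial>lborel \<partial>lborel)"
      by (rule lborel_pair.Fubini') (auto intro!: F1 simp: case_prod_beta)
    also have "\<dots> = (\<integral>\<^sup>+ y. \<bar>b\<bar> * (\<integral>\<^sup>+ s. F (0 + (- b) * y) s \<partial>lborel) \<partial>lborel)"
    proof (intro nn_integral_cong)
      fix y
      have "(\<integral>\<^sup>+ s. F (0 + (- b) * y) s \<partial>lborel) = \<bar>1/b\<bar> * (\<integral>\<^sup>+ s. F (0 + (- b) * y) (0 + (1 / b) * s) \<partial>lborel)"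
        using b by (intro nn_integral_real_affine F1) auto
      then have "\<bar>b\<bar> * (\<integral>\<^sup>+ s. F (0 + (- b) * y) s \<partial>lborel) = (ennreal \<bar>b\<bar> * ennreal \<bar>1/b\<bar>) * (\<integral>\<^sup>+ s. F (0 + (- b) * y) (0 + (1 / b) * s) \<partial>lborel)"
        by (simp add: mult.assoc)
      also have "ennreal \<bar>b\<bar> * ennreal \<bar>1/b\<bar> = 1" using b by (simp add: ennreal_mult[symmetric] abs_mult[symmetric])
      finally show "(\<integral>\<^sup>+ s. F (0 + (- b) * y) (0 + (1 / b) * s) \<partial>lborel) = \<bar>b\<bar> * (\<integral>\<^sup>+ s. F (0 + (- b) * y) s \<partial>lborel)" by simp
    qed
    also have "\<dots> = \<bar>- b\<bar> * (\<integral>\<^sup>+ y. (\<integral>\<^sup>+ s. F (0 + (- b) * y) s \<partial>lborel) \<partial>lborel)"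
      by (simp, rule nn_integral_cmult) measurable
    also have "\<dots> = (\<integral>\<^sup>+ y. (\<integral>\<^sup>+ s. F y s \<partial>lborel) \<partial>lborel)"
      by (rule nn_integral_real_affine[symmetric], measurable) (use b in simp)
    finally show ?thesis .
  next
    case False
    have "(\<integral>\<^sup>+ s. \<integral>\<^sup>+ y. F (s * a / n - y * b) (s * b / n + y * a) \<partial>lborel \<partial>lborel)
      = (\<integral>\<^sup>+ s. ennreal (1 / \<bar>a\<bar>) * (\<integral>\<^sup>+ y. F ((s - b * y) / a) y \<partial>lborel) \<partial>lborel)"
    proof (intro nn_integral_cong)
      fix s
      have q: "(s - b * (s * b / n + a * y)) / a = s * a / n - y * b" for y
      proof -
        have "s * n = s * a * a + s * b * b" by (simp add: n_def power2_eq_square algebra_simps)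
        then show ?thesis using False n0 by (simp add: field_simps)
      qed
      have "(\<integral>\<^sup>+ y. F ((s - b * y) / a) y \<partial>lborel) = \<bar>a\<bar> * (\<integral>\<^sup>+ y. F ((s - b * (s * b / n + a * y)) / a) (s * b / n + a * y) \<partial>lborel)"
        using False by (intro nn_integral_real_affine F1) auto
      then have e: "(\<integral>\<^sup>+ y. F ((s - b * y) / a) y \<partial>lborel) = \<bar>a\<bar> * (\<integral>\<^sup>+ y. F (s * a / n - y * b) (s * b / n + y * a) \<partial>lborel)"
        unfolding q by (simp add: mult.commute)
      have "ennreal (1 / \<bar>a\<bar>) * ennreal \<bar>a\<bar> = 1" using False by (simp add: ennreal_mult[symmetric])
      then show "(\<integral>\<^sup>+ y. F (s * a / n - y * b) (s * b / n + y * a) \<partial>lborel) = ennreal (1 / \<bar>a\<bar>) * (\<integral>\<^sup>+ y. F ((s - b * y) / a) y \<partial>lborel)"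
        unfolding e by (simp add: mult.assoc[symmetric])
    qed
    also have "\<dots> = (\<integral>\<^sup>+ s. (\<integral>\<^sup>+ y. ennreal (1 / \<bar>a\<bar>) * F ((s - b * y) / a) y \<partial>lborel) \<partial>lborel)"
      by (intro nn_integral_cong nn_integral_cmult[symmetric] F1) auto
    also have "\<dots> = (\<integral>\<^sup>+ y. (\<integral>\<^sup>+ s. ennreal (1 / \<bar>a\<bar>) * F ((s - b * y) / a) y \<partial>lborel) \<partial>lborel)"
      by (rule lborel_pair.Fubini') (auto intro!: F1 borel_measurable_times simp: case_prod_beta)
    also have "\<dots> = (\<integral>\<^sup>+ y. (\<integral>\<^sup>+ x. F x y \<partial>lborel) \<partial>lborel)"
    proof (rule nn_integral_cong)
      fix y
      have "(\<integral>\<^sup>+ x. F x y \<partial>lborel) = \<bar>1/a\<bar> * (\<integral>\<^sup>+ s. F (- b * y / a + (1/a) * s) y \<partial>lborel)"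
        using False by (intro nn_integral_real_affine F1) auto
      moreover have q: "- b * y / a + (1/a) * s = (s - b * y) / a" for s using False by (simp add: field_simps)
      ultimately show "(\<integral>\<^sup>+ s. ennreal (1 / \<bar>a\<bar>) * F ((s - b * y) / a) y \<partial>lborel) = (\<integral>\<^sup>+ x. F x y \<partial>lborel)"
        unfolding q
        by (subst nn_integral_cmult) (auto intro!: F1)
    qed
    also have "\<dots> = (\<integral>\<^sup>+ x. \<integral>\<^sup>+ y. F x y \<partial>lborel \<partial>lborel)"
      by (rule lborel_pair.Fubini') (auto intro!: F1 simp: case_prod_beta)
    finally show ?thesis .
  qed
  also have "\<dots> = (\<integral>\<^sup>+ z. indicator A z \<partial>(lborel \<Otimes>\<^sub>M lborel))"
    unfolding F_def by (rule lborel.nn_integral_fst) (simp add: lborel_prod)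
  also have "\<dots> = emeasure lborel A" by (simp add: lborel_prod)
  finally show "emeasure (distr lborel borel (frame k)) A = emeasure lborel A" .
qed simp

text \<open>The chord condition is put in a homogeneous form, for \<open>k\<close> of any length and
  points of the open domain: the supremum minus \<open>p \<bullet> k\<close>, divided by
  \<open>norm k\<close>, is the distance of the segment from the support line, which is the
  \<open>\<delta>\<close> of the hypothesis.\<close>

locale curved_domain =
  fixes \<Omega> :: "(real \<times> real) set" and M r0 r1 :: real
  assumes conv: "convex \<Omega>" and op: "open \<Omega>"
    and r0: "0 < r0" "r0 \<le> 1" "ball 0 r0 \<subseteq> \<Omega>" and r1: "\<Omega> \<subseteq> ball 0 r1"
    and M0: "M > 0"
    and chord: "\<And>p q k. p \<in> \<Omega> \<Longrightarrow> q \<in> \<Omega> \<Longrightarrow> p \<bullet> k = q \<bullet> k \<Longrightarrow>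
      norm k * (norm (p - q))\<^sup>2 \<le> M\<^sup>2 * (Sup ((\<lambda>x. x \<bullet> k) ` \<Omega>) - p \<bullet> k)"
begin

definition rho :: "real \<times> real \<Rightarrow> real" where
  "rho k = Sup ((\<lambda>x. x \<bullet> k) ` \<Omega>)"

abbreviation K where "K \<equiv> closure \<Omega>"

lemma zero_in: "0 \<in> \<Omega>" using r0 by auto

lemma r1_pos: "0 < r1" using zero_in r1 by auto

lemma bounded_Omega: "bounded \<Omega>" using r1 bounded_ball bounded_subset by blast

lemma compact_K: "compact K" using bounded_Omega by simp

lemma convex_K: "convex K" using conv by (rule convex_closure)

lemma K_norm: "x \<in> K \<Longrightarrow> norm x \<le> r1"
  using closure_mono[OF r1] r1_pos by (auto simp: closure_ball)

lemma cball_K: "cball 0 r0 \<subseteq> K"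
  using closure_mono[OF r0(3)] r0 by (simp add: closure_ball)

lemma bdd: "bdd_above ((\<lambda>x. x \<bullet> k) ` \<Omega>)"
proof (rule bdd_aboveI2)
  fix x assume "x \<in> \<Omega>"
  then have "norm x \<le> r1" using K_norm closure_subset by blast
  then have "norm x * norm k \<le> r1 * norm k" by (rule mult_right_mono) simp
  then show "x \<bullet> k \<le> r1 * norm k" using norm_cauchy_schwarz[of x k] by linarith
qed

lemma rho_ge_open: "x \<in> \<Omega> \<Longrightarrow> x \<bullet> k \<le> rho k"
  unfolding rho_def by (rule cSup_upper[OF _ bdd]) auto

lemma rho_ge: "x \<in> K \<Longrightarrow> x \<bullet> k \<le> rho k"
proof -
  assume x: "x \<in> K"
  have "K \<subseteq> {x. k \<bullet> x \<le> rho k}"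
    using rho_ge_open[of _ k]
    by (intro closure_minimal subsetI closed_Collect_le continuous_intros) (simp_all add: inner_commute)
  then show ?thesis using x by (auto simp: inner_commute)
qed

lemma rho_le: "(\<And>x. x \<in> \<Omega> \<Longrightarrow> x \<bullet> k \<le> c) \<Longrightarrow> rho k \<le> c"
  unfolding rho_def by (rule cSup_least) (use zero_in in auto)

lemma rho_attained: obtains p where "p \<in> K" "p \<bullet> k = rho k"
proof -
  have "continuous_on K (\<lambda>x. x \<bullet> k)" by (intro continuous_intros)
  then obtain p where p: "p \<in> K" "\<And>x. x \<in> K \<Longrightarrow> x \<bullet> k \<le> p \<bullet> k"
    using continuous_attains_sup[OF compact_K, of "\<lambda>x. x \<bullet> k"] zero_in closure_subset by blast
  then have "rho k \<le> p \<bullet> k" using closure_subset by (intro rho_le) blast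
  then show ?thesis using that[of p] p(1) rho_ge[of p k] by (simp add: antisym)
qed

lemma rho_lower: "r0 * norm k \<le> rho k"
proof (cases "k = 0")
  case False
  have "(r0 / norm k) *\<^sub>R k \<in> K" using r0 False by (intro subsetD[OF cball_K]) auto
  from rho_ge[OF this, of k] show ?thesis using False by (simp add: dot_square_norm power2_eq_square)
next
  case True
  then show ?thesis using rho_ge_open[OF zero_in] by simp
qed

lemma rho_nonneg: "0 \<le> rho k" using rho_ge_open[OF zero_in] by simp

lemma rho_upper: "rho k \<le> r1 * norm k"
proof (rule rho_le)
  fix x assume "x \<in> \<Omega>"
  then have "norm x \<le> r1" using K_norm closure_subset by blast
  then have "norm x * norm k \<le> r1 * norm k" by (rule mult_right_mono) simp
  then show "x \<bullet> k \<le> r1 * norm k" using norm_cauchy_schwarz[of x k] by linarith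
qed

lemma rho_pos: "k \<noteq> 0 \<Longrightarrow> 0 < rho k"
  using rho_lower[of k] r0 by (meson less_le_trans mult_pos_pos zero_less_norm_iff)

lemma rho_add: "rho (a + b) \<le> rho a + rho b"
  by (rule rho_le) (auto simp: inner_add_right intro!: add_mono rho_ge_open)

lemma rho_scale_le: "0 \<le> c \<Longrightarrow> rho (c *\<^sub>R a) \<le> c * rho a"
  by (rule rho_le) (auto intro!: mult_left_mono rho_ge_open)

lemma rho_scale: "0 \<le> c \<Longrightarrow> rho (c *\<^sub>R a) = c * rho a"
proof (cases "c = 0")
  case False
  assume "0 \<le> c"
  then have c: "c > 0" using False by simp
  have "rho ((1/c) *\<^sub>R (c *\<^sub>R a)) \<le> (1/c) * rho (c *\<^sub>R a)" using c by (intro rho_scale_le) simp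
  then have "c * rho a \<le> rho (c *\<^sub>R a)" using c by (simp add: field_simps)
  then show ?thesis using rho_scale_le[of c a] c by simp
next
  case True
  then show ?thesis using rho_upper[of 0] rho_nonneg[of 0] by simp
qed

lemma rho_lip: "\<bar>rho a - rho b\<bar> \<le> r1 * norm (a - b)"
proof -
  have "rho a \<le> rho b + r1 * norm (a - b)" for a b
    using rho_add[of b "a - b"] rho_upper[of "a - b"] by simp
  from this[of a b] this[of b a] show ?thesis by (simp add: abs_le_iff norm_minus_commute)
qed

lemma shrink_in: "x \<in> K \<Longrightarrow> 0 < e \<Longrightarrow> e \<le> 1 \<Longrightarrow> (1 - e) *\<^sub>R x \<in> \<Omega>"
proof -
  assume "x \<in> K" "0 < e" "e \<le> 1"
  then have "x - e *\<^sub>R (x - 0) \<in> interior \<Omega>"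
    using zero_in by (intro mem_interior_closure_convex_shrink[OF conv]) (auto simp: interior_open[OF op])
  then show ?thesis by (simp add: interior_open[OF op] scaleR_diff_left)
qed

text \<open>Both points are shrunk towards the origin into \<open>\<Omega>\<close>, which keeps
  their inner products with \<open>k\<close> equal, and the factor tends to 1.\<close>

lemma chord_K:
  assumes p: "p \<in> K" and q: "q \<in> K" and pq: "p \<bullet> k = q \<bullet> k"
  shows "norm k * (norm (p - q))\<^sup>2 \<le> M\<^sup>2 * (rho k - p \<bullet> k)"
proof -
  have ineq: "norm k * ((1 - e) * norm (p - q))\<^sup>2 \<le> M\<^sup>2 * (rho k - (1 - e) * (p \<bullet> k))" if e: "0 < e" "e \<le> 1" for e
  proof -
    have "(1 - e) *\<^sub>R p - (1 - e) *\<^sub>R q = (1 - e) *\<^sub>R (p - q)" by (simp add: algebra_simps)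
    moreover have "((1 - e) *\<^sub>R p) \<bullet> k = ((1 - e) *\<^sub>R q) \<bullet> k" using pq by simp
    ultimately show ?thesis using chord[OF shrink_in[OF p e] shrink_in[OF q e], of k] e
      unfolding rho_def[symmetric] by simp
  qed
  have "((\<lambda>e. norm k * ((1 - e) * norm (p - q))\<^sup>2) \<longlongrightarrow> norm k * ((1 - 0) * norm (p - q))\<^sup>2) (at_right 0)"
    by (intro tendsto_intros)
  moreover have "((\<lambda>e. M\<^sup>2 * (rho k - (1 - e) * (p \<bullet> k))) \<longlongrightarrow> M\<^sup>2 * (rho k - (1 - 0) * (p \<bullet> k))) (at_right 0)"
    by (intro tendsto_intros)
  moreover have "\<forall>\<^sub>F e in at_right 0. norm k * ((1 - e) * norm (p - q))\<^sup>2 \<le> M\<^sup>2 * (rho k - (1 - e) * (p \<bullet> k))"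
    by (rule eventually_mono[OF eventually_at_right_real[of 0 1]]) (auto intro!: ineq)
  ultimately have "norm k * ((1 - 0) * norm (p - q))\<^sup>2 \<le> M\<^sup>2 * (rho k - (1 - 0) * (p \<bullet> k))"
    using tendsto_le trivial_limit_at_right_real by blast
  then show ?thesis by simp
qed

section \<open>Slices as compact intervals\<close>

definition slice :: "real \<times> real \<Rightarrow> real \<Rightarrow> real set" where
  "slice k s = {y. frame k (s, y) \<in> K}"

definition hi where "hi k s = Sup (slice k s)"
definition lo where "lo k s = Inf (slice k s)"

lemma slice_convex_comb:
  assumes "y \<in> slice k s" "y' \<in> slice k s'" "0 \<le> l" "l \<le> 1"
  shows "(1 - l) * y + l * y' \<in> slice k ((1 - l) * s + l * s')"
proof -
  have "(1 - l) *\<^sub>R frame k (s, y) + l *\<^sub>R frame k (s', y') = frame k ((1 - l) *\<^sub>R (s, y) + l *\<^sub>R (s', y'))"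
    by (simp only: linear_add[OF linear_frame] linear_scale[OF linear_frame])
  moreover have "(1 - l) *\<^sub>R frame k (s, y) + l *\<^sub>R frame k (s', y') \<in> K"
    using assms by (intro convexD[OF convex_K]) (auto simp: slice_def)
  ultimately show ?thesis by (simp add: slice_def)
qed

lemma slice_empty: "k \<noteq> 0 \<Longrightarrow> s \<notin> {- rho (- k)..rho k} \<Longrightarrow> slice k s = {}"
proof (rule ccontr)
  assume k: "k \<noteq> 0" "s \<notin> {- rho (- k)..rho k}" and "slice k s \<noteq> {}"
  then obtain y where "frame k (s, y) \<in> K" by (auto simp: slice_def)
  from rho_ge[OF this, of k] rho_ge[OF this, of "- k"] k show False by simp
qed

lemma frame_decomp: "k \<noteq> 0 \<Longrightarrow> x = frame k (x \<bullet> k, (x \<bullet> perp k) / (norm k)\<^sup>2)"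
proof -
  assume k: "k \<noteq> 0"
  obtain a b where kab: "k = (a, b)" by (cases k)
  obtain c d where x: "x = (c, d)" by (cases x)
  define n where "n = a * a + b * b"
  have n: "(norm k)\<^sup>2 = n" "n \<noteq> 0"
    using k by (simp_all add: n_def kab norm_Pair power2_eq_square sum_squares_eq_zero_iff zero_prod_def)
  have "(c * a + d * b) * a - (d * a - c * b) * b = c * n" "(c * a + d * b) * b + (d * a - c * b) * a = d * n"
    by (simp_all add: n_def algebra_simps)
  then have "((c * a + d * b) * a - (d * a - c * b) * b) / n = c" "((c * a + d * b) * b + (d * a - c * b) * a) / n = d"
    using n by simp_all
  moreover have "X * a / n - Y / n * b = (X * a - Y * b) / n" "X * b / n + Y / n * a = (X * b + Y * a) / n" for X Y
    by (simp_all add: diff_divide_distrib add_divide_distrib)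
  ultimately show ?thesis unfolding frame_coords n(1)
    by (simp add: kab x perp_def)
qed

lemma slice_nonempty: "k \<noteq> 0 \<Longrightarrow> s \<in> {- rho (- k)..rho k} \<Longrightarrow> slice k s \<noteq> {}"
proof -
  assume k: "k \<noteq> 0" and s: "s \<in> {- rho (- k)..rho k}"
  obtain p where p: "p \<in> K" "p \<bullet> k = rho k" using rho_attained by blast
  obtain q where q: "q \<in> K" "q \<bullet> (- k) = rho (- k)" using rho_attained by blast
  define D where "D = rho k + rho (- k)"
  have D: "D > 0" using rho_pos[of k] rho_pos[of "- k"] k(1) by (simp add: D_def add_pos_pos)
  define l where "l = (s + rho (- k)) / D"
  have l: "0 \<le> l" "l \<le> 1" using s D by (auto simp: l_def D_def)
  define x where "x = (1 - l) *\<^sub>R q + l *\<^sub>R p"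
  have xK: "x \<in> K" unfolding x_def using l p q by (intro convexD[OF convex_K]) auto
  have "q \<bullet> k = - rho (- k)" using q(2) by simp
  then have "x \<bullet> k = (1 - l) * (- rho (- k)) + l * rho k" using p by (simp add: x_def inner_add_left)
  also have "\<dots> = l * D - rho (- k)" by (simp add: D_def algebra_simps)
  also have "\<dots> = s" using D by (simp add: l_def)
  finally have "frame k (s, (x \<bullet> perp k) / (norm k)\<^sup>2) \<in> K" using frame_decomp[OF k, of x] xK by simp
  then show ?thesis by (auto simp: slice_def)
qed

lemma closed_slice: "closed (slice k s)"
proof -
  have "slice k s = (\<lambda>y. frame k (s, y)) -` K" by (auto simp: slice_def)
  moreover have "continuous_on UNIV (\<lambda>y. frame k (s, y))"
    by (rule continuous_on_compose2[OF continuous_on_frame[of UNIV]]) (auto intro!: continuous_intros)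
  ultimately show ?thesis by (simp add: continuous_closed_vimage continuous_on_eq_continuous_at)
qed

lemma compact_slice: "k \<noteq> 0 \<Longrightarrow> compact (slice k s)"
proof -
  assume k: "k \<noteq> 0"
  have "bounded (slice k s)"
  proof (rule boundedI)
    fix y assume y: "y \<in> slice k s"
    have "frame k (s, y) \<bullet> perp k = y * (norm k)\<^sup>2"
      by (simp add: frame_def inner_add_left dot_square_norm)
    moreover have "\<bar>frame k (s, y) \<bullet> perp k\<bar> \<le> r1 * norm k"
    proof -
      have "norm (frame k (s, y)) \<le> r1" using y K_norm by (simp add: slice_def)
      then have "norm (frame k (s, y)) * norm k \<le> r1 * norm k" by (rule mult_right_mono) simp
      then show ?thesis using Cauchy_Schwarz_ineq2[of "frame k (s, y)" "perp k"] by simp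
    qed
    ultimately have "\<bar>y\<bar> * (norm k)\<^sup>2 \<le> r1 * norm k" by (simp add: abs_mult)
    then show "norm y \<le> r1 / norm k" using k by (simp add: field_simps power2_eq_square)
  qed
  then show ?thesis by (simp add: compact_eq_bounded_closed closed_slice)
qed

lemma slice_eq:
  assumes "k \<noteq> 0" "s \<in> {- rho (- k)..rho k}"
  shows "slice k s = {lo k s..hi k s}" "lo k s \<in> slice k s" "hi k s \<in> slice k s" "lo k s \<le> hi k s"
proof -
  note ne = slice_nonempty[OF assms] and c = compact_slice[OF assms(1), of s]
  have b: "bdd_above (slice k s)" "bdd_below (slice k s)"
    using c by (auto simp: compact_imp_bounded bounded_imp_bdd_above bounded_imp_bdd_below)
  show l: "lo k s \<in> slice k s" unfolding lo_def using ne c b by (intro closed_contains_Inf) (auto simp: compact_imp_closed)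
  show h: "hi k s \<in> slice k s" unfolding hi_def using ne c b by (intro closed_contains_Sup) (auto simp: compact_imp_closed)
  have cv: "convex (slice k s)"
  proof (rule convexI)
    fix x y and u v :: real assume "x \<in> slice k s" "y \<in> slice k s" "0 \<le> u" "0 \<le> v" "u + v = 1"
    moreover from this have "u = 1 - v" by simp
    moreover have "(1 - v) * s + v * s = s" by (simp add: algebra_simps)
    ultimately show "u *\<^sub>R x + v *\<^sub>R y \<in> slice k s"
      using slice_convex_comb[of x k s y s v] by simp
  qed
  show "slice k s = {lo k s..hi k s}"
  proof
    show "slice k s \<subseteq> {lo k s..hi k s}" using b by (auto simp: lo_def hi_def intro: cInf_lower cSup_upper)
    show "{lo k s..hi k s} \<subseteq> slice k s"
      using cv l h by (metis convex_contains_segment closed_segment_eq_real_ivl atLeastatMost_empty_iff empty_subsetI)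
  qed
  with l show "lo k s \<le> hi k s" by auto
qed

section \<open>Slice lengths and their profile below the support line\<close>

definition len :: "real \<times> real \<Rightarrow> real \<Rightarrow> real" where
  "len k s = measure lborel (slice k s)"

lemma len_eq: "k \<noteq> 0 \<Longrightarrow> s \<in> {- rho (- k)..rho k} \<Longrightarrow> len k s = hi k s - lo k s"
  unfolding len_def using slice_eq[of k s] by simp

lemma len_nonneg: "len k s \<ge> 0" by (simp add: len_def)

lemma len_outside: "k \<noteq> 0 \<Longrightarrow> s \<notin> {- rho (- k)..rho k} \<Longrightarrow> len k s = 0"
  by (simp add: len_def slice_empty)

text \<open>The far end of the slices for \<open>k\<close> is the near end for \<open>- k\<close>,
  so that bounds at one end serve both.\<close>

lemma len_reflect: "len (- k) (- s) = len k s"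
proof -
  have "slice (- k) (- s) = uminus ` slice k s"
  proof -
    have "frame (- k) (- s, y) = frame k (s, - y)" for y by (simp add: frame_coords)
    then have "slice (- k) (- s) = {y. - y \<in> slice k s}" by (simp add: slice_def)
    also have "\<dots> = uminus ` slice k s" by (force simp: image_iff)
    finally show ?thesis .
  qed
  moreover have "measure lebesgue (uminus ` slice k s) = measure lebesgue (slice k s)"
    using measure_lebesgue_affine[of "-1" 0 "slice k s"] by simp
  moreover have "slice k s \<in> sets lborel" for k s
    using closed_slice by simp
  ultimately have "measure lebesgue (slice (- k) (- s)) = measure lebesgue (slice k s)"
    "\<And>k s. measure lebesgue (slice k s) = measure lborel (slice k s)"
    by (simp, intro measure_completion)
  then show ?thesis by (simp add: len_def)
qed

text \<open>The slice length as a function of the depth \<open>u\<close> below the support line of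
  \<open>k\<close>, in the units of \<open>frame\<close>: the chord itself has length
  \<open>norm k * prof k u\<close>, and lies at distance \<open>u / norm k\<close> from that
  line.\<close>

definition prof :: "real \<times> real \<Rightarrow> real \<Rightarrow> real" where
  "prof k u = len k (rho k - u)"

definition width :: "real \<times> real \<Rightarrow> real" where
  "width k = rho k + rho (- k)"

lemma width_ge: "2 * r0 * norm k \<le> width k"
  using rho_lower[of k] rho_lower[of "- k"] by (simp add: width_def)

lemma prof_reflect: "prof k (width k - u) = prof (- k) u"
  using len_reflect[of k "rho k - (width k - u)"] by (simp add: prof_def width_def)

lemma prof_nonneg: "prof k u \<ge> 0" by (simp add: prof_def len_nonneg)

lemma prof_ends:
  assumes k: "k \<noteq> 0" and u: "u \<in> {0..width k}"
  obtains p q where "p \<in> K" "q \<in> K" "p \<bullet> k = rho k - u" "q \<bullet> k = rho k - u"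
    "p - q = prof k u *\<^sub>R perp k"
proof -
  define s where "s = rho k - u"
  have s: "s \<in> {- rho (- k)..rho k}" using u by (auto simp: s_def width_def)
  show thesis
  proof (rule that[of "frame k (s, hi k s)" "frame k (s, lo k s)"])
    show "frame k (s, hi k s) - frame k (s, lo k s) = prof k u *\<^sub>R perp k"
      by (simp add: prof_def s_def[symmetric] len_eq[OF k s] frame_def algebra_simps)
  qed (use slice_eq[OF k s] k in \<open>auto simp: slice_def s_def\<close>)
qed

text \<open>Squaring the chord length gives two factors \<open>norm k\<close>, converting the depth
  into a distance gives the third.\<close>

lemma prof_chord:
  assumes k: "k \<noteq> 0" and u: "0 \<le> u"
  shows "(norm k)^3 * (prof k u)\<^sup>2 \<le> M\<^sup>2 * u"
proof (cases "u \<le> width k")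
  case True
  then have u': "u \<in> {0..width k}" using u by simp
  obtain p q where pq: "p \<in> K" "q \<in> K" "p \<bullet> k = rho k - u" "q \<bullet> k = rho k - u"
    "p - q = prof k u *\<^sub>R perp k" using prof_ends[OF k u'] by metis
  have "norm k * (norm (p - q))\<^sup>2 \<le> M\<^sup>2 * (rho k - p \<bullet> k)" using pq by (intro chord_K) auto
  then show ?thesis using pq(3) unfolding pq(5)
    by (simp add: power_mult_distrib power3_eq_cube power2_eq_square mult_ac)
next
  case False
  then have "prof k u = 0" unfolding prof_def using k by (intro len_outside) (auto simp: width_def)
  then show ?thesis using u by simp
qed

text \<open>The two ends of the chord at depth \<open>u\<close> are test points for
  \<open>rho\<close> at \<open>k + d\<close> and at \<open>k - d\<close>. A long slice near the
  boundary thus forces a large second difference; read backwards, a small second difference makes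
  the amplitude small.\<close>

lemma prof_second_difference:
  assumes k: "k \<noteq> 0" and u: "u \<in> {0..width k}"
  shows "prof k u * \<bar>perp k \<bullet> d\<bar> \<le> rho (k + d) + rho (k - d) - 2 * rho k + 2 * u"
proof -
  obtain p q where pq: "p \<in> K" "q \<in> K" "p \<bullet> k = rho k - u" "q \<bullet> k = rho k - u"
    "p - q = prof k u *\<^sub>R perp k" using prof_ends[OF k u] by metis
  have *: "(p - q) \<bullet> e \<le> rho (k + e) + rho (k - e) - 2 * rho k + 2 * u" for e
    using rho_ge[OF pq(1), of "k + e"] rho_ge[OF pq(2), of "k - e"] pq(3,4)
    by (simp add: inner_add_right inner_diff_right inner_diff_left)
  from *[of d] *[of "- d"] show ?thesis unfolding pq(5) using prof_nonneg[of k u]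
    by (cases "perp k \<bullet> d \<ge> 0") (auto simp: add.commute)
qed

lemma prof_0: "k \<noteq> 0 \<Longrightarrow> prof k 0 = 0"
  using prof_chord[of k 0] by (simp add: mult_le_0_iff)

lemma prof_width: "k \<noteq> 0 \<Longrightarrow> prof k (width k) = 0"
  using prof_reflect[of k 0] prof_0[of "- k"] by simp

text \<open>Convex combinations of the ends of two slices lie in the slice in between, by convexity
  of \<open>K\<close>.\<close>

lemma prof_concave:
  assumes k: "k \<noteq> 0"
  shows "concave_on {0..width k} (prof k)"
proof (rule concave_on_linorderI)
  fix l x y :: real assume l: "0 < l" "l < 1" and x: "x \<in> {0..width k}" and y: "y \<in> {0..width k}"
  define s where "s = rho k - x"
  define s' where "s' = rho k - y"
  have s: "s \<in> {- rho (- k)..rho k}" "s' \<in> {- rho (- k)..rho k}" using x y by (auto simp: s_def s'_def width_def)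
  define m where "m = (1 - l) * s + l * s'"
  have m: "m \<in> {- rho (- k)..rho k}"
    unfolding m_def real_scaleR_def[symmetric] using s l by (intro convexD[OF convex_real_interval(5)]) auto
  have h: "(1 - l) * hi k s + l * hi k s' \<in> slice k m" "(1 - l) * lo k s + l * lo k s' \<in> slice k m"
    unfolding m_def using l s by (auto intro!: slice_convex_comb slice_eq[OF k])
  have "(1 - l) * (hi k s - lo k s) + l * (hi k s' - lo k s') \<le> hi k m - lo k m"
    using h unfolding slice_eq(1)[OF k m] by (simp add: algebra_simps)
  moreover have "rho k - ((1 - l) * x + l * y) = m" by (simp add: m_def s_def s'_def algebra_simps)
  ultimately show "prof k ((1 - l) *\<^sub>R x + l *\<^sub>R y) \<ge> (1 - l) * prof k x + l * prof k y"
    using len_eq[OF k s(1)] len_eq[OF k s(2)] len_eq[OF k m]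
    by (simp add: prof_def s_def[symmetric] s'_def[symmetric])
qed simp

lemma prof_le: "k \<noteq> 0 \<Longrightarrow> 0 \<le> u \<Longrightarrow> prof k u \<le> M * sqrt u / norm k powr (3/2)"
proof -
  assume k: "k \<noteq> 0" and u: "0 \<le> u"
  have "(norm k powr (3/2))\<^sup>2 = norm k ^ 3"
    using k by (simp add: powr_power powr_numeral)
  then have "(norm k powr (3/2) * prof k u)\<^sup>2 \<le> (M * sqrt u)\<^sup>2"
    using prof_chord[OF k u] u by (simp add: power_mult_distrib)
  then have "norm k powr (3/2) * prof k u \<le> M * sqrt u"
    by (rule power2_le_imp_le) (use M0 u in auto)
  then show ?thesis using k by (simp add: field_simps)
qed

text \<open>Concavity gives continuity in the interior. At depth 0 it comes from the square root
  bound \<open>prof_le\<close>, at the far end by reflection.\<close>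

lemma prof_continuous:
  assumes k: "k \<noteq> 0"
  shows "continuous_on {0..width k} (prof k)"
proof -
  have end0: "(prof k \<longlongrightarrow> 0) (at 0 within {0..})" if k: "k \<noteq> 0" for k
  proof (rule tendsto_sandwich)
    show "\<forall>\<^sub>F u in at 0 within {0..}. 0 \<le> prof k u" by (simp add: prof_nonneg)
    show "\<forall>\<^sub>F u in at 0 within {0..}. prof k u \<le> M * sqrt u / norm k powr (3/2)"
      using prof_le[OF k] by (auto simp: eventually_at_filter)
    have "((\<lambda>u. M * sqrt u / norm k powr (3/2)) \<longlongrightarrow> M * sqrt 0 / norm k powr (3/2)) (at 0 within {0..})"
      using k by (intro tendsto_intros) auto
    then show "((\<lambda>u. M * sqrt u / norm k powr (3/2)) \<longlongrightarrow> 0) (at 0 within {0..})" by simp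
  qed simp
  have "continuous_on {0<..<width k} (\<lambda>u. - prof k u)"
  proof (rule convex_on_continuous)
    show "convex_on {0<..<width k} (\<lambda>u. - prof k u)"
      using prof_concave[OF k] unfolding concave_on_def by (rule convex_on_subset) auto
  qed simp
  then have "continuous_on {0<..<width k} (\<lambda>u. - (- prof k u))" by (rule continuous_on_minus)
  then have inner: "continuous_on {0<..<width k} (prof k)" by simp
  show ?thesis unfolding continuous_on_def
  proof
    fix u assume u: "u \<in> {0..width k}"
    consider "u = 0" | "u = width k" | "u \<in> {0<..<width k}" using u by force
    then show "(prof k \<longlongrightarrow> prof k u) (at u within {0..width k})"
    proof cases
      case 1
      show ?thesis unfolding 1 prof_0[OF k] by (rule tendsto_within_subset[OF end0[OF k]]) auto
    next
      case 2
      have "filterlim (\<lambda>u. width k - u) (at 0 within {0..}) (at (width k) within {0..width k})"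
        unfolding filterlim_at
        by (auto simp: eventually_at_filter intro!: tendsto_eq_intros)
      from filterlim_compose[OF end0[of "- k"] this] k
      have "((\<lambda>u. prof (- k) (width k - u)) \<longlongrightarrow> 0) (at (width k) within {0..width k})" by simp
      moreover have "prof (- k) (width k - u) = prof k u" for u
        using prof_reflect[of k "width k - u"] by simp
      ultimately show ?thesis unfolding 2 prof_width[OF k] by simp
    next
      case 3
      then have "isCont (prof k) u" using inner by (simp add: continuous_on_eq_continuous_at)
      then show ?thesis unfolding isCont_def by (rule tendsto_within_subset) auto
    qed
  qed
qed


section \<open>Fourier coefficients of the dilates\<close>

definition dil :: "real \<Rightarrow> (real \<times> real) set" where
  "dil t = (\<lambda>x. t *\<^sub>R x) ` K"

definition coef :: "real \<times> real \<Rightarrow> real \<Rightarrow> complex" where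
  "coef k t = (LINT x|lborel. indicator (dil t) x *\<^sub>R ee (x \<bullet> k))"

lemma compact_dil: "compact (dil t)"
  unfolding dil_def by (intro compact_continuous_image continuous_intros compact_K)

text \<open>Fubini in the coordinates of \<open>frame k\<close>: the phase depends on the first
  coordinate alone, so a slice contributes its length. Measuring depth from the support line pulls
  out the phase \<open>t rho k\<close>.\<close>

lemma coef_formula:
  assumes k: "k \<noteq> 0" and t: "t > 0"
  shows "coef k t = of_real (t\<^sup>2) * ee (t * rho k) * integral {0..width k} (\<lambda>u. of_real (prof k u) * ee (- (t * u)))"
proof -
  define g where "g x = (indicator (dil t) x *\<^sub>R ee (x \<bullet> k) :: complex)" for x
  have ig: "integrable lborel g" unfolding g_def
    by (intro borel_integrable_compact compact_dil continuous_intros)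
  have gm[measurable]: "g \<in> borel_measurable borel" using ig by (simp add: borel_measurable_integrable)
  have mem: "frame k (s, y) \<in> dil t \<longleftrightarrow> y \<in> (*) t ` slice k (s / t)" for s y
  proof -
    have sc: "frame k (s, y) = t *\<^sub>R frame k (s / t, y / t)"
      using t by (simp add: linear_scale[OF linear_frame, symmetric])
    have "frame k (s, y) \<in> dil t \<longleftrightarrow> y / t \<in> slice k (s / t)"
    proof
      assume "frame k (s, y) \<in> dil t"
      then obtain x where "x \<in> K" "t *\<^sub>R frame k (s / t, y / t) = t *\<^sub>R x" unfolding sc dil_def by blast
      then show "y / t \<in> slice k (s / t)" using t by (simp add: slice_def)
    next
      assume "y / t \<in> slice k (s / t)"
      then show "frame k (s, y) \<in> dil t" unfolding sc dil_def slice_def by blast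
    qed
    also have "\<dots> \<longleftrightarrow> y \<in> (*) t ` slice k (s / t)" using t by (force simp: image_iff)
    finally show ?thesis .
  qed
  have inner: "(LINT y|lborel. g (frame k (s, y))) = (t * len k (s / t)) *\<^sub>R ee s" for s
  proof -
    have m: "(*) t ` slice k (s / t) \<in> sets borel"
      using closed_scaling[OF closed_slice[of k "s / t"], of t] by (simp add: image_def)
    have "(LINT y|lborel. g (frame k (s, y))) = (LINT y|lborel. indicator ((*) t ` slice k (s / t)) y *\<^sub>R ee s)"
      unfolding g_def by (intro Bochner_Integration.integral_cong) (auto simp: indicator_def mem k)
    also have "\<dots> = measure lborel ((*) t ` slice k (s / t)) *\<^sub>R ee s"
    proof -
      have "compact ((*) t ` slice k (s / t))"
        by (intro compact_continuous_image continuous_intros compact_slice k)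
      then have "emeasure lborel ((*) t ` slice k (s / t)) < \<infinity>" by (rule emeasure_compact_finite)
      then show ?thesis using m by (subst integral_scaleR_left) (auto simp: integrable_real_indicator)
    qed
    also have "measure lborel ((*) t ` slice k (s / t)) = t * len k (s / t)"
    proof -
      have "measure lebesgue ((\<lambda>x. t *\<^sub>R x + 0) ` slice k (s / t)) = \<bar>t\<bar> ^ DIM(real) * measure lebesgue (slice k (s / t))"
        using measure_lebesgue_affine[of t 0 "slice k (s / t)"] by (simp add: add.commute)
      moreover have "measure lebesgue ((*) t ` slice k (s / t)) = measure lborel ((*) t ` slice k (s / t))"
        using m by (intro measure_completion) simp
      moreover have "measure lebesgue (slice k (s / t)) = measure lborel (slice k (s / t))"
        using closed_slice by (intro measure_completion) simp
      ultimately show ?thesis using t by (simp add: len_def)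
    qed
    finally show ?thesis .
  qed
  have gf: "integrable lborel (\<lambda>z. g (frame k z))"
    using ig integrable_distr_eq[of "frame k" lborel borel g] by (simp add: distr_frame[OF k])
  have "coef k t = (LINT z|distr lborel borel (frame k). g z)"
    by (simp add: coef_def g_def distr_frame[OF k])
  also have "\<dots> = (LINT z|lborel. g (frame k z))" by (rule integral_distr) auto
  also have "\<dots> = (LINT z|(lborel \<Otimes>\<^sub>M lborel). g (frame k z))" by (simp add: lborel_prod)
  also have "\<dots> = (LINT s|lborel. LINT y|lborel. g (frame k (s, y)))"
    by (rule lborel_pair.integral_fst'[symmetric]) (use gf in \<open>simp add: lborel_prod\<close>)
  also have "\<dots> = (LINT s|lborel. (t * len k (s / t)) *\<^sub>R ee s)" by (simp only: inner)
  \<comment> \<open>The substitution \<open>s = t rho k - t u\<close>.\<close>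
  also have "\<dots> = \<bar>- t\<bar> *\<^sub>R (LINT u|lborel. (t * len k ((t * rho k + (- t) * u) / t)) *\<^sub>R ee (t * rho k + (- t) * u))"
    using t by (intro lborel_integral_real_affine) auto
  also have "\<dots> = t *\<^sub>R (LINT u|lborel. indicator {0..width k} u *\<^sub>R ((of_real t * ee (t * rho k)) * (of_real (prof k u) * ee (- (t * u)))))"
  proof -
    have "(t * len k ((t * rho k + (- t) * u) / t)) *\<^sub>R ee (t * rho k + (- t) * u)
      = indicator {0..width k} u *\<^sub>R ((of_real t * ee (t * rho k)) * (of_real (prof k u) * ee (- (t * u))))" for u
    proof -
      have "(t * rho k + (- t) * u) / t = rho k - u" using t by (simp add: field_simps)
      moreover have "prof k u = 0" if "u \<notin> {0..width k}"
        using that k unfolding prof_def by (intro len_outside) (auto simp: width_def)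
      moreover have "ee (t * rho k + (- t) * u) = ee (t * rho k) * ee (- (t * u))"
        by (simp only: ee_add) simp
      ultimately show ?thesis
        by (cases "u \<in> {0..width k}") (simp_all add: prof_def[symmetric] scaleR_conv_of_real)
    qed
    then show ?thesis using t by simp
  qed
  also have "(LINT u|lborel. indicator {0..width k} u *\<^sub>R ((of_real t * ee (t * rho k)) * (of_real (prof k u) * ee (- (t * u)))))
     = integral {0..width k} (\<lambda>u. (of_real t * ee (t * rho k)) * (of_real (prof k u) * ee (- (t * u))))"
    unfolding set_lebesgue_integral_def[symmetric]
    by (intro set_borel_integral_eq_integral borel_integrable_atLeastAtMost' continuous_intros prof_continuous k)
  also have "\<dots> = (of_real t * ee (t * rho k)) * integral {0..width k} (\<lambda>u. of_real (prof k u) * ee (- (t * u)))"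
    by simp
  finally show ?thesis by (simp add: power2_eq_square scaleR_conv_of_real mult_ac)
qed

lemma coef_0: "t > 0 \<Longrightarrow> coef 0 t = of_real (t\<^sup>2 * measure lborel K)"
proof -
  assume t: "t > 0"
  have "coef 0 t = of_real (measure lborel (dil t))"
    using emeasure_compact_finite[OF compact_dil[of t]] compact_dil[of t]
    by (simp add: coef_def compact_imp_closed scaleR_conv_of_real)
  also have "measure lborel (dil t) = measure lebesgue (dil t)"
    using compact_dil[of t] by (intro measure_completion[symmetric]) (simp add: compact_imp_closed)
  also have "\<dots> = t\<^sup>2 * measure lebesgue K"
    using measure_lebesgue_affine[of t 0 K] t by (simp add: dil_def power2_eq_square)
  also have "measure lebesgue K = measure lborel K"
    by (intro measure_completion) simp
  finally show ?thesis .
qed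

text \<open>The factor \<open>t^2\<close> of \<open>coef_formula\<close> is the one that turns the
  transform of the profile into that of its second derivative. The far end has phase
  \<open>t (rho k - width k) = - t rho (- k)\<close>, and its amplitude is that of the near end for
  \<open>- k\<close>.\<close>

lemma coef_structure:
  assumes k: "1 \<le> norm k" and R: "R \<ge> 1" and \<epsilon>: "\<epsilon> > 0"
  obtains P Q where "slow R (32 * pi * R / r0 * prof k (r0 / R)) P"
    "slow R (32 * pi * R / r0 * prof (- k) (r0 / R)) Q"
    "\<And>t. 0 < t \<Longrightarrow> t \<le> 4 * R \<Longrightarrow>
      norm (of_real (4 * pi\<^sup>2) * coef k t - ee (t * rho k) * P t - ee (- (t * rho (- k))) * Q t)
      \<le> 16 * sqrt R / r0 * (M * sqrt (r0 / sqrt R) / norm k powr (3/2)) + \<epsilon>"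
proof -
  have k0: "k \<noteq> 0" using k by auto
  have w: "2 * r0 \<le> width k"
  proof -
    have "2 * r0 * 1 \<le> 2 * r0 * norm k" using k r0 by (intro mult_left_mono) auto
    then show ?thesis using width_ge[of k] by simp
  qed
  obtain P Q where P: "slow R (32 * pi * R / r0 * prof k (r0 / R)) P"
    and Q: "slow R (32 * pi * R / r0 * prof k (width k - r0 / R)) Q"
    and PQ: "\<And>t. 0 < t \<Longrightarrow> t \<le> 4 * R \<Longrightarrow>
      norm (of_real (4 * pi\<^sup>2 * t\<^sup>2) * integral {0..width k} (\<lambda>u. of_real (prof k u) * ee (- (t * u))) - P t - ee (- (t * width k)) * Q t)
      \<le> 8 * sqrt R / r0 * (prof k (r0 / sqrt R) + prof k (width k - r0 / sqrt R)) + \<epsilon>"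
    by (rule concave_fourier_structure[OF R r0(1,2) w prof_concave[OF k0] prof_0[OF k0] prof_width[OF k0] prof_continuous[OF k0] \<epsilon>]) (rule that)
  show thesis
  proof (rule that[OF P])
    show "slow R (32 * pi * R / r0 * prof (- k) (r0 / R)) Q" using Q by (simp add: prof_reflect)
    fix t assume t: "0 < t" "t \<le> 4 * R"
    define J where "J = integral {0..width k} (\<lambda>u. of_real (prof k u) * ee (- (t * u)))"
    have "of_real (4 * pi\<^sup>2) * coef k t - ee (t * rho k) * P t - ee (- (t * rho (- k))) * Q t
       = ee (t * rho k) * (of_real (4 * pi\<^sup>2 * t\<^sup>2) * J - P t - ee (- (t * width k)) * Q t)"
    proof -
      have "ee (- (t * rho (- k))) = ee (t * rho k) * ee (- (t * width k))"
        unfolding ee_add[symmetric] by (simp add: width_def algebra_simps)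
      moreover have "coef k t = of_real (t\<^sup>2) * ee (t * rho k) * J" unfolding J_def by (rule coef_formula[OF k0 t(1)])
      ultimately show ?thesis by (simp add: algebra_simps)
    qed
    then have "norm (of_real (4 * pi\<^sup>2) * coef k t - ee (t * rho k) * P t - ee (- (t * rho (- k))) * Q t)
      \<le> 8 * sqrt R / r0 * (prof k (r0 / sqrt R) + prof (- k) (r0 / sqrt R)) + \<epsilon>"
      using PQ[OF t] by (simp add: norm_mult J_def prof_reflect)
    also have "\<dots> \<le> 8 * sqrt R / r0 * (M * sqrt (r0 / sqrt R) / norm k powr (3/2) + M * sqrt (r0 / sqrt R) / norm k powr (3/2)) + \<epsilon>"
      using prof_le[of k "r0 / sqrt R"] prof_le[of "- k" "r0 / sqrt R"] k0 r0 R
      by (intro add_mono mult_left_mono) auto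
    finally show "norm (of_real (4 * pi\<^sup>2) * coef k t - ee (t * rho k) * P t - ee (- (t * rho (- k))) * Q t)
      \<le> 16 * sqrt R / r0 * (M * sqrt (r0 / sqrt R) / norm k powr (3/2)) + \<epsilon>" by simp
  qed
qed

end

section \<open>The smoothing kernel\<close>

definition trig :: "nat \<Rightarrow> (int \<Rightarrow> real) \<Rightarrow> real \<Rightarrow> real" where
  "trig N c x = (\<Sum>m\<in>{- int N..int N}. c m * cos (2 * pi * (of_int m * x)))"

lemma continuous_on_trig [continuous_intros]:
  fixes g :: "'a::t2_space \<Rightarrow> real"
  shows "continuous_on S g \<Longrightarrow> continuous_on S (\<lambda>x. trig N c (g x))"
  unfolding trig_def
  by (intro continuous_on_sum continuous_on_mult continuous_on_cos continuous_on_const)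

lemma trig_eq_ee:
  assumes "\<And>m. c (- m) = c m"
  shows "complex_of_real (trig N c x) = (\<Sum>m\<in>{- int N..int N}. of_real (c m) * ee (of_int m * x))"
proof -
  define S where "S = (\<Sum>m\<in>{- int N..int N}. of_real (c m) * ee (of_int m * x))"
  have "S = (\<Sum>m\<in>{- int N..int N}. of_real (c (- m)) * ee (of_int (- m) * x))"
    unfolding S_def by (rule sum.reindex_bij_witness[of _ uminus uminus]) auto
  then have "S + S = (\<Sum>m\<in>{- int N..int N}. of_real (c m) * (ee (of_int m * x) + ee (of_int (- m) * x)))"
    using assms unfolding S_def by (simp add: sum.distrib distrib_left)
  also have "\<dots> = (\<Sum>m\<in>{- int N..int N}. of_real (2 * (c m * cos (2 * pi * (of_int m * x)))))"
    by (intro sum.cong) (auto simp: complex_eq_iff ee_def)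
  also have "\<dots> = 2 * of_real (trig N c x)"
    unfolding trig_def by (simp add: sum_distrib_left)
  finally show ?thesis unfolding S_def by simp
qed

text \<open>The Fourier coefficients of the normalized indicator of \<open>[-a, a]\<close>.\<close>

definition sincf :: "real \<Rightarrow> int \<Rightarrow> real" where
  "sincf a m = (if m = 0 then 1 else sin (2 * pi * (of_int m * a)) / (2 * pi * (of_int m * a)))"

lemma sincf_le: "\<bar>sincf a m\<bar> \<le> 1"
proof (cases "m = 0 \<or> a = 0")
  case False
  then show ?thesis using abs_sin_x_le_abs_x[of "2 * pi * (of_int m * a)"]
    by (auto simp: sincf_def)
qed (auto simp: sincf_def)

lemma sincf_le': "m \<noteq> 0 \<Longrightarrow> a > 0 \<Longrightarrow> \<bar>sincf a m\<bar> \<le> 1 / (2 * pi * (\<bar>of_int m\<bar> * a))"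
proof -
  assume m: "m \<noteq> 0" "a > 0"
  then have "\<bar>sincf a m\<bar> = \<bar>sin (2 * pi * (of_int m * a))\<bar> / (2 * pi * (\<bar>of_int m\<bar> * a))"
    by (simp add: sincf_def abs_mult)
  also have "\<dots> \<le> 1 / (2 * pi * (\<bar>of_int m\<bar> * a))"
    using m by (intro divide_right_mono) auto
  finally show ?thesis .
qed

lemma sincf_minus: "sincf a (- m) = sincf a m"
  by (simp add: sincf_def)

lemma has_integral_cos:
  assumes "l \<le> u" "m \<noteq> 0"
  shows "((\<lambda>y. cos (2 * pi * (of_int m * y))) has_integral
    (sin (2 * pi * (of_int m * u)) - sin (2 * pi * (of_int m * l))) / (2 * pi * of_int m)) {l..u}"
proof -
  have "((\<lambda>y. cos (2 * pi * (of_int m * y))) has_integral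
    sin (2 * pi * (of_int m * u)) / (2 * pi * of_int m) - sin (2 * pi * (of_int m * l)) / (2 * pi * of_int m)) {l..u}"
    using assms by (intro fundamental_theorem_of_calculus)
      (auto intro!: derivative_eq_intros simp flip: has_real_derivative_iff_has_vector_derivative)
  then show ?thesis by (simp add: diff_divide_distrib)
qed

lemma trig_average:
  assumes a: "a > 0"
  shows "((trig N c) has_integral 2 * a * trig N (\<lambda>m. c m * sincf a m) x) {x - a..x + a}"
proof -
  have "((\<lambda>y. cos (2 * pi * (of_int m * y))) has_integral 2 * a * (sincf a m * cos (2 * pi * (of_int m * x)))) {x - a..x + a}" for m
  proof (cases "m = 0")
    case True
    then show ?thesis using has_integral_const_real[of "1::real" "x - a" "x + a"] a by (simp add: sincf_def)
  next
    case False
    have "sin (2 * pi * (of_int m * (x + a))) - sin (2 * pi * (of_int m * (x - a)))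
      = 2 * sin (2 * pi * (of_int m * a)) * cos (2 * pi * (of_int m * x))"
      by (simp add: distrib_left right_diff_distrib sin_add sin_diff)
    then have "(sin (2 * pi * (of_int m * (x + a))) - sin (2 * pi * (of_int m * (x - a)))) / (2 * pi * of_int m)
      = 2 * a * (sincf a m * cos (2 * pi * (of_int m * x)))"
      using a False by (simp add: sincf_def)
    then show ?thesis using has_integral_cos[of "x - a" "x + a" m] False a by simp
  qed
  then have "((\<lambda>y. \<Sum>m\<in>{- int N..int N}. c m * cos (2 * pi * (of_int m * y))) has_integral
      (\<Sum>m\<in>{- int N..int N}. c m * (2 * a * (sincf a m * cos (2 * pi * (of_int m * x)))))) {x - a..x + a}"
    by (intro has_integral_sum has_integral_mult_right) auto
  moreover have "(\<Sum>m\<in>{- int N..int N}. c m * (2 * a * (sincf a m * cos (2 * pi * (of_int m * x))))) = 2 * a * trig N (\<lambda>m. c m * sincf a m) x"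
    by (simp add: trig_def sum_distrib_left mult_ac)
  ultimately show ?thesis unfolding trig_def[abs_def] by simp
qed

lemma trig_average_nonneg:
  assumes a: "a > 0" and pos: "\<And>x. trig N c x \<ge> 0"
  shows "trig N (\<lambda>m. c m * sincf a m) x \<ge> 0"
proof -
  have "2 * a * trig N (\<lambda>m. c m * sincf a m) x \<ge> 0"
    using has_integral_nonneg[OF trig_average[OF a]] pos by blast
  then show ?thesis using a by (simp add: zero_le_mult_iff)
qed

text \<open>Averaging with radius \<open>a\<close> widens by \<open>a\<close> the neighbourhood of
  the integers in which the function may be large.\<close>

lemma trig_average_le:
  assumes a: "a > 0" and le: "\<And>x. (\<And>n::int. d \<le> \<bar>x - of_int n\<bar>) \<Longrightarrow> trig N c x \<le> \<eta>"
    and x: "\<And>n::int. d + a \<le> \<bar>x - of_int n\<bar>"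
  shows "trig N (\<lambda>m. c m * sincf a m) x \<le> \<eta>"
proof -
  have "2 * a * trig N (\<lambda>m. c m * sincf a m) x \<le> \<eta> * (x + a - (x - a))"
  proof (rule has_integral_le[OF trig_average[OF a]])
    show "((\<lambda>_. \<eta>) has_integral \<eta> * (x + a - (x - a))) {x - a..x + a}"
      using has_integral_const_real[of \<eta> "x - a" "x + a"] a by (simp add: mult.commute)
    fix y assume y: "y \<in> {x - a..x + a}"
    show "trig N c y \<le> \<eta>"
    proof (rule le)
      fix n :: int
      show "d \<le> \<bar>y - of_int n\<bar>" using x[of n] y by auto
    qed
  qed
  then have "2 * a * trig N (\<lambda>m. c m * sincf a m) x \<le> 2 * a * \<eta>" by (simp add: algebra_simps)
  then show ?thesis using a by simp
qed

text \<open>For positive \<open>N\<close> these are the coefficients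
  \<open>max 0 (1 - |m| / N)\<close>, written as a normalized count of differences so that the
  polynomial appears as a squared modulus.\<close>

definition fejer :: "nat \<Rightarrow> int \<Rightarrow> real" where
  "fejer N m = real (card {p \<in> {..<N} \<times> {..<N}. int (fst p) - int (snd p) = m}) / real N"

lemma fejer_0: "N > 0 \<Longrightarrow> fejer N 0 = 1"
proof -
  assume N: "N > 0"
  have "{p \<in> {..<N} \<times> {..<N}. int (fst p) - int (snd p) = 0} = (\<lambda>i. (i, i)) ` {..<N}" by auto
  then have "card {p \<in> {..<N} \<times> {..<N}. int (fst p) - int (snd p) = 0} = N"
    by (simp add: card_image inj_on_def)
  then show ?thesis using N by (simp add: fejer_def)
qed

lemma fejer_bounds: "0 \<le> fejer N m" "fejer N m \<le> 1"
proof -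
  have "card {p \<in> {..<N} \<times> {..<N}. int (fst p) - int (snd p) = m} \<le> card {..<N}"
    by (rule card_inj_on_le[of fst]) (auto simp: inj_on_def)
  then show "fejer N m \<le> 1" by (auto simp: fejer_def divide_le_eq_1)
qed (simp add: fejer_def)

lemma fejer_minus: "fejer N (- m) = fejer N m"
proof -
  have "bij_betw prod.swap {p \<in> {..<N} \<times> {..<N}. int (fst p) - int (snd p) = - m} {p \<in> {..<N} \<times> {..<N}. int (fst p) - int (snd p) = m}"
    by (rule bij_betwI[where g = prod.swap]) auto
  then show ?thesis unfolding fejer_def by (simp add: bij_betw_same_card)
qed

lemma trig_fejer: "trig N (fejer N) x = (norm (\<Sum>j<N. ee (real j * x)))\<^sup>2 / N"
proof -
  have "complex_of_real ((norm (\<Sum>j<N. ee (real j * x)))\<^sup>2) = (\<Sum>i<N. \<Sum>j<N. ee (real i * x) * cnj (ee (real j * x)))"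
    unfolding complex_norm_square by (simp add: cnj_sum sum_product)
  also have "\<dots> = (\<Sum>p\<in>{..<N}\<times>{..<N}. ee (of_int (int (fst p) - int (snd p)) * x))"
    unfolding sum.cartesian_product by (intro sum.cong) (auto simp: cnj_ee ee_add[symmetric] algebra_simps)
  also have "\<dots> = (\<Sum>m\<in>{- int N..int N}. \<Sum>p\<in>{p \<in> {..<N} \<times> {..<N}. int (fst p) - int (snd p) = m}. ee (of_int (int (fst p) - int (snd p)) * x))"
    by (rule sum.group[symmetric]) auto
  also have "\<dots> = (\<Sum>m\<in>{- int N..int N}. of_real (real (card {p \<in> {..<N} \<times> {..<N}. int (fst p) - int (snd p) = m})) * ee (of_int m * x))"
    by (intro sum.cong) auto
  finally have "complex_of_real ((norm (\<Sum>j<N. ee (real j * x)))\<^sup>2 / N) = (\<Sum>m\<in>{- int N..int N}. of_real (fejer N m) * ee (of_int m * x))"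
    by (simp add: fejer_def sum_divide_distrib)
  also have "\<dots> = of_real (trig N (fejer N) x)"
    by (rule trig_eq_ee[symmetric]) (rule fejer_minus)
  finally show ?thesis by (simp only: of_real_eq_iff)
qed

lemma sin_pi_ge:
  assumes a: "0 < a" "a \<le> 1/2" and x: "\<And>n::int. a \<le> \<bar>x - of_int n\<bar>"
  shows "sin (pi * a) \<le> \<bar>sin (pi * x)\<bar>"
proof -
  define n where "n = round x"
  define y where "y = x - of_int n"
  have y: "\<bar>y\<bar> \<le> 1/2" using of_int_round_abs_le[of x] by (simp add: y_def n_def abs_minus_commute)
  have ay: "a \<le> \<bar>y\<bar>" using x[of n] by (simp add: y_def)
  have "pi * x = pi * y + pi * of_int n" by (simp add: y_def right_diff_distrib)
  then have "\<bar>sin (pi * x)\<bar> = \<bar>sin (pi * y)\<bar>"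
    by (simp add: sin_add sin_npi_int cos_npi_int)
  also have "\<dots> = \<bar>sin (pi * \<bar>y\<bar>)\<bar>" by (cases "y \<ge> 0") auto
  also have "\<dots> \<ge> sin (pi * \<bar>y\<bar>)" by simp
  finally have "sin (pi * \<bar>y\<bar>) \<le> \<bar>sin (pi * x)\<bar>" .
  moreover have "sin (pi * a) \<le> sin (pi * \<bar>y\<bar>)"
  proof (rule sin_monotone_2pi_le)
    have "pi * 0 \<le> pi * a" using a by simp
    then show "- (pi / 2) \<le> pi * a" using pi_gt_zero by linarith
    show "pi * a \<le> pi * \<bar>y\<bar>" using ay by simp
    have "pi * \<bar>y\<bar> \<le> pi * (1/2)" using y by (intro mult_left_mono) auto
    then show "pi * \<bar>y\<bar> \<le> pi / 2" by simp
  qed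
  ultimately show ?thesis by linarith
qed

text \<open>The geometric sum under the square has modulus at most
  \<open>1 / |sin (pi x)|\<close>.\<close>

lemma trig_fejer_le:
  assumes a: "0 < a" "a \<le> 1/2" and x: "\<And>n::int. a \<le> \<bar>x - of_int n\<bar>" and N: "N > 0"
  shows "trig N (fejer N) x \<le> 1 / (N * (sin (pi * a))\<^sup>2)"
proof -
  have s0: "sin (pi * a) > 0" using a by (intro sin_gt_zero) auto
  define S where "S = (\<Sum>j<N. ee (real j * x))"
  have "ee (real j * x) = ee x ^ j" for j
    by (induction j) (simp_all add: distrib_right ee_add)
  then have "(1 - ee x) * S = 1 - ee x ^ N" unfolding S_def by (simp add: one_diff_power_eq)
  moreover have "ee x ^ N = ee (real N * x)"
    by (induction N) (simp_all add: distrib_right ee_add)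
  ultimately have "norm (1 - ee x) * norm S \<le> 2"
    using norm_1_minus_ee_le_2[of "real N * x"] by (simp flip: norm_mult)
  moreover have "sin (pi * a) * norm S \<le> \<bar>sin (pi * x)\<bar> * norm S"
    by (intro mult_right_mono sin_pi_ge a x) auto
  ultimately have "sin (pi * a) * norm S \<le> 1" by (simp add: norm_1_minus_ee)
  then have "(sin (pi * a) * norm S)\<^sup>2 \<le> 1" using s0 by (intro power_le_one) auto
  then have "(norm S)\<^sup>2 \<le> 1 / (sin (pi * a))\<^sup>2" using s0 by (simp add: power_mult_distrib field_simps)
  then have "(norm S)\<^sup>2 / N \<le> 1 / (sin (pi * a))\<^sup>2 / N" by (intro divide_right_mono) auto
  then show ?thesis unfolding trig_fejer S_def[symmetric] by (simp add: mult.commute)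
qed

text \<open>A high Fejer kernel averaged twice over \<open>[-a, a]\<close>: the averages give the decay of the coefficients
  at scale \<open>1/a\<close>, the Fejer kernel makes the mass away from the integers as small as desired.\<close>
lemma smoothing_kernel:
  assumes a: "0 < a" "a \<le> 1/2" and \<eta>: "\<eta> > 0"
  obtains N s where "s 0 = 1" "\<And>m. s (- m) = s m" "\<And>m. \<bar>s m\<bar> \<le> 1"
    "\<And>m. m \<noteq> 0 \<Longrightarrow> \<bar>s m\<bar> \<le> 1 / (of_int m * a)\<^sup>2"
    "\<And>x. 0 \<le> trig N s x"
    "\<forall>x. (\<forall>n::int. 3 * a \<le> \<bar>x - of_int n\<bar>) \<longrightarrow> trig N s x \<le> \<eta>"
proof -
  have s0: "sin (pi * a) > 0" using a by (intro sin_gt_zero) auto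
  obtain N0 :: nat where N0: "1 / (\<eta> * (sin (pi * a))\<^sup>2) < N0" using reals_Archimedean2 by blast
  define N where "N = Suc N0"
  have N: "N > 0" "1 / (N * (sin (pi * a))\<^sup>2) \<le> \<eta>"
  proof -
    define \<kappa> where "\<kappa> = (sin (pi * a))\<^sup>2"
    have k: "\<kappa> > 0" using s0 by (simp add: \<kappa>_def)
    have "1 / (\<eta> * \<kappa>) \<le> N" using N0 by (simp add: N_def \<kappa>_def)
    then have "1 \<le> N * (\<eta> * \<kappa>)" using \<eta> k by (simp add: pos_divide_le_eq)
    moreover have "N * \<kappa> > 0" using k by (simp add: N_def)
    ultimately show "1 / (N * (sin (pi * a))\<^sup>2) \<le> \<eta>"
      unfolding \<kappa>_def[symmetric] by (subst pos_divide_le_eq) (auto simp: mult_ac)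
  qed (simp add: N_def)
  define s where "s m = fejer N m * sincf a m * sincf a m" for m
  have f0: "trig N (fejer N) x \<ge> 0" for x by (simp add: trig_fejer)
  have fle: "trig N (fejer N) x \<le> \<eta>" if "\<And>n::int. a \<le> \<bar>x - of_int n\<bar>" for x
    using trig_fejer_le[OF a that N(1)] N(2) by linarith
  show thesis
  proof (rule that[of s N])
    show "s 0 = 1" by (simp add: s_def fejer_0 N sincf_def)
    show "s (- m) = s m" for m by (simp add: s_def fejer_minus sincf_minus)
    show "\<bar>s m\<bar> \<le> 1" for m
    proof -
      have "\<bar>s m\<bar> = fejer N m * \<bar>sincf a m\<bar> * \<bar>sincf a m\<bar>" by (simp add: s_def abs_mult fejer_bounds)
      also have "\<dots> \<le> 1 * 1 * 1" by (intro mult_mono fejer_bounds sincf_le mult_nonneg_nonneg) auto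
      finally show ?thesis by simp
    qed
    show "\<bar>s m\<bar> \<le> 1 / (of_int m * a)\<^sup>2" if m: "m \<noteq> 0" for m
    proof -
      define z where "z = \<bar>of_int m\<bar> * a"
      have z: "z > 0" using m a by (simp add: z_def)
      have "\<bar>sincf a m\<bar> \<le> 1 / (2 * pi * z)" unfolding z_def by (rule sincf_le'[OF m a(1)])
      also have "\<dots> \<le> 1 / (1 * z)" using z pi_gt3 by (intro divide_left_mono mult_right_mono) auto
      finally have z1: "\<bar>sincf a m\<bar> \<le> 1 / z" by simp
      have "\<bar>s m\<bar> = fejer N m * \<bar>sincf a m\<bar> * \<bar>sincf a m\<bar>" by (simp add: s_def abs_mult fejer_bounds)
      also have "\<dots> \<le> 1 * (1 / z) * (1 / z)" using z by (intro mult_mono fejer_bounds z1 mult_nonneg_nonneg) auto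
      also have "\<dots> = 1 / (of_int m * a)\<^sup>2" by (simp add: z_def power2_eq_square abs_mult_self_eq mult_ac) 
      finally show ?thesis .
    qed
    show "0 \<le> trig N s x" for x
      unfolding s_def by (intro trig_average_nonneg a f0)
    have "trig N s x \<le> \<eta>" if x: "\<And>n::int. 3 * a \<le> \<bar>x - of_int n\<bar>" for x
      unfolding s_def
    \<comment> \<open>Two averages of radius \<open>a\<close> turn the distance \<open>a\<close> in
      the Fejer bound into \<open>3 a\<close>.\<close>
    proof (rule trig_average_le[OF a(1), where d = "2 * a"])
      fix y :: real assume y: "\<And>n::int. 2 * a \<le> \<bar>y - of_int n\<bar>"
      show "trig N (\<lambda>m. fejer N m * sincf a m) y \<le> \<eta>"
        by (rule trig_average_le[OF a(1), where d = a]) (use fle y in auto)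
    qed (use x in auto)
    then show "\<forall>x. (\<forall>n::int. 3 * a \<le> \<bar>x - of_int n\<bar>) \<longrightarrow> trig N s x \<le> \<eta>" by blast
  qed
qed

section \<open>The lattice smoothed to a periodic measure on the plane\<close>

definition pt :: "int \<times> int \<Rightarrow> real \<times> real" where
  "pt n = (of_int (fst n), of_int (snd n))"

definition weight :: "(real \<Rightarrow> real) \<Rightarrow> real set \<Rightarrow> ennreal" where
  "weight \<sigma> A = (\<integral>\<^sup>+ x. ennreal (\<sigma> x) * indicator A x \<partial>lborel)"

text \<open>The product kernel is periodic, so its density concentrates near all lattice points at
  once, and the mass of a dilate is a smoothed lattice count.\<close>

definition weight2 :: "(real \<Rightarrow> real) \<Rightarrow> (real \<times> real) measure" where
  "weight2 \<sigma> = density lborel (\<lambda>z. ennreal (\<sigma> (fst z) * \<sigma> (snd z)))"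

lemma sets_weight2 [simp, measurable_cong]: "sets (weight2 \<sigma>) = sets borel"
  by (simp add: weight2_def)

lemma emeasure_weight2_Times:
  assumes \<sigma>[measurable]: "\<sigma> \<in> borel_measurable borel" and pos: "\<And>x. \<sigma> x \<ge> 0"
    and A[measurable]: "A \<in> sets borel" and B[measurable]: "B \<in> sets borel"
  shows "emeasure (weight2 \<sigma>) (A \<times> B) = weight \<sigma> A * weight \<sigma> B"
proof -
  have AB: "A \<times> B \<in> sets (borel \<Otimes>\<^sub>M borel)" by measurable
  have AB': "A \<times> B \<in> sets borel" using AB unfolding borel_prod .
  have m: "(\<lambda>z. ennreal (\<sigma> (fst z) * \<sigma> (snd z))) \<in> borel_measurable (borel \<Otimes>\<^sub>M borel)" by measurable
  have "emeasure (weight2 \<sigma>) (A \<times> B) = (\<integral>\<^sup>+ z. ennreal (\<sigma> (fst z) * \<sigma> (snd z)) * indicator (A \<times> B) z \<partial>lborel)"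
    unfolding weight2_def by (rule emeasure_density) (use m in \<open>simp add: borel_prod\<close>, use AB' in simp)
  also have "\<dots> = (\<integral>\<^sup>+ z. ennreal (\<sigma> (fst z) * \<sigma> (snd z)) * indicator (A \<times> B) z \<partial>(lborel \<Otimes>\<^sub>M lborel))"
    by (simp add: lborel_prod)
  also have "\<dots> = (\<integral>\<^sup>+ x. \<integral>\<^sup>+ y. ennreal (\<sigma> x * \<sigma> y) * indicator (A \<times> B) (x, y) \<partial>lborel \<partial>lborel)"
    using AB' m by (subst lborel.nn_integral_fst[symmetric]) (simp_all add: borel_prod lborel_prod)
  also have "\<dots> = (\<integral>\<^sup>+ x. \<integral>\<^sup>+ y. (ennreal (\<sigma> x) * indicator A x) * (ennreal (\<sigma> y) * indicator B y) \<partial>lborel \<partial>lborel)"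
    using pos by (intro nn_integral_cong) (auto simp: ennreal_mult indicator_def)
  also have "\<dots> = weight \<sigma> A * weight \<sigma> B"
    by (simp add: weight_def nn_integral_cmult nn_integral_multc)
  finally show ?thesis .
qed

text \<open>An average of radius 1/2 runs over a full period, so only the coefficient
  \<open>s 0\<close> survives.\<close>

lemma weight_cell:
  assumes s0: "s 0 = 1" and pos: "\<And>x. trig N s x \<ge> 0"
  shows "weight (trig N s) {of_int n - 1/2..of_int n + 1/2} = 1"
proof -
  define I where "I = {real_of_int n - 1/2..real_of_int n + 1/2}"
  have z: "sincf (1/2) m = (if m = 0 then 1 else 0)" for m
  proof -
    have "sin (2 * pi * (real_of_int m * (1/2))) = sin (pi * of_int m)" by (simp add: mult_ac)
    then show ?thesis by (simp add: sincf_def sin_npi_int)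
  qed
  have "trig N (\<lambda>m. s m * sincf (1/2) m) (of_int n) = (\<Sum>m\<in>{- int N..int N}. if m = 0 then 1 else 0)"
    unfolding trig_def using s0 by (intro sum.cong) (auto simp: z)
  then have "trig N (\<lambda>m. s m * sincf (1/2) m) (of_int n) = 1" by simp
  then have "((trig N s) has_integral 1) I"
    using trig_average[of "1/2" N s "of_int n"] by (simp add: I_def)
  then have "((\<lambda>x. if x \<in> I then trig N s x else 0) has_integral 1) UNIV"
    by (simp add: has_integral_restrict_UNIV)
  then have "(\<integral>\<^sup>+ x. ennreal (if x \<in> I then trig N s x else 0) \<partial>lborel) = ennreal 1"
  proof (intro nn_integral_has_integral_lborel)
    have [measurable]: "trig N s \<in> borel_measurable borel" by (intro borel_measurable_continuous_onI continuous_intros)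
    show "(\<lambda>x. if x \<in> I then trig N s x else 0) \<in> borel_measurable borel" unfolding I_def by measurable
  qed (use pos in auto)
  moreover have "(\<lambda>x. ennreal (if x \<in> I then trig N s x else 0)) = (\<lambda>x. ennreal (trig N s x) * indicator I x)"
    by auto
  ultimately show ?thesis by (simp add: weight_def I_def)
qed

text \<open>Inside the unit interval about \<open>n\<close>, a distance of at least
  \<open>3 a \<le> 1/2\<close> from \<open>n\<close> is also a lower bound for the distance from
  every other integer.\<close>

lemma weight_tail:
  assumes a: "0 < a" "a \<le> 1/6" and \<eta>: "0 \<le> \<eta>"
    and tail: "\<And>x. (\<And>n::int. 3 * a \<le> \<bar>x - of_int n\<bar>) \<Longrightarrow> trig N s x \<le> \<eta>"
  shows "weight (trig N s) ({of_int n - 1/2..of_int n + 1/2} - {of_int n - 3 * a<..<of_int n + 3 * a}) \<le> ennreal \<eta>"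
proof -
  define I where "I = {real_of_int n - 1/2..real_of_int n + 1/2}"
  define J where "J = {real_of_int n - 3 * a<..<of_int n + 3 * a}"
  have "trig N s x \<le> \<eta>" if x: "x \<in> I - J" for x
  proof (rule tail)
    fix m :: int
    show "3 * a \<le> \<bar>x - of_int m\<bar>"
    proof (cases "m = n")
      case True then show ?thesis using x by (auto simp: I_def J_def)
    next
      case False
      then have "real_of_int m \<le> of_int n - 1 \<or> real_of_int m \<ge> of_int n + 1"
        by (metis linorder_neqE_linordered_idom of_int_1 of_int_add of_int_diff of_int_le_iff zle_diff1_eq add1_zle_eq)
      then show ?thesis using x a by (auto simp: I_def)
    qed
  qed
  then have "weight (trig N s) (I - J) \<le> (\<integral>\<^sup>+ x. ennreal \<eta> * indicator I x \<partial>lborel)"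
    unfolding weight_def by (intro nn_integral_mono) (auto simp: indicator_def intro!: ennreal_leI)
  also have "\<dots> = ennreal \<eta> * emeasure lborel I" by (simp add: nn_integral_cmult_indicator I_def)
  also have "emeasure lborel I = 1" by (simp add: I_def)
  finally show ?thesis by (simp add: I_def J_def)
qed

definition cell :: "int \<times> int \<Rightarrow> (real \<times> real) set" where
  "cell n = {of_int (fst n) - 1/2..of_int (fst n) + 1/2} \<times> {of_int (snd n) - 1/2..of_int (snd n) + 1/2}"

text \<open>The square about a lattice point that carries all but \<open>2 \<eta>\<close> of the
  mass of its cell.\<close>

definition core :: "real \<Rightarrow> int \<times> int \<Rightarrow> (real \<times> real) set" where
  "core a n = {of_int (fst n) - 3*a<..<of_int (fst n) + 3*a} \<times> {of_int (snd n) - 3*a<..<of_int (snd n) + 3*a}"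

lemma borel_cell [measurable]: "cell n \<in> sets borel" "core a n \<in> sets borel"
  unfolding cell_def core_def by (simp_all add: borel_prod[symmetric])

lemma weight2_cell:
  assumes a: "0 < a" "a \<le> 1/6" and \<eta>: "0 \<le> \<eta>" and s0: "s 0 = 1" and pos: "\<And>x. trig N s x \<ge> 0"
    and tail: "\<And>x. (\<And>n::int. 3 * a \<le> \<bar>x - of_int n\<bar>) \<Longrightarrow> trig N s x \<le> \<eta>"
  defines "\<mu> \<equiv> emeasure (weight2 (trig N s))"
  shows "\<mu> (cell n) = 1" "\<mu> (cell n - core a n) \<le> ennreal (2 * \<eta>)" "1 \<le> \<mu> (core a n) + ennreal (2 * \<eta>)"
proof -
  define I where "I m = {real_of_int m - 1/2..of_int m + 1/2}" for m
  define J where "J m = {real_of_int m - 3 * a<..<of_int m + 3 * a}" for m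
  have IJ: "I m \<in> sets borel" "J m \<in> sets borel" for m by (auto simp: I_def J_def)
  have \<sigma>: "trig N s \<in> borel_measurable borel" by (intro borel_measurable_continuous_onI continuous_intros)
  note T = emeasure_weight2_Times[OF \<sigma> pos]
  have wI: "weight (trig N s) (I m) = 1" for m unfolding I_def by (rule weight_cell[OF s0 pos])
  have wT: "weight (trig N s) (I m - J m) \<le> ennreal \<eta>" for m unfolding I_def J_def by (rule weight_tail[OF a \<eta> tail])
  show 1: "\<mu> (cell n) = 1" unfolding \<mu>_def cell_def I_def[symmetric] using IJ by (simp add: T wI)
  have "cell n - core a n \<subseteq> (I (fst n) - J (fst n)) \<times> I (snd n) \<union> I (fst n) \<times> (I (snd n) - J (snd n))"
    by (auto simp: cell_def core_def I_def J_def)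
  then have "\<mu> (cell n - core a n) \<le> \<mu> ((I (fst n) - J (fst n)) \<times> I (snd n) \<union> I (fst n) \<times> (I (snd n) - J (snd n)))"
    unfolding \<mu>_def using IJ by (intro emeasure_mono) (auto simp: borel_prod[symmetric])
  also have "\<dots> \<le> \<mu> ((I (fst n) - J (fst n)) \<times> I (snd n)) + \<mu> (I (fst n) \<times> (I (snd n) - J (snd n)))"
    unfolding \<mu>_def using IJ by (intro emeasure_subadditive) (auto simp: borel_prod[symmetric])
  also have "\<dots> \<le> ennreal \<eta> + ennreal \<eta>"
    unfolding \<mu>_def using IJ wT by (intro add_mono) (simp_all add: T wI)
  also have "\<dots> = ennreal (2 * \<eta>)" using \<eta> by (simp flip: ennreal_plus)
  finally show 2: "\<mu> (cell n - core a n) \<le> ennreal (2 * \<eta>)" .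
  have "1 = \<mu> (cell n)" using 1 by simp
  also have "\<dots> \<le> \<mu> (core a n \<union> (cell n - core a n))" unfolding \<mu>_def by (intro emeasure_mono) auto
  also have "\<dots> \<le> \<mu> (core a n) + \<mu> (cell n - core a n)" unfolding \<mu>_def by (intro emeasure_subadditive) auto
  also have "\<dots> \<le> \<mu> (core a n) + ennreal (2 * \<eta>)" by (intro add_mono 2) auto
  finally show "1 \<le> \<mu> (core a n) + ennreal (2 * \<eta>)" .
qed

lemma core_disjoint: "a \<le> 1/6 \<Longrightarrow> m \<noteq> n \<Longrightarrow> core a m \<inter> core a n = {}"
proof (rule ccontr)
  assume a: "a \<le> 1/6" and mn: "m \<noteq> n" and "core a m \<inter> core a n \<noteq> {}"
  then obtain z where z: "z \<in> core a m" "z \<in> core a n" by auto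
  have "\<bar>real_of_int (fst m) - of_int (fst n)\<bar> < 1" "\<bar>real_of_int (snd m) - of_int (snd n)\<bar> < 1"
    using z a by (auto simp: core_def)
  then have "fst m = fst n" "snd m = snd n" by linarith+
  then show False using mn by (simp add: prod_eq_iff)
qed

lemma cell_cover: "z \<in> cell (round (fst z), round (snd z))"
  using of_int_round_abs_le[of "fst z"] of_int_round_abs_le[of "snd z"]
  unfolding abs_le_iff by (cases z) (auto simp: cell_def)

text \<open>Half the diagonal of a core is \<open>3 sqrt 2 a\<close>, which is below
  \<open>5 a\<close>.\<close>

lemma core_norm: "z \<in> core a n \<Longrightarrow> norm (z - pt n) < 5 * a"
proof -
  assume z: "z \<in> core a n"
  then have a: "a > 0" by (auto simp: core_def)
  define p q where "p = fst z - of_int (fst n)" and "q = snd z - of_int (snd n)"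
  have pq: "\<bar>p\<bar> < 3 * a" "\<bar>q\<bar> < 3 * a" using z by (auto simp: core_def p_def q_def abs_less_iff)
  have "p\<^sup>2 < (3 * a)\<^sup>2" "q\<^sup>2 < (3 * a)\<^sup>2" 
    using power_strict_mono[OF pq(1), of 2] power_strict_mono[OF pq(2), of 2] by simp_all
  then have "p\<^sup>2 + q\<^sup>2 < (5 * a)\<^sup>2" by (simp add: power_mult_distrib) (use mult_pos_pos[OF a a] in \<open>auto simp: power2_eq_square\<close>)
  then have "sqrt (p\<^sup>2 + q\<^sup>2) < 5 * a" 
    using real_sqrt_less_mono[of "p\<^sup>2 + q\<^sup>2" "(5 * a)\<^sup>2"] a unfolding real_sqrt_abs by simp
  moreover have "z - pt n = (p, q)" by (simp add: pt_def p_def q_def prod_eq_iff)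
  ultimately show ?thesis by (simp add: norm_Pair)
qed

context curved_domain
begin

definition Lat :: "real \<Rightarrow> (int \<times> int) set" where
  "Lat t = {n. pt n \<in> (\<lambda>x. t *\<^sub>R x) ` \<Omega>}"

lemma dil_norm: "z \<in> dil t \<Longrightarrow> t \<ge> 0 \<Longrightarrow> norm z \<le> t * r1"
proof -
  assume "z \<in> dil t" "t \<ge> 0"
  then obtain x where "x \<in> K" "z = t *\<^sub>R x" by (auto simp only: dil_def image_iff)
  then show ?thesis using K_norm[of x] \<open>t \<ge> 0\<close> by (simp add: mult_left_mono)
qed

text \<open>\<open>K\<close> contains the disc of radius \<open>r0\<close>, so a point within
  \<open>5 a\<close> of \<open>t \<Omega>\<close> lies in \<open>t K + b K = (t + b) K\<close> with
  \<open>b = 5 a / r0\<close>.\<close>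

lemma core_sub_dil:
  assumes t: "t > 0" and a: "a > 0" and n: "n \<in> Lat t"
  shows "core a n \<subseteq> dil (t + 5 * a / r0)"
proof
  fix z assume z: "z \<in> core a n"
  obtain x where x: "x \<in> \<Omega>" "pt n = t *\<^sub>R x" using n by (auto simp: Lat_def)
  define b where "b = 5 * a / r0"
  have b: "b > 0" using a r0 by (simp add: b_def)
  define w where "w = (1 / b) *\<^sub>R (z - pt n)"
  have "norm w = (1 / b) * norm (z - pt n)" using b by (simp add: w_def)
  also have "\<dots> \<le> (1 / b) * (5 * a)" using core_norm[OF z] b by (intro mult_left_mono) auto
  also have "\<dots> = r0" using a r0 by (simp add: b_def)
  finally have "norm w \<le> r0" .
  then have wK: "w \<in> K" using cball_K by auto
  have "z = t *\<^sub>R x + b *\<^sub>R w" using b x by (simp add: w_def)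
  also have "\<dots> = (t + b) *\<^sub>R ((t / (t + b)) *\<^sub>R x + (b / (t + b)) *\<^sub>R w)"
    using t b by (simp add: scaleR_add_right)
  also have "(t / (t + b)) *\<^sub>R x + (b / (t + b)) *\<^sub>R w \<in> K"
    using t b x wK closure_subset by (intro convexD[OF convex_K]) (auto simp flip: add_divide_distrib)
  ultimately show "z \<in> dil (t + 5 * a / r0)" unfolding dil_def b_def by blast
qed

text \<open>The reverse passage, from the dilate by \<open>t - b\<close> to
  \<open>t \<Omega>\<close>. The lattice point has to land in the open set, which is why the strict
  inequality of \<open>core_norm\<close> is used.\<close>

lemma core_dil_Lat:
  assumes a: "a > 0" and t: "5 * a / r0 < t" and z: "z \<in> core a n" "z \<in> dil (t - 5 * a / r0)"
  shows "n \<in> Lat t"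
proof -
  define b where "b = 5 * a / r0"
  have b: "b > 0" "b < t" using a r0 t by (auto simp: b_def)
  obtain x where x: "x \<in> K" "z = (t - b) *\<^sub>R x" using z(2) by (auto simp: dil_def b_def)
  define w where "w = (1 / b) *\<^sub>R (pt n - z)"
  have "norm w = (1 / b) * norm (z - pt n)" using b by (simp add: w_def norm_minus_commute)
  also have "\<dots> < (1 / b) * (5 * a)" using core_norm[OF z(1)] b by (intro mult_strict_left_mono) auto
  also have "\<dots> = r0" using a r0 by (simp add: b_def)
  finally have "norm w < r0" .
  then have w: "w \<in> interior \<Omega>" using r0(3) by (auto simp: interior_open[OF op])
  have "x - (b / t) *\<^sub>R (x - w) \<in> interior \<Omega>"
    by (rule mem_interior_closure_convex_shrink[OF conv w x(1)]) (use b in auto)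
  then have "x - (b / t) *\<^sub>R (x - w) \<in> \<Omega>" by (simp add: interior_open[OF op])
  moreover have "pt n = t *\<^sub>R (x - (b / t) *\<^sub>R (x - w))"
  proof -
    have "t *\<^sub>R (x - (b / t) *\<^sub>R (x - w)) = t *\<^sub>R x - b *\<^sub>R x + b *\<^sub>R w"
      using b by (simp add: scaleR_diff_right)
    also have "b *\<^sub>R w = pt n - z" using b by (simp add: w_def)
    finally show ?thesis using x(2) by (simp add: scaleR_diff_left)
  qed
  ultimately show ?thesis by (auto simp: Lat_def)
qed

text \<open>The mass of the dilate under \<open>weight2\<close>, expanded exactly because the kernel
  is a trigonometric polynomial.\<close>

definition smooth_count :: "nat \<Rightarrow> (int \<Rightarrow> real) \<Rightarrow> real \<Rightarrow> real" where
  "smooth_count N s t = Re (\<Sum>m\<in>{- int N..int N}. \<Sum>n\<in>{- int N..int N}. of_real (s m * s n) * coef (pt (m, n)) t)"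

lemma weight2_dil:
  assumes pos: "\<And>x. trig N s x \<ge> 0" and sym: "\<And>m. s (- m) = s m"
  shows "emeasure (weight2 (trig N s)) (dil t) = ennreal (smooth_count N s t)" "smooth_count N s t \<ge> 0"
proof -
  define g where "g z = trig N s (fst z) * trig N s (snd z)" for z
  have cg: "continuous_on S g" for S unfolding g_def by (intro continuous_intros)
  have ig: "integrable lborel (\<lambda>z. indicator (dil t) z *\<^sub>R g z)"
    by (rule borel_integrable_compact[OF compact_dil cg])
  have g0: "g z \<ge> 0" for z by (simp add: g_def pos)
  have dm[measurable]: "dil t \<in> sets borel" using compact_dil[of t] by (simp add: compact_imp_closed)
  have gm[measurable]: "g \<in> borel_measurable borel" by (intro borel_measurable_continuous_onI cg)
  have "emeasure (weight2 (trig N s)) (dil t) = (\<integral>\<^sup>+ z. ennreal (g z) * indicator (dil t) z \<partial>lborel)"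
    unfolding weight2_def g_def[symmetric] by (rule emeasure_density) simp_all
  also have "\<dots> = (\<integral>\<^sup>+ z. ennreal (indicator (dil t) z *\<^sub>R g z) \<partial>lborel)"
    by (intro nn_integral_cong) (auto simp: indicator_def)
  also have "\<dots> = ennreal (LINT z|lborel. indicator (dil t) z *\<^sub>R g z)"
    using g0 by (intro nn_integral_eq_integral ig) auto
  finally have 1: "emeasure (weight2 (trig N s)) (dil t) = ennreal (LINT z|lborel. indicator (dil t) z *\<^sub>R g z)" .
  have ge: "complex_of_real (g z) = (\<Sum>m\<in>{- int N..int N}. \<Sum>n\<in>{- int N..int N}. of_real (s m * s n) * ee (z \<bullet> pt (m, n)))" for z
  proof -
    have "complex_of_real (g z) = (\<Sum>m\<in>{- int N..int N}. \<Sum>n\<in>{- int N..int N}.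
        (of_real (s m) * ee (of_int m * fst z)) * (of_real (s n) * ee (of_int n * snd z)))"
      unfolding g_def of_real_mult trig_eq_ee[where c = s, OF sym] sum_product ..
    also have "\<dots> = (\<Sum>m\<in>{- int N..int N}. \<Sum>n\<in>{- int N..int N}. of_real (s m * s n) * ee (z \<bullet> pt (m, n)))"
      by (intro sum.cong) (auto simp: pt_def inner_prod_def ee_add mult_ac)
    finally show ?thesis .
  qed
  define E where "E m n z = indicator (dil t) z *\<^sub>R ee (z \<bullet> pt (m, n))" for m n z
  have ie: "integrable lborel (E m n)" for m n
    unfolding E_def by (intro borel_integrable_compact compact_dil continuous_intros)
  have "complex_of_real (LINT z|lborel. indicator (dil t) z *\<^sub>R g z) = (LINT z|lborel. complex_of_real (indicator (dil t) z *\<^sub>R g z))"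
    by (rule integral_complex_of_real[symmetric])
  also have "\<dots> = (LINT z|lborel. (\<Sum>m\<in>{- int N..int N}. \<Sum>n\<in>{- int N..int N}. of_real (s m * s n) * E m n z))"
  proof (rule Bochner_Integration.integral_cong)
    fix z
    have "complex_of_real (indicator (dil t) z *\<^sub>R g z) = indicator (dil t) z *\<^sub>R complex_of_real (g z)"
      by (simp add: scaleR_conv_of_real)
    also have "\<dots> = (\<Sum>m\<in>{- int N..int N}. \<Sum>n\<in>{- int N..int N}. of_real (s m * s n) * E m n z)"
      unfolding ge E_def scaleR_sum_right by simp
    finally show "complex_of_real (indicator (dil t) z *\<^sub>R g z) = (\<Sum>m\<in>{- int N..int N}. \<Sum>n\<in>{- int N..int N}. of_real (s m * s n) * E m n z)" .
  qed simp
  also have "\<dots> = (\<Sum>m\<in>{- int N..int N}. \<Sum>n\<in>{- int N..int N}. of_real (s m * s n) * (LINT z|lborel. E m n z))"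
    using ie by (simp add: Bochner_Integration.integral_sum)
  also have "\<dots> = (\<Sum>m\<in>{- int N..int N}. \<Sum>n\<in>{- int N..int N}. of_real (s m * s n) * coef (pt (m, n)) t)"
    by (simp add: coef_def E_def)
  finally have "(LINT z|lborel. indicator (dil t) z *\<^sub>R g z) = smooth_count N s t"
    unfolding smooth_count_def by (metis Re_complex_of_real)
  moreover have "(LINT z|lborel. indicator (dil t) z *\<^sub>R g z) \<ge> 0"
    using g0 by (intro Bochner_Integration.integral_nonneg) auto
  ultimately show "emeasure (weight2 (trig N s)) (dil t) = ennreal (smooth_count N s t)" "smooth_count N s t \<ge> 0"
    using 1 by auto
qed

text \<open>The cores of the points of \<open>Lat t\<close> are disjoint and lie in the dilate by
  \<open>t + b\<close>; the dilate by \<open>t - b\<close> is covered by the cells of these points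
  and by tails of other cells. The errors of 1 come from fixing the tail mass after the number of
  cells.\<close>

lemma sandwich:
  assumes R: "R \<ge> 1" and a: "0 < a" "a \<le> 1/6"
  obtains N s where "s 0 = 1" "\<And>m. s (- m) = s m" "\<And>m. \<bar>s m\<bar> \<le> 1"
    "\<And>m. m \<noteq> 0 \<Longrightarrow> \<bar>s m\<bar> \<le> 1 / (of_int m * a)\<^sup>2"
    "\<And>t. 5 * a / r0 < t \<Longrightarrow> t \<le> 4 * R \<Longrightarrow> real (card (Lat t)) - 1 \<le> smooth_count N s (t + 5 * a / r0)"
    "\<And>t. 5 * a / r0 < t \<Longrightarrow> t \<le> 4 * R \<Longrightarrow> smooth_count N s (t - 5 * a / r0) \<le> real (card (Lat t)) + 1"
proof -
  define b where "b = 5 * a / r0"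
  have b: "b > 0" using a r0 by (simp add: b_def)
  \<comment> \<open>A box of lattice points whose cells cover every dilate in question, with margin
    1 for rounding; \<open>\<eta>\<close> makes the tails of all its cells add up to at most
    1.\<close>
  define B where "B = \<lceil>4 * R * r1 + 1\<rceil>"
  define X where "X = {- B..B} \<times> {- B..B}"
  define \<eta> where "\<eta> = 1 / (2 * (real (card X) + 1))"
  have fX: "finite X" by (simp add: X_def)
  have a2: "a \<le> 1/2" using a(2) by simp
  have \<eta>: "\<eta> > 0" "2 * \<eta> * real (card X) \<le> 1" by (auto simp: \<eta>_def divide_simps)
  obtain N s where s: "s 0 = 1" "\<And>m. s (- m) = s m" "\<And>m. \<bar>s m\<bar> \<le> 1"
    "\<And>m. m \<noteq> 0 \<Longrightarrow> \<bar>s m\<bar> \<le> 1 / (of_int m * a)\<^sup>2"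
    and pos: "\<And>x. 0 \<le> trig N s x"
    and tail': "\<forall>x. (\<forall>n::int. 3 * a \<le> \<bar>x - of_int n\<bar>) \<longrightarrow> trig N s x \<le> \<eta>"
    by (rule smoothing_kernel[OF a(1) a2 \<eta>(1)]) (rule that)
  have tail: "\<And>x. (\<And>n::int. 3 * a \<le> \<bar>x - of_int n\<bar>) \<Longrightarrow> trig N s x \<le> \<eta>" using tail' by blast
  define \<mu> where "\<mu> = emeasure (weight2 (trig N s))"
  note C = weight2_cell[OF a less_imp_le[OF \<eta>(1)] s(1) pos tail, folded \<mu>_def]
  have bX: "(x, y) \<in> X" if "\<bar>real_of_int x\<bar> \<le> 4 * R * r1 + 1" "\<bar>real_of_int y\<bar> \<le> 4 * R * r1 + 1" for x y
    using that unfolding X_def B_def by (auto simp: abs_le_iff le_ceiling_iff minus_le_iff) linarith+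
  have LX: "Lat t \<subseteq> X" if t: "0 < t" "t \<le> 4 * R" for t
  proof
    fix n assume n: "n \<in> Lat t"
    then have "pt n \<in> dil t" using closure_subset by (auto simp: Lat_def dil_def)
    then have "norm (pt n) \<le> t * r1" using dil_norm t by auto
    also have "\<dots> \<le> 4 * R * r1" using t r1_pos by (intro mult_right_mono) auto
    finally have "norm (pt n) \<le> 4 * R * r1" .
    moreover have "\<bar>real_of_int (fst n)\<bar> \<le> norm (pt n)" "\<bar>real_of_int (snd n)\<bar> \<le> norm (pt n)"
      using norm_fst_le[of "real_of_int (fst n)" "real_of_int (snd n)"] norm_snd_le[of "real_of_int (snd n)" "real_of_int (fst n)"] by (auto simp: pt_def)
    ultimately show "n \<in> X" using bX[of "fst n" "snd n"] by simp
  qed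
  show thesis
  proof (rule that[OF s])
    fix t assume t: "5 * a / r0 < t" "t \<le> 4 * R"
    have t0: "0 < t" using t b unfolding b_def by linarith
    have fL: "finite (Lat t)" using LX[OF t0 t(2)] fX finite_subset by blast
    have cL: "2 * \<eta> * real (card (Lat t)) \<le> 1"
    proof -
      have "2 * \<eta> * real (card (Lat t)) \<le> 2 * \<eta> * real (card X)"
        using card_mono[OF fX LX[OF t0 t(2)]] \<eta> by (intro mult_left_mono) auto
      then show ?thesis using \<eta> by linarith
    qed
    have "ennreal (real (card (Lat t))) = (\<Sum>n\<in>Lat t. 1)" by (simp add: ennreal_of_nat_eq_real_of_nat)
    also have "\<dots> \<le> (\<Sum>n\<in>Lat t. \<mu> (core a n) + ennreal (2 * \<eta>))" by (intro sum_mono C)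
    also have "\<dots> = (\<Sum>n\<in>Lat t. \<mu> (core a n)) + ennreal (real (card (Lat t)) * (2 * \<eta>))"
      using \<eta> by (simp add: sum.distrib ennreal_mult ennreal_of_nat_eq_real_of_nat)
    also have "(\<Sum>n\<in>Lat t. \<mu> (core a n)) = \<mu> (\<Union>n\<in>Lat t. core a n)"
      unfolding \<mu>_def using fL core_disjoint[OF a(2)]
      by (intro sum_emeasure) (auto simp: disjoint_family_on_def)
    also have "\<dots> \<le> \<mu> (dil (t + b))"
      unfolding \<mu>_def b_def using core_sub_dil[OF t0 a(1)] compact_dil
      by (intro emeasure_mono) (auto simp: compact_imp_closed)
    also have "\<dots> = ennreal (smooth_count N s (t + b))" unfolding \<mu>_def by (rule weight2_dil[OF pos s(2)])
    finally have "ennreal (real (card (Lat t))) \<le> ennreal (smooth_count N s (t + b)) + ennreal (real (card (Lat t)) * (2 * \<eta>))"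
      by (simp add: add_mono)
    also have "\<dots> = ennreal (smooth_count N s (t + b) + real (card (Lat t)) * (2 * \<eta>))"
      using \<eta> weight2_dil(2)[OF pos s(2)] by (subst ennreal_plus) auto
    finally have "real (card (Lat t)) \<le> smooth_count N s (t + b) + real (card (Lat t)) * (2 * \<eta>)"
      using \<eta> weight2_dil(2)[OF pos s(2), of "t + b"] by (subst (asm) ennreal_le_iff) auto
    then show "real (card (Lat t)) - 1 \<le> smooth_count N s (t + 5 * a / r0)"
      using cL by (simp add: b_def mult_ac)
    \<comment> \<open>A core that meets the smaller dilate has its centre in \<open>Lat t\<close>,
      so every other cell contributes only its part outside the core.\<close>
    have "dil (t - b) \<subseteq> (\<Union>n\<in>Lat t. cell n) \<union> (\<Union>n\<in>X. cell n - core a n)"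
    proof
      fix z assume z: "z \<in> dil (t - b)"
      define n where "n = (round (fst z), round (snd z))"
      have zc: "z \<in> cell n" unfolding n_def by (rule cell_cover)
      have "norm z \<le> (t - b) * r1" using dil_norm[OF z] t by (simp add: b_def)
      also have "\<dots> \<le> 4 * R * r1" using t b r1_pos by (intro mult_right_mono) auto
      finally have "norm z \<le> 4 * R * r1" .
      moreover have "\<bar>fst z\<bar> \<le> norm z" "\<bar>snd z\<bar> \<le> norm z"
        using norm_fst_le[of "fst z" "snd z"] norm_snd_le[of "snd z" "fst z"] by auto
      moreover have "\<bar>real_of_int (round (fst z)) - fst z\<bar> \<le> 1" "\<bar>real_of_int (round (snd z)) - snd z\<bar> \<le> 1"
        using of_int_round_abs_le[of "fst z"] of_int_round_abs_le[of "snd z"] by auto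
      ultimately have "n \<in> X" unfolding n_def by (intro bX) linarith+
      moreover have "n \<in> Lat t" if "z \<in> core a n"
        using core_dil_Lat[OF a(1) t(1) that] z by (simp add: b_def)
      ultimately show "z \<in> (\<Union>n\<in>Lat t. cell n) \<union> (\<Union>n\<in>X. cell n - core a n)" using zc by auto
    qed
    then have "\<mu> (dil (t - b)) \<le> \<mu> ((\<Union>n\<in>Lat t. cell n) \<union> (\<Union>n\<in>X. cell n - core a n))"
      unfolding \<mu>_def using fL fX by (intro emeasure_mono) auto
    also have "\<dots> \<le> \<mu> (\<Union>n\<in>Lat t. cell n) + \<mu> (\<Union>n\<in>X. cell n - core a n)"
      unfolding \<mu>_def using fL fX by (intro emeasure_subadditive) auto
    also have "\<dots> \<le> (\<Sum>n\<in>Lat t. \<mu> (cell n)) + (\<Sum>n\<in>X. \<mu> (cell n - core a n))"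
      unfolding \<mu>_def using fL fX by (intro add_mono emeasure_subadditive_finite) auto
    also have "\<dots> \<le> (\<Sum>n\<in>Lat t. 1) + (\<Sum>n\<in>X. ennreal (2 * \<eta>))"
      by (intro add_mono sum_mono) (auto simp: C)
    also have "\<dots> = ennreal (real (card (Lat t)) + real (card X) * (2 * \<eta>))"
      using \<eta> by (simp add: ennreal_of_nat_eq_real_of_nat ennreal_mult)
    finally have "ennreal (smooth_count N s (t - b)) \<le> ennreal (real (card (Lat t)) + real (card X) * (2 * \<eta>))"
      unfolding \<mu>_def weight2_dil(1)[OF pos s(2)] .
    then have "smooth_count N s (t - b) \<le> real (card (Lat t)) + real (card X) * (2 * \<eta>)"
      using \<eta> by (subst (asm) ennreal_le_iff) auto
    then show "smooth_count N s (t - 5 * a / r0) \<le> real (card (Lat t)) + 1"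
      using \<eta>(2) by (simp add: b_def mult_ac)
  qed
qed

end

section \<open>Counting frequencies\<close>

lemma pt_diff: "pt (m - n) = pt m - pt n" by (simp add: pt_def prod_eq_iff)
lemma pt_add: "pt (m + n) = pt m + pt n" by (simp add: pt_def prod_eq_iff)
lemma pt_minus: "pt (- n) = - pt n" by (simp add: pt_def prod_eq_iff)
lemma pt_inject: "pt m = pt n \<longleftrightarrow> m = n" by (simp add: pt_def prod_eq_iff)

lemma abs_pt_le: "\<bar>real_of_int (fst n)\<bar> \<le> norm (pt n)" "\<bar>real_of_int (snd n)\<bar> \<le> norm (pt n)"
  using norm_fst_le[of "real_of_int (fst n)" "real_of_int (snd n)"]
    norm_snd_le[of "real_of_int (snd n)" "real_of_int (fst n)"] by (auto simp: pt_def)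

lemma norm_pt_ge_1: "n \<noteq> 0 \<Longrightarrow> 1 \<le> norm (pt n)"
proof -
  assume "n \<noteq> 0"
  then have "fst n \<noteq> 0 \<or> snd n \<noteq> 0" by (auto simp: prod_eq_iff)
  then have "1 \<le> \<bar>real_of_int (fst n)\<bar> \<or> 1 \<le> \<bar>real_of_int (snd n)\<bar>" by linarith
  then show ?thesis using abs_pt_le[of n] by linarith
qed

context curved_domain
begin

lemma continuous_rho: "continuous_on S rho"
proof (rule lipschitz_on_continuous_on)
  show "r1-lipschitz_on S rho"
    using rho_lip r1_pos by (intro lipschitz_onI) (auto simp: dist_norm)
qed

text \<open>Compare areas: the discs of radius \<open>q / 2\<close> about the points are disjoint
  and lie between two level sets of \<open>rho\<close> whose levels differ by a multiple of
  \<open>q\<close>, a region of area \<open>O(q (|x| + q))\<close>.\<close>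

lemma packing:
  obtains C where "C > 0" "\<And>q x S. 1 \<le> q \<Longrightarrow> finite S \<Longrightarrow> (\<And>p. p \<in> S \<Longrightarrow> x \<le> rho p \<and> rho p < x + 1) \<Longrightarrow>
    (\<And>p p'. p \<in> S \<Longrightarrow> p' \<in> S \<Longrightarrow> p \<noteq> p' \<Longrightarrow> q \<le> norm (p - p')) \<Longrightarrow> real (card S) \<le> C * (\<bar>x\<bar> + q) / q"
proof -
  define Pol where "Pol X = {z. rho z < X}" for X
  have cr: "continuous_on UNIV rho" by (rule continuous_rho)
  have oPol: "open (Pol X)" for X
    unfolding Pol_def by (rule open_Collect_less) (auto intro: cr continuous_on_const)
  have bPol: "bounded (Pol X)" for X
  proof (rule boundedI)
    fix z assume "z \<in> Pol X"
    then have "r0 * norm z \<le> X" using rho_lower[of z] by (simp add: Pol_def)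
    then show "norm z \<le> X / r0" using r0 by (simp add: field_simps)
  qed
  have mPol: "Pol X \<in> lmeasurable" for X by (rule bounded_set_imp_lmeasurable) (use oPol bPol in auto)
  define A where "A = measure lebesgue (Pol 1)"
  have A0: "A \<ge> 0" by (simp add: A_def)
  have mea: "measure lebesgue (Pol X) = X\<^sup>2 * A" if X: "X \<ge> 0" for X
  proof (cases "X = 0")
    case True
    then have "Pol X = {}" using rho_nonneg by (auto simp: Pol_def not_less)
    then show ?thesis using True by simp
  next
    case False
    then have X: "X > 0" using X by simp
    have "Pol X = (\<lambda>z. X *\<^sub>R z + 0) ` Pol 1"
    proof (intro equalityI subsetI)
      fix z assume "z \<in> Pol X"
      then have "(1/X) *\<^sub>R z \<in> Pol 1" using X by (simp add: Pol_def rho_scale field_simps)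
      moreover have "z = X *\<^sub>R ((1/X) *\<^sub>R z) + 0" using X by simp
      ultimately show "z \<in> (\<lambda>z. X *\<^sub>R z + 0) ` Pol 1" by blast
    next
      fix z assume "z \<in> (\<lambda>z. X *\<^sub>R z + 0) ` Pol 1"
      then obtain y where "y \<in> Pol 1" "z = X *\<^sub>R y + 0" by blast
      then show "z \<in> Pol X" using X mult_strict_left_mono[of "rho y" 1 X] by (simp add: Pol_def rho_scale)
    qed
    then show ?thesis using measure_lebesgue_affine[of X 0 "Pol 1"] X
      by (simp add: A_def power2_eq_square)
  qed
  define V where "V = measure lborel (ball (0::real\<times>real) 1)"
  have V0: "V > 0" unfolding V_def by (rule content_ball_pos) simp
  have ball: "measure lborel (ball p r) = r\<^sup>2 * V" if "r > 0" for p :: "real \<times> real" and r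
    using content_ball_conv_unit_ball[of r p] that by (simp add: V_def power2_eq_square)
  define C where "C = 8 * A * (1 + 2 * r1) * (1 + r1) / V + 1"
  have C0: "C > 0" unfolding C_def using A0 V0 r1_pos by (intro add_nonneg_pos divide_nonneg_pos mult_nonneg_nonneg) auto
  show thesis
  proof (rule that[OF C0])
    fix q x :: real and S :: "(real \<times> real) set"
    assume q: "1 \<le> q" and S: "finite S" and x: "\<And>p. p \<in> S \<Longrightarrow> x \<le> rho p \<and> rho p < x + 1"
      and sep: "\<And>p p'. p \<in> S \<Longrightarrow> p' \<in> S \<Longrightarrow> p \<noteq> p' \<Longrightarrow> q \<le> norm (p - p')"
    show "real (card S) \<le> C * (\<bar>x\<bar> + q) / q"
    proof (cases "S = {}")
      case True
      then show ?thesis using C0 q by simp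
    next
      case False
      then obtain p0 where p0: "p0 \<in> S" by blast
      have x1: "x + 1 > 0" using x[OF p0] rho_nonneg[of p0] by linarith
      \<comment> \<open>On a disc \<open>rho\<close> varies by at most \<open>r1 q / 2\<close>. The
        maximum with 0 covers the case that the region reaches the origin.\<close>
      define X1 where "X1 = max 0 (x - r1 * q)"
      define X2 where "X2 = x + 1 + r1 * q"
      have r1q: "r1 * q > 0" using r1_pos q by simp
      have X12: "0 \<le> X1" "X1 \<le> X2"
        using x1 r1q max.boundedI[of 0 "x + 1 + r1 * q" "x - r1 * q"] by (auto simp only: X1_def X2_def max.cobounded1)
      define U where "U = (\<Union>p\<in>S. ball p (q / 2))"
      have mU: "measure lebesgue U = real (card S) * ((q / 2)\<^sup>2 * V)"
      proof -
        have "measure lebesgue U = (\<Sum>p\<in>S. measure lebesgue (ball p (q / 2)))"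
          unfolding U_def
        proof (rule measure_UNION'[OF S])
          show "pairwise (\<lambda>p p'. disjnt (ball p (q / 2)) (ball p' (q / 2))) S"
            unfolding pairwise_def disjnt_iff
          proof (intro ballI impI allI notI)
            fix p p' z assume p: "p \<in> S" "p' \<in> S" "p \<noteq> p'" "z \<in> ball p (q / 2) \<and> z \<in> ball p' (q / 2)"
            then have "dist p p' < q" using dist_triangle_half_l[of p z q p'] by (auto simp: dist_commute)
            then show False using sep[OF p(1-3)] by (simp add: dist_norm)
          qed
        qed (rule lmeasurable_ball)
        also have "\<dots> = real (card S) * ((q / 2)\<^sup>2 * V)" using q by (simp add: ball)
        finally show ?thesis .
      qed
      have sub: "U \<union> Pol X1 \<subseteq> Pol X2" and disj: "U \<inter> Pol X1 = {}"
      proof -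
        have z: "X1 \<le> rho z \<and> rho z < X2" if zU: "z \<in> U" for z
        proof -
          obtain p where p: "p \<in> S" "dist p z < q / 2" using zU by (auto simp: U_def)
          have "r1 * norm (z - p) \<le> r1 * (q / 2)"
            using p r1_pos by (intro mult_left_mono) (auto simp: dist_norm norm_minus_commute)
          then have "\<bar>rho z - rho p\<bar> \<le> r1 * q / 2" using rho_lip[of z p] by simp
          then show ?thesis using x[OF p(1)] rho_nonneg[of z] r1q unfolding X1_def X2_def abs_le_iff by auto
        qed
        show "U \<union> Pol X1 \<subseteq> Pol X2" using z X12 by (auto simp: Pol_def) 
        show "U \<inter> Pol X1 = {}" using z by (force simp: Pol_def)
      qed
      have U: "U \<in> lmeasurable" by (rule bounded_set_imp_lmeasurable) (use S in \<open>auto simp: U_def\<close>)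
      have "Pol X1 - U = Pol X1" using disj by auto
      then have "measure lebesgue U + measure lebesgue (Pol X1) = measure lebesgue (U \<union> Pol X1)"
        using U mPol by (simp add: measure_Un2)
      also have "\<dots> \<le> measure lebesgue (Pol X2)"
        using sub U mPol by (intro measure_mono_fmeasurable) auto
      finally have "real (card S) * ((q / 2)\<^sup>2 * V) \<le> A * (X2\<^sup>2 - X1\<^sup>2)"
        unfolding mU using mea[of X1] mea[of X2] X12 by (simp add: algebra_simps)
      also have "X2\<^sup>2 - X1\<^sup>2 = (X2 - X1) * (X2 + X1)" by (simp add: power2_eq_square algebra_simps)
      also have "A * ((X2 - X1) * (X2 + X1)) \<le> A * (((1 + 2 * r1) * q) * (2 * ((1 + r1) * (\<bar>x\<bar> + q))))"
      proof (intro mult_left_mono mult_mono)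
        show "X2 - X1 \<le> (1 + 2 * r1) * q" using q x1 unfolding X1_def X2_def by (simp add: algebra_simps max_def)
        have "r1 * \<bar>x\<bar> \<ge> 0" using r1_pos by simp
        then have "X2 \<le> (1 + r1) * (\<bar>x\<bar> + q)" using q unfolding X2_def by (simp add: algebra_simps)
        then show "X2 + X1 \<le> 2 * ((1 + r1) * (\<bar>x\<bar> + q))" using X12 by simp
      qed (use A0 X12 r1_pos q in auto)
      finally have "4 * (real (card S) * ((q / 2)\<^sup>2 * V)) \<le> 4 * (A * (((1 + 2 * r1) * q) * (2 * ((1 + r1) * (\<bar>x\<bar> + q)))))"
        by (rule mult_left_mono) simp
      moreover have "4 * (real (card S) * ((q / 2)\<^sup>2 * V)) = real (card S) * q * V * q"
        by (simp add: power2_eq_square)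
      moreover have "4 * (A * (((1 + 2 * r1) * q) * (2 * ((1 + r1) * (\<bar>x\<bar> + q))))) = (8 * A * (1 + 2 * r1) * (1 + r1)) * (\<bar>x\<bar> + q) * q"
        by (simp add: algebra_simps)
      ultimately have "real (card S) * q * V * q \<le> (8 * A * (1 + 2 * r1) * (1 + r1)) * (\<bar>x\<bar> + q) * q"
        by (simp only:)
      then have "real (card S) * q * V \<le> (8 * A * (1 + 2 * r1) * (1 + r1)) * (\<bar>x\<bar> + q)"
        using q by (subst (asm) mult_le_cancel_right_pos) auto
      then have "real (card S) * q \<le> (8 * A * (1 + 2 * r1) * (1 + r1)) * (\<bar>x\<bar> + q) / V"
        using V0 by (simp add: pos_le_divide_eq)
      also have "\<dots> \<le> C * (\<bar>x\<bar> + q)" using q by (simp add: C_def distrib_right)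
      finally show ?thesis using q by (simp add: field_simps)
    qed
  qed
qed

text \<open>\<open>rho\<close> is homogeneous and at least \<open>r0 * norm k\<close>, so a radial
  step changes it at a definite rate. A step that nearly preserves \<open>rho\<close> must therefore
  be transversal to \<open>k\<close>.\<close>

lemma cross_lower:
  assumes d: "1 \<le> norm d" "norm d \<le> norm k" and near: "\<bar>rho (k + d) - rho k\<bar> \<le> r0 / 2"
  shows "r0 / (2 * (r0 + r1)) * (norm k * norm d) \<le> \<bar>perp k \<bullet> d\<bar>"
proof -
  have k: "norm k > 0" using d by linarith
  then have k0: "k \<noteq> 0" by auto
  define \<alpha> where "\<alpha> = (d \<bullet> k) / (norm k)\<^sup>2"
  define \<beta> where "\<beta> = (d \<bullet> perp k) / (norm k)\<^sup>2"
  have dd: "d = \<alpha> *\<^sub>R k + \<beta> *\<^sub>R perp k"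
    using frame_decomp[OF k0, of d] by (simp add: frame_def \<alpha>_def \<beta>_def)
  have "\<bar>d \<bullet> k\<bar> \<le> norm d * norm k" by (rule Cauchy_Schwarz_ineq2)
  also have "\<dots> \<le> norm k * norm k" using d by (intro mult_right_mono) auto
  finally have "\<bar>\<alpha>\<bar> \<le> 1" using k by (simp add: \<alpha>_def power2_eq_square)
  then have a1: "0 \<le> 1 + \<alpha>" by linarith
  have "k + d - (1 + \<alpha>) *\<^sub>R k = \<beta> *\<^sub>R perp k" by (simp add: dd algebra_simps)
  then have "\<bar>rho (k + d) - rho ((1 + \<alpha>) *\<^sub>R k)\<bar> \<le> r1 * (\<bar>\<beta>\<bar> * norm k)"
    using rho_lip[of "k + d" "(1 + \<alpha>) *\<^sub>R k"] by simp
  moreover have "rho ((1 + \<alpha>) *\<^sub>R k) = rho k + \<alpha> * rho k" using rho_scale[OF a1] by (simp add: algebra_simps)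
  ultimately have "\<bar>\<alpha> * rho k\<bar> \<le> r0 / 2 + r1 * (\<bar>\<beta>\<bar> * norm k)" using near by linarith
  moreover have "\<bar>\<alpha>\<bar> * (r0 * norm k) \<le> \<bar>\<alpha> * rho k\<bar>"
    using rho_lower[of k] rho_nonneg[of k] by (simp add: abs_mult mult_left_mono)
  moreover have "r0 / 2 * 1 \<le> r0 / 2 * norm d" using d r0 by (intro mult_left_mono) auto
  ultimately have 1: "\<bar>\<alpha>\<bar> * (r0 * norm k) \<le> r0 / 2 * norm d + r1 * (\<bar>\<beta>\<bar> * norm k)"
    by linarith
  have "norm d \<le> \<bar>\<alpha>\<bar> * norm k + \<bar>\<beta>\<bar> * norm k"
    using norm_triangle_ineq[of "\<alpha> *\<^sub>R k" "\<beta> *\<^sub>R perp k"] dd by simp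
  then have "r0 * norm d \<le> r0 * (\<bar>\<alpha>\<bar> * norm k + \<bar>\<beta>\<bar> * norm k)" using r0 by (intro mult_left_mono) auto
  then have "r0 * norm d \<le> r0 / 2 * norm d + (r0 + r1) * (\<bar>\<beta>\<bar> * norm k)" using 1 by (simp add: algebra_simps)
  then have 2: "r0 / 2 * norm d \<le> (r0 + r1) * (\<bar>\<beta>\<bar> * norm k)" by (simp add: algebra_simps)
  have rr: "r0 + r1 > 0" using r0 r1_pos by simp
  have "\<bar>\<beta>\<bar> * norm k * norm k = \<bar>perp k \<bullet> d\<bar>"
    using k by (simp add: \<beta>_def power2_eq_square inner_commute)
  moreover have "r0 / 2 * norm d * norm k \<le> (r0 + r1) * (\<bar>\<beta>\<bar> * norm k) * norm k" using 2 by (intro mult_right_mono) auto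
  ultimately have "r0 / 2 * norm d * norm k \<le> (r0 + r1) * \<bar>perp k \<bullet> d\<bar>" by (simp add: mult.assoc)
  then show ?thesis using rr by (simp add: field_simps)
qed

section \<open>Convexity of the support function along lattice lines\<close>

definition incr :: "int \<times> int \<Rightarrow> int \<times> int \<Rightarrow> real" where
  "incr d k = rho (pt (k + d)) - rho (pt k)"

text \<open>Subadditivity of \<open>rho\<close> at \<open>2 (k + d) = k + (k + 2 d)\<close>.\<close>

lemma incr_mono: "incr d k \<le> incr d (k + d)"
proof -
  have "rho (2 *\<^sub>R pt (k + d)) \<le> rho (pt k) + rho (pt (k + d + d))"
    using rho_add[of "pt k" "pt (k + d + d)"] by (simp add: pt_add scaleR_2 algebra_simps)
  then show ?thesis by (simp add: rho_scale incr_def)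
qed

lemma incr_mono_mult: "incr d k \<le> incr d (k + (int n * fst d, int n * snd d))"
proof (induction n)
  case (Suc n)
  have eq: "k + (int n * fst d, int n * snd d) + d = k + (int (Suc n) * fst d, int (Suc n) * snd d)"
    by (simp add: prod_eq_iff algebra_simps)
  from order.trans[OF Suc incr_mono[of d "k + (int n * fst d, int n * snd d)"]] show ?case unfolding eq .
qed (simp flip: zero_prod_def)

text \<open>Along a line in direction \<open>d\<close> the increments increase, and at each counted point by more than \<open>\<sigma>\<close>;
  so a point is determined by its line and by \<open>\<lfloor>incr d k / \<sigma>\<rfloor>\<close>.\<close>
lemma card_steep:
  fixes quo :: "int \<times> int \<Rightarrow> int"
  assumes \<sigma>: "\<sigma> > 0" and t0: "\<tau> \<ge> 0" and E: "finite E"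
    and X: "\<And>k. k \<in> X \<Longrightarrow> \<bar>incr d k\<bar> \<le> \<tau> \<and> \<sigma> < incr d k - incr d (k - d)"
    and quo: "\<And>k. k \<in> X \<Longrightarrow> k - (quo k * fst d, quo k * snd d) \<in> E"
  shows "finite X" "real (card X) \<le> real (card E) * (2 * \<tau> / \<sigma> + 2)"
proof -
  \<comment> \<open>The chosen representative of the line through \<open>k\<close> in direction
    \<open>d\<close>.\<close>
  define e where "e k = k - (quo k * fst d, quo k * snd d)" for k
  define bk where "bk k = \<lfloor>incr d k / \<sigma>\<rfloor>" for k
  define I where "I = {\<lfloor>- \<tau> / \<sigma>\<rfloor>..\<lfloor>\<tau> / \<sigma>\<rfloor>}"
  have lt: "bk k < bk k'" if k: "k' \<in> X" "k' = k + (int n * fst d, int n * snd d)" "n \<ge> 1" for k k' n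
  proof -
    have "k' - d = k + (int (n - 1) * fst d, int (n - 1) * snd d)"
      using k by (simp add: prod_eq_iff of_nat_diff algebra_simps)
    \<comment> \<open>One step back from \<open>k'\<close> is still at or beyond \<open>k\<close>,
      so the jump \<open>\<sigma>\<close> at \<open>k'\<close> comes on top of
      \<open>incr d k\<close>.\<close>
    then have "incr d k \<le> incr d (k' - d)" using incr_mono_mult by simp
    then have "incr d k + \<sigma> < incr d k'" using X[OF k(1)] by linarith
    then have "(incr d k + \<sigma>) / \<sigma> < incr d k' / \<sigma>" using \<sigma> by (rule divide_strict_right_mono)
    then have "incr d k / \<sigma> + 1 < incr d k' / \<sigma>" using \<sigma> by (simp add: add_divide_distrib)
    then show ?thesis unfolding bk_def by linarith
  qed
  have inj: "inj_on (\<lambda>k. (e k, bk k)) X"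
  proof (rule inj_onI)
    fix k k' assume kk: "k \<in> X" "k' \<in> X" "(e k, bk k) = (e k', bk k')"
    define n where "n = quo k' - quo k"
    have k': "k' = k + (n * fst d, n * snd d)"
      using kk(3) by (auto simp: e_def n_def prod_eq_iff algebra_simps)
    then have k: "k = k' + ((- n) * fst d, (- n) * snd d)" by (simp add: prod_eq_iff)
    show "k = k'"
    proof (cases "n = 0")
      case True then show ?thesis using k' by (simp add: prod_eq_iff)
    next
      case False
      then consider "n \<ge> 1" | "- n \<ge> 1" by linarith
      then show ?thesis
      proof cases
        case 1
        then have "bk k < bk k'" using lt[OF kk(2), of k "nat n"] k' by simp
        then show ?thesis using kk by simp
      next
        case 2
        then have "bk k' < bk k" using lt[OF kk(1), of k' "nat (- n)"] k by simp
        then show ?thesis using kk by simp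
      qed
    qed
  qed
  have img: "(\<lambda>k. (e k, bk k)) ` X \<subseteq> E \<times> I"
  proof -
    have "bk k \<in> I" if "k \<in> X" for k
    proof -
      have "- \<tau> / \<sigma> \<le> incr d k / \<sigma>" "incr d k / \<sigma> \<le> \<tau> / \<sigma>" 
        using X[OF that] \<sigma> divide_right_mono[of "- \<tau>" "incr d k" \<sigma>] divide_right_mono[of "incr d k" \<tau> \<sigma>]
        by (auto simp: abs_le_iff)
      then show ?thesis by (auto simp: I_def bk_def intro: floor_mono)
    qed
    then show ?thesis using quo by (auto simp: e_def)
  qed
  have fI: "finite (E \<times> I)" using E by (simp add: I_def)
  show "finite X" using inj img fI by (meson finite_imageD finite_subset)
  show "real (card X) \<le> real (card E) * (2 * \<tau> / \<sigma> + 2)"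
  proof -
    have "card X \<le> card (E \<times> I)" by (rule card_inj_on_le[OF inj img fI])
    then have "real (card X) \<le> real (card E) * real (card I)" by (simp add: card_cartesian_product flip: of_nat_mult)
    also have "real (card I) \<le> 2 * \<tau> / \<sigma> + 2"
    proof -
      have "\<lfloor>- \<tau> / \<sigma>\<rfloor> \<le> \<lfloor>\<tau> / \<sigma>\<rfloor>" using t0 \<sigma> by (intro floor_mono divide_right_mono) auto
      then have "real (card I) = of_int (\<lfloor>\<tau> / \<sigma>\<rfloor> - \<lfloor>- \<tau> / \<sigma>\<rfloor> + 1)" by (simp add: I_def)
      also have "\<dots> \<le> \<tau> / \<sigma> - (- \<tau> / \<sigma> - 1) + 1" unfolding of_int_add of_int_diff by linarith
      finally show ?thesis by simp
    qed
    finally show ?thesis by (simp add: mult_left_mono)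
  qed
qed

end

text \<open>With \<open>Q = 2 ^ j\<close> the twelfth root of the inner radius, the bounds below
  become integer powers of \<open>Q\<close>: \<open>Q^24\<close> points, clusters of
  \<open>Q^12\<close>, amplitudes with \<open>Q^-18\<close>.\<close>

definition shell :: "nat \<Rightarrow> (int \<times> int) set" where
  "shell j = {k. (2 ^ j) ^ 12 \<le> norm (pt k) \<and> norm (pt k) < (2 * 2 ^ j) ^ 12}"

lemma shell_subset: "shell j \<subseteq> {- 4096 * (2 ^ j) ^ 12..4096 * (2 ^ j) ^ 12} \<times> {- 4096 * (2 ^ j) ^ 12..4096 * (2 ^ j) ^ 12}"
proof
  fix k assume k: "k \<in> shell j"
  define B :: int where "B = 4096 * (2 ^ j) ^ 12"
  have "norm (pt k) \<le> of_int B" using k by (simp add: shell_def B_def power_mult_distrib)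
  then have "\<bar>real_of_int (fst k)\<bar> \<le> of_int B" "\<bar>real_of_int (snd k)\<bar> \<le> of_int B"
    using abs_pt_le[of k] by linarith+
  then have "\<bar>fst k\<bar> \<le> B" "\<bar>snd k\<bar> \<le> B" by linarith+
  then show "k \<in> {- 4096 * (2 ^ j) ^ 12..4096 * (2 ^ j) ^ 12} \<times> {- 4096 * (2 ^ j) ^ 12..4096 * (2 ^ j) ^ 12}"
    unfolding B_def by (cases k) (auto simp: abs_le_iff)
qed

lemma finite_shell: "finite (shell j)"
  by (rule finite_subset[OF shell_subset]) simp

lemma card_shell:
  assumes "Z \<subseteq> shell j"
  shows "real (card Z) \<le> 10 ^ 9 * (2 ^ j) ^ 24"
proof -
  define B :: int where "B = 4096 * (2 ^ j) ^ 12"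
  have "(1::int) \<le> (2 ^ j) ^ 12" by (intro one_le_power) simp
  then have B: "B \<ge> 1" unfolding B_def by linarith
  have "card Z \<le> card ({- B..B} \<times> {- B..B})"
    using order.trans[OF assms shell_subset] by (intro card_mono) (simp_all add: B_def)
  also have "\<dots> = nat (2 * B + 1) * nat (2 * B + 1)" by (simp add: card_cartesian_product)
  finally have "real (card Z) \<le> real (nat (2 * B + 1)) * real (nat (2 * B + 1))" by (simp flip: of_nat_mult)
  also have "\<dots> \<le> of_int (3 * B) * of_int (3 * B)" using B by (intro mult_mono) auto
  also have "\<dots> = (9 * 4096 * 4096) * (2 ^ j) ^ 24"
  proof -
    have "((2::real) ^ j) ^ 24 = (2 ^ j) ^ 12 * (2 ^ j) ^ 12" by (simp flip: power_add)
    then show ?thesis by (simp add: B_def)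
  qed
  also have "\<dots> \<le> 10 ^ 9 * (2 ^ j) ^ 24" by (intro mult_right_mono) auto
  finally show ?thesis .
qed

lemma int_quot_bounds:
  fixes a b :: int
  assumes b: "b \<noteq> 0"
  shows "\<bar>a - a div b * b\<bar> \<le> \<bar>b\<bar>" "\<bar>a div b\<bar> \<le> \<bar>a\<bar> + 1"
proof -
  have "a - a div b * b = a mod b" by (simp add: minus_div_mult_eq_mod)
  then show 1: "\<bar>a - a div b * b\<bar> \<le> \<bar>b\<bar>" using abs_mod_less[OF b, of a] by simp
  have "\<bar>a div b\<bar> * \<bar>b\<bar> \<le> \<bar>a\<bar> + \<bar>b\<bar>" using 1 unfolding abs_mult[symmetric] by linarith
  also have "\<dots> \<le> (\<bar>a\<bar> + 1) * \<bar>b\<bar>"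
    using b mult_left_mono[of 1 "\<bar>b\<bar>" "\<bar>a\<bar>"] by (simp add: distrib_right)
  finally show "\<bar>a div b\<bar> \<le> \<bar>a\<bar> + 1" using b by (simp add: mult_le_cancel_right)
qed

text \<open>Bookkeeping for one class of frequencies: amplitudes \<open>a sqrt R / Q^m\<close>,
  \<open>n Q^p\<close> frequencies, clusters of \<open>D Q^r\<close>. The budget
  \<open>p + r + 1 \<le> 2 m\<close> leaves one factor \<open>1 / Q\<close>.\<close>

lemma power_bound:
  fixes Q :: real
  assumes Q: "1 \<le> Q" and m: "p + r + 1 \<le> 2 * m" and nn: "0 \<le> C" "0 \<le> n" "0 \<le> D" "0 \<le> R"
  shows "C * sqrt R * (a * sqrt R / Q ^ m)\<^sup>2 * (n * Q ^ p) * (D * Q ^ r) \<le> (C * a\<^sup>2 * n * D) * (R * sqrt R) / Q"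
proof -
  have Q0: "Q > 0" using Q by simp
  have sq: "(a * sqrt R / Q ^ m)\<^sup>2 = a\<^sup>2 * R / Q ^ (2 * m)"
    using nn by (simp add: power_mult_distrib power_divide power_even_eq)
  have "C * sqrt R * (a * sqrt R / Q ^ m)\<^sup>2 * (n * Q ^ p) * (D * Q ^ r)
      = (C * a\<^sup>2 * n * D) * (R * sqrt R) * (Q ^ (p + r) / Q ^ (2 * m))"
    unfolding sq by (simp add: power_add)
  also have "\<dots> \<le> (C * a\<^sup>2 * n * D) * (R * sqrt R) * (1 / Q)"
  proof (intro mult_left_mono)
    have "Q ^ (p + r + 1) \<le> Q ^ (2 * m)" using Q m by (rule power_increasing[rotated])
    then show "Q ^ (p + r) / Q ^ (2 * m) \<le> 1 / Q" using Q0 by (simp add: divide_simps mult.commute)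
  qed (use nn in auto)
  finally show ?thesis by simp
qed

context curved_domain
begin

lemma norm_shell: "k \<in> shell j \<Longrightarrow> 1 \<le> norm (pt k)" "k \<in> shell j \<Longrightarrow> pt k \<noteq> 0"
proof -
  assume k: "k \<in> shell j"
  have "(1::real) \<le> (2 ^ j) ^ 12" by (intro one_le_power) simp
  moreover have "(2 ^ j) ^ 12 \<le> norm (pt k)" using k unfolding shell_def by blast
  ultimately show "1 \<le> norm (pt k)" by linarith
  then show "pt k \<noteq> 0" by auto
qed

text \<open>\<open>packing\<close> inside a shell, where both the level \<open>x\<close> and the
  separation \<open>s\<close> are at most of the order of the radius.\<close>

lemma cluster_count:
  obtains C where "C > 0" "\<forall>j Z x s. Z \<subseteq> shell j \<longrightarrow> 1 \<le> s \<longrightarrow> s \<le> (2 ^ j) ^ 12 \<longrightarrow>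
    (\<forall>k\<in>Z. x \<le> rho (pt k) \<and> rho (pt k) < x + 1) \<longrightarrow>
    (\<forall>k\<in>Z. \<forall>k'\<in>Z. k \<noteq> k' \<longrightarrow> s \<le> norm (pt k - pt k')) \<longrightarrow>
    real (card Z) \<le> C * (2 ^ j) ^ 12 / s"
proof -
  obtain C where C: "C > 0" "\<And>q x S. 1 \<le> q \<Longrightarrow> finite S \<Longrightarrow> (\<And>p. p \<in> S \<Longrightarrow> x \<le> rho p \<and> rho p < x + 1) \<Longrightarrow>
    (\<And>p p'. p \<in> S \<Longrightarrow> p' \<in> S \<Longrightarrow> p \<noteq> p' \<Longrightarrow> q \<le> norm (p - p')) \<Longrightarrow> real (card S) \<le> C * (\<bar>x\<bar> + q) / q"
    using packing by blast
  define C' where "C' = C * (4096 * r1 + 2)"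
  have C': "C' > 0" using C r1_pos by (simp add: C'_def add_pos_pos)
  show thesis
  proof (rule that[OF C'], intro allI impI)
    fix j Z and x s :: real
    assume Z: "Z \<subseteq> shell j" and s: "1 \<le> s" "s \<le> (2 ^ j) ^ 12"
      and x: "\<forall>k\<in>Z. x \<le> rho (pt k) \<and> rho (pt k) < x + 1"
      and sep: "\<forall>k\<in>Z. \<forall>k'\<in>Z. k \<noteq> k' \<longrightarrow> s \<le> norm (pt k - pt k')"
    define Q :: real where "Q = (2 ^ j) ^ 12"
    have Q: "Q \<ge> 1" unfolding Q_def by (intro one_le_power) simp
    show "real (card Z) \<le> C' * (2 ^ j) ^ 12 / s"
    proof (cases "Z = {}")
      case True then show ?thesis using C' s by simp
    next
      case False
      then obtain k where k: "k \<in> Z" by blast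
      have "norm (pt k) \<le> 4096 * Q" using k Z by (auto simp: shell_def Q_def power_mult_distrib)
      then have "r1 * norm (pt k) \<le> r1 * (4096 * Q)" using r1_pos by (intro mult_left_mono) auto
      then have "rho (pt k) \<le> r1 * (4096 * Q)" using rho_upper[of "pt k"] by linarith
      then have xb: "\<bar>x\<bar> \<le> 1 + r1 * (4096 * Q)" using bspec[OF x k] rho_nonneg[of "pt k"] by linarith
      have "card Z = card (pt ` Z)" by (rule card_image[symmetric]) (simp add: inj_on_def pt_inject)
      also have "real (card (pt ` Z)) \<le> C * (\<bar>x\<bar> + s) / s"
      proof (rule C(2)[OF s(1)])
        show "finite (pt ` Z)" using Z finite_shell finite_subset by blast
        show "x \<le> rho p \<and> rho p < x + 1" if "p \<in> pt ` Z" for p using that x by blast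
        show "s \<le> norm (p - p')" if "p \<in> pt ` Z" "p' \<in> pt ` Z" "p \<noteq> p'" for p p'
        proof -
          obtain k k' where "k \<in> Z" "k' \<in> Z" "p = pt k" "p' = pt k'" using \<open>p \<in> pt ` Z\<close> \<open>p' \<in> pt ` Z\<close> by blast
          then show ?thesis using sep \<open>p \<noteq> p'\<close> by metis
        qed
      qed
      also have "\<dots> \<le> C * ((4096 * r1 + 2) * Q) / s"
      proof (intro divide_right_mono mult_left_mono)
        show "\<bar>x\<bar> + s \<le> (4096 * r1 + 2) * Q" using xb s Q by (simp add: Q_def algebra_simps)
      qed (use C s in auto)
      finally show ?thesis by (simp add: C'_def Q_def mult.assoc)
    qed
  qed
qed

text \<open>Distinct lattice points are at distance at least 1, so \<open>s = 1\<close> is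
  admissible in \<open>cluster_count\<close>.\<close>

lemma rho_count:
  obtains C where "C > 0" "\<And>j Z y w. Z \<subseteq> shell j \<Longrightarrow> w \<le> 1 \<Longrightarrow>
    real (card {k \<in> Z. y \<le> rho (pt k) \<and> rho (pt k) < y + w}) \<le> C * (2 ^ j) ^ 12"
proof -
  obtain C where C: "C > 0" "\<forall>j Z x s. Z \<subseteq> shell j \<longrightarrow> 1 \<le> s \<longrightarrow> s \<le> (2 ^ j) ^ 12 \<longrightarrow>
    (\<forall>k\<in>Z. x \<le> rho (pt k) \<and> rho (pt k) < x + 1) \<longrightarrow>
    (\<forall>k\<in>Z. \<forall>k'\<in>Z. k \<noteq> k' \<longrightarrow> s \<le> norm (pt k - pt k')) \<longrightarrow>
    real (card Z) \<le> C * (2 ^ j) ^ 12 / s" by (rule cluster_count)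
  show thesis
  proof (rule that[OF C(1)])
    fix j Z and y w :: real assume Z: "Z \<subseteq> shell j" and w: "w \<le> 1"
    have "real (card {k \<in> Z. y \<le> rho (pt k) \<and> rho (pt k) < y + w}) \<le> C * (2 ^ j) ^ 12 / 1"
      by (rule C(2)[rule_format, where x = y]) (use Z w in \<open>auto simp: pt_diff[symmetric] zero_prod_def intro!: norm_pt_ge_1\<close>)
    then show "real (card {k \<in> Z. y \<le> rho (pt k) \<and> rho (pt k) < y + w}) \<le> C * (2 ^ j) ^ 12" by simp
  qed
qed

lemma prof_shell:
  assumes k: "k \<in> shell j" and u: "0 \<le> u"
  shows "prof (pt k) u \<le> M * sqrt u / (2 ^ j) ^ 18"
proof -
  define Q :: real where "Q = 2 ^ j"
  have Q: "Q > 0" by (simp add: Q_def)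
  have "norm (pt k) \<ge> Q ^ 12" using k by (simp add: shell_def Q_def)
  then have "norm (pt k) powr (3/2) \<ge> (Q ^ 12) powr (3/2)" using Q by (intro powr_mono2) auto
  moreover have "(Q ^ 12) powr (3/2) = Q ^ 18"
  proof -
    have "Q ^ 12 = Q powr 12" "Q ^ 18 = Q powr 18" using Q by (simp_all add: powr_numeral)
    then show ?thesis using powr_powr[of Q 12 "3/2"] by simp
  qed
  ultimately have "M * sqrt u / norm (pt k) powr (3/2) \<le> M * sqrt u / Q ^ 18"
    using Q M0 u by (intro divide_left_mono mult_pos_pos) (auto intro: less_le_trans)
  then show ?thesis using prof_le[OF norm_shell(2)[OF k] u] by (simp add: Q_def)
qed

section \<open>Mean squares over one shell\<close>

lemma mean_square_shell:
  obtains C where "C > 0"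
    "\<forall>R j Z \<beta> P n D. 2 \<le> R \<longrightarrow> Z \<subseteq> shell j \<longrightarrow> (\<forall>k\<in>Z. slow R \<beta> (P k)) \<longrightarrow>
      real (card Z) \<le> n \<longrightarrow>
      (\<forall>y. real (card {k \<in> Z. y \<le> rho (pt k) \<and> rho (pt k) < y + (r0 / 2) / sqrt R}) \<le> D) \<longrightarrow>
      integral {R - 1/2 .. R + sqrt R + 1/2} (\<lambda>t. (norm (\<Sum>k\<in>Z. ee (t * rho (pt k)) * P k t))\<^sup>2) \<le> C * sqrt R * \<beta>\<^sup>2 * n * D"
proof -
  define C where "C = 32 + 64 / (r0 / 2)\<^sup>2"
  have C: "C > 0" using r0 by (simp add: C_def add_pos_pos)
  show thesis
  proof (rule that[OF C], intro allI impI)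
    fix R j Z \<beta> P n D
    assume R: "2 \<le> (R::real)" and Z: "Z \<subseteq> shell j" and P: "\<forall>k\<in>Z. slow R \<beta> (P k)" and n: "real (card Z) \<le> n"
      and D: "\<forall>y. real (card {k \<in> Z. y \<le> rho (pt k) \<and> rho (pt k) < y + (r0 / 2) / sqrt R}) \<le> D"
    have D0: "D \<ge> 0" using spec[OF D, of 0] by (meson of_nat_0_le_iff order.trans)
    have "integral {R - 1/2 .. R + sqrt R + 1/2} (\<lambda>t. (norm (\<Sum>k\<in>Z. ee (t * rho (pt k)) * P k t))\<^sup>2)
      \<le> C * sqrt R * \<beta>\<^sup>2 * real (card Z) * D"
      unfolding C_def using r0 finite_subset[OF Z finite_shell]
      by (intro slow_mean_square[OF R _ _ bspec[OF P] spec[OF D]]) auto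
    also have "\<dots> \<le> C * sqrt R * \<beta>\<^sup>2 * n * D"
      using n C R D0 by (intro mult_right_mono mult_left_mono) auto
    finally show "integral {R - 1/2 .. R + sqrt R + 1/2} (\<lambda>t. (norm (\<Sum>k\<in>Z. ee (t * rho (pt k)) * P k t))\<^sup>2) \<le> C * sqrt R * \<beta>\<^sup>2 * n * D" .
  qed
qed

text \<open>No gain beyond the trivial count of frequencies per unit interval: used for the frequencies
  that the smoothing kernel damps.\<close>
lemma far_shell:
  assumes A: "A > 0"
  obtains C where "C > 0" "\<forall>R j Z w P. 2 \<le> R \<longrightarrow> Z \<subseteq> shell j \<longrightarrow> 0 \<le> w \<longrightarrow>
    (\<forall>k\<in>Z. slow R (w * (A * R * prof (pt k) (r0 / R))) (P k)) \<longrightarrow>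
    integral {R - 1/2 .. R + sqrt R + 1/2} (\<lambda>t. (norm (\<Sum>k\<in>Z. ee (t * rho (pt k)) * P k t))\<^sup>2) \<le> C * (R * sqrt R) * w\<^sup>2"
proof -
  obtain C1 where C1: "C1 > 0" "\<And>j Z y w. Z \<subseteq> shell j \<Longrightarrow> w \<le> 1 \<Longrightarrow>
    real (card {k \<in> Z. y \<le> rho (pt k) \<and> rho (pt k) < y + w}) \<le> C1 * (2 ^ j) ^ 12"
    using rho_count by blast
  obtain C2 where C2: "C2 > 0"
    "\<forall>R j Z \<beta> P n D. 2 \<le> R \<longrightarrow> Z \<subseteq> shell j \<longrightarrow> (\<forall>k\<in>Z. slow R \<beta> (P k)) \<longrightarrow>
      real (card Z) \<le> n \<longrightarrow>
      (\<forall>y. real (card {k \<in> Z. y \<le> rho (pt k) \<and> rho (pt k) < y + (r0 / 2) / sqrt R}) \<le> D) \<longrightarrow>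
      integral {R - 1/2 .. R + sqrt R + 1/2} (\<lambda>t. (norm (\<Sum>k\<in>Z. ee (t * rho (pt k)) * P k t))\<^sup>2) \<le> C2 * sqrt R * \<beta>\<^sup>2 * n * D"
    by (rule mean_square_shell)
  define C where "C = C2 * (A * M)\<^sup>2 * 10 ^ 9 * C1"
  have C: "C > 0" using C1 C2 A M0 by (simp add: C_def)
  show thesis
  proof (rule that[OF C], intro allI impI)
    fix R j Z w P
    assume R: "2 \<le> R" and Z: "Z \<subseteq> shell j" and w: "0 \<le> w"
      and P: "\<forall>k\<in>Z. slow R (w * (A * R * prof (pt k) (r0 / R))) (P k)"
    define Q :: real where "Q = 2 ^ j"
    have Q: "Q > 0" by (simp add: Q_def)
    define \<beta> where "\<beta> = w * (A * M * sqrt R / Q ^ 18)"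
    have sl: "slow R \<beta> (P k)" if k: "k \<in> Z" for k
    proof (rule slow_mono[OF bspec[OF P k]])
      have "prof (pt k) (r0 / R) \<le> M * sqrt (r0 / R) / Q ^ 18"
        unfolding Q_def by (rule prof_shell) (use k Z r0 R in auto)
      also have "\<dots> \<le> M * sqrt (1 / R) / Q ^ 18"
        using M0 Q r0 R by (intro divide_right_mono mult_left_mono real_sqrt_le_mono) auto
      finally have "A * R * prof (pt k) (r0 / R) \<le> A * R * (M * sqrt (1 / R) / Q ^ 18)"
        using A R by (intro mult_left_mono) auto
      also have "\<dots> = A * M * (R / sqrt R) / Q ^ 18" by (simp add: real_sqrt_divide)
      also have "R / sqrt R = sqrt R" using R by (simp add: real_div_sqrt)
      finally show "w * (A * R * prof (pt k) (r0 / R)) \<le> \<beta>" unfolding \<beta>_def using w by (intro mult_left_mono)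
    qed (use R in simp)
    have "integral {R - 1/2 .. R + sqrt R + 1/2} (\<lambda>t. (norm (\<Sum>k\<in>Z. ee (t * rho (pt k)) * P k t))\<^sup>2)
       \<le> C2 * sqrt R * \<beta>\<^sup>2 * (10 ^ 9 * Q ^ 24) * (C1 * Q ^ 12)"
    proof (rule C2(2)[rule_format, OF R Z sl])
      show "real (card Z) \<le> 10 ^ 9 * Q ^ 24" unfolding Q_def by (rule card_shell[OF Z])
      have "r0 / 2 / sqrt R \<le> 1 / 1" using r0 R by (intro frac_le) auto
      then show "real (card {k \<in> Z. y \<le> rho (pt k) \<and> rho (pt k) < y + r0 / 2 / sqrt R}) \<le> C1 * Q ^ 12" for y
        unfolding Q_def by (intro C1(2)[OF Z]) simp
    qed
    \<comment> \<open>The powers balance exactly: \<open>Q^24\<close> points and clusters of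
      \<open>Q^12\<close> against a squared amplitude with \<open>Q^-36\<close>.\<close>
    also have "\<dots> = C * (R * sqrt R) * w\<^sup>2"
    proof -
      have "\<beta>\<^sup>2 = w\<^sup>2 * ((A * M)\<^sup>2 * R / Q ^ 36)"
        using R by (simp add: \<beta>_def power_mult_distrib power_divide flip: power_mult)
      moreover have "Q ^ 36 = Q ^ 24 * Q ^ 12" by (simp flip: power_add)
      moreover have "x * (y / z) * z = x * y" if "z \<noteq> 0" for x y z :: real using that by simp
      moreover have "Q ^ 24 * Q ^ 12 \<noteq> 0" using Q by simp
      ultimately have b: "\<beta>\<^sup>2 * (Q ^ 24 * Q ^ 12) = w\<^sup>2 * ((A * M)\<^sup>2 * R)" by (simp only:)
      have "C2 * sqrt R * \<beta>\<^sup>2 * (10 ^ 9 * Q ^ 24) * (C1 * Q ^ 12) = C2 * sqrt R * 10 ^ 9 * C1 * (\<beta>\<^sup>2 * (Q ^ 24 * Q ^ 12))"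
        by (simp only: mult_ac)
      also have "\<dots> = C * (R * sqrt R) * w\<^sup>2" unfolding b C_def by (simp only: mult_ac)
      finally show ?thesis .
    qed
    finally show "integral {R - 1/2 .. R + sqrt R + 1/2} (\<lambda>t. (norm (\<Sum>k\<in>Z. ee (t * rho (pt k)) * P k t))\<^sup>2) \<le> C * (R * sqrt R) * w\<^sup>2" .
  qed
qed

lemma slow_bound_shell:
  assumes A: "A > 0" and R: "2 \<le> R" and k: "k \<in> shell j"
    and P: "slow R (A * R * prof (pt k) (r0 / R)) P"
  shows "slow R (A * M * sqrt R / (2 ^ j) ^ 18) P"
proof (rule slow_mono[OF P])
  define Q :: real where "Q = 2 ^ j"
  have Q: "Q > 0" by (simp add: Q_def)
  have "prof (pt k) (r0 / R) \<le> M * sqrt (r0 / R) / Q ^ 18"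
    unfolding Q_def by (rule prof_shell) (use k r0 R in auto)
  also have "\<dots> \<le> M * sqrt (1 / R) / Q ^ 18"
    using M0 Q r0 R by (intro divide_right_mono mult_left_mono real_sqrt_le_mono) auto
  finally have "A * R * prof (pt k) (r0 / R) \<le> A * R * (M * sqrt (1 / R) / Q ^ 18)"
    using A R by (intro mult_left_mono) auto
  also have "\<dots> = A * M * (R / sqrt R) / Q ^ 18" by (simp add: real_sqrt_divide)
  also have "R / sqrt R = sqrt R" using R by (simp add: real_div_sqrt)
  finally show "A * R * prof (pt k) (r0 / R) \<le> A * M * sqrt R / (2 ^ j) ^ 18" by (simp add: Q_def)
qed (use R in simp)

text \<open>There are \<open>O(Q^2)\<close> vectors \<open>d\<close>; for each of them
  \<open>O(Q^14)\<close> representatives meet all lines, and a line carries \<open>O(Q^7)\<close>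
  steep points. The product \<open>Q^23\<close> is one power below the trivial
  \<open>Q^24\<close>.\<close>

lemma card_steep_shell:
  fixes j :: nat
  defines "Q \<equiv> 2 ^ j"
  assumes \<sigma>: "\<sigma> > 0" and \<tau>: "0 \<le> \<tau>" "\<tau> / \<sigma> \<le> Q ^ 7 / 2" and Z: "Z \<subseteq> shell j"
    and X: "\<And>k. k \<in> Z \<Longrightarrow> \<exists>d. d \<noteq> 0 \<and> norm (pt d) \<le> Q \<and> \<bar>incr d k\<bar> \<le> \<tau> \<and> \<sigma> < incr d k - incr d (k - d)"
  shows "real (card Z) \<le> 10 ^ 8 * Q ^ 23"
proof -
  define Qi :: int where "Qi = 2 ^ j"
  define B :: int where "B = 4096 * Qi ^ 12"
  \<comment> \<open>Subtracting the quotient multiple of \<open>d\<close> brings one coordinate down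
    to \<open>Qi\<close> but may move the other by \<open>(B + 1) * Qi\<close>.\<close>
  define L where "L = 3 * B * Qi"
  have Qi: "Qi \<ge> 1" "of_int Qi = Q" by (simp_all add: Qi_def Q_def)
  have "1 \<le> Qi ^ 12" using Qi(1) by (rule one_le_power)
  then have B: "B \<ge> 1" unfolding B_def by linarith
  have BQ: "B \<le> B * Qi" using Qi(1) B by simp
  have QB: "Qi \<le> B * Qi" using Qi(1) B by simp
  have "(B + 1) * Qi = B * Qi + Qi" "L = 3 * (B * Qi)" by (simp_all add: L_def distrib_right)
  then have L: "L \<ge> B + (B + 1) * Qi" "L \<ge> 1"
    using BQ QB B by linarith+
  have Q1: "Q \<ge> 1" by (simp add: Q_def)
  define Ds where "Ds = {- Qi..Qi} \<times> {- Qi..Qi}"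
  define Xd where "Xd d = {k \<in> Z. \<bar>incr d k\<bar> \<le> \<tau> \<and> \<sigma> < incr d k - incr d (k - d)}" for d
  have card1: "real (card (Xd d)) \<le> (10 ^ 6 * Q ^ 14) * (3 * Q ^ 7)" if d: "d \<in> Ds - {0}" for d
  proof -
    \<comment> \<open>Division by a nonzero coordinate of \<open>d\<close> selects the
      representative of the line.\<close>
    define quo where "quo k = (if fst d \<noteq> 0 then fst k div fst d else snd k div snd d)" for k :: "int \<times> int"
    define E where "E = (if fst d \<noteq> 0 then {- Qi..Qi} \<times> {- L..L} else {- L..L} \<times> {- Qi..Qi})"
    have d': "\<bar>fst d\<bar> \<le> Qi" "\<bar>snd d\<bar> \<le> Qi" using d by (auto simp: Ds_def)
    have lin: "\<bar>b - a div c * e\<bar> \<le> L" if "\<bar>a\<bar> \<le> B" "\<bar>b\<bar> \<le> B" "c \<noteq> 0" "\<bar>e\<bar> \<le> Qi" for a b c e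
    proof -
      have "\<bar>a div c\<bar> * \<bar>e\<bar> \<le> (B + 1) * Qi"
        using int_quot_bounds(2)[OF that(3), of a] that Qi by (intro mult_mono) auto
      then show ?thesis using L that(2) unfolding abs_mult[symmetric] by linarith
    qed
    have quoE: "k - (quo k * fst d, quo k * snd d) \<in> E" if k: "k \<in> Xd d" for k
    proof -
      have kB: "\<bar>fst k\<bar> \<le> B" "\<bar>snd k\<bar> \<le> B"
        using k Z shell_subset[of j] by (auto simp: Xd_def B_def Qi_def abs_le_iff)
      show ?thesis
      proof (cases "fst d = 0")
        case False
        have "\<bar>fst k - fst k div fst d * fst d\<bar> \<le> Qi" using int_quot_bounds(1)[OF False, of "fst k"] d' by linarith
        moreover have "\<bar>snd k - fst k div fst d * snd d\<bar> \<le> L" using lin kB False d' by blast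
        ultimately show ?thesis using False by (cases k) (auto simp: E_def quo_def abs_le_iff)
      next
        case True
        then have d2: "snd d \<noteq> 0" using d by (auto simp: prod_eq_iff)
        have "\<bar>snd k - snd k div snd d * snd d\<bar> \<le> Qi" using int_quot_bounds(1)[OF d2, of "snd k"] d' by linarith
        moreover have "\<bar>fst k - snd k div snd d * fst d\<bar> \<le> L" using lin kB d2 d' by blast
        ultimately show ?thesis using True by (cases k) (auto simp: E_def quo_def abs_le_iff)
      qed
    qed
    have fE: "finite E" by (auto simp: E_def)
    have cE: "real (card E) \<le> 10 ^ 6 * Q ^ 14"
    proof -
      have "card E = nat (2 * Qi + 1) * nat (2 * L + 1)"
        by (auto simp: E_def card_cartesian_product)
      then have "real (card E) = of_int (2 * Qi + 1) * of_int (2 * L + 1)" using Qi(1) L(2) by simp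
      also have "\<dots> \<le> of_int (3 * Qi) * of_int (3 * L)"
        unfolding of_int_mult[symmetric] of_int_le_iff using Qi(1) L(2) by (intro mult_mono) auto
      also have "\<dots> = 110592 * (Q * Q ^ 12 * Q)" by (simp add: L_def B_def Qi(2)[symmetric])
      also have "Q * Q ^ 12 * Q = Q ^ 14" by (simp flip: power_Suc power_Suc2)
      finally have "real (card E) \<le> 110592 * Q ^ 14" .
      moreover have "110592 * Q ^ 14 \<le> 10 ^ 6 * Q ^ 14" using Q1 by (intro mult_right_mono) auto
      ultimately show ?thesis by linarith
    qed
    have Xs: "\<bar>incr d k\<bar> \<le> \<tau> \<and> \<sigma> < incr d k - incr d (k - d)" if "k \<in> Xd d" for k using that by (simp add: Xd_def)
    have "real (card (Xd d)) \<le> real (card E) * (2 * \<tau> / \<sigma> + 2)"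
      by (rule card_steep(2)[OF \<sigma> \<tau>(1) fE Xs quoE])
    also have "\<dots> \<le> (10 ^ 6 * Q ^ 14) * (3 * Q ^ 7)"
    proof (rule mult_mono[OF cE])
      have "1 \<le> Q ^ 7" using Q1 by (rule one_le_power)
      moreover have "2 * \<tau> / \<sigma> = 2 * (\<tau> / \<sigma>)" by simp
      ultimately show "2 * \<tau> / \<sigma> + 2 \<le> 3 * Q ^ 7" using \<tau>(2) by linarith
    qed (use Q1 \<tau> \<sigma> in auto)
    finally show ?thesis .
  qed
  have fD: "finite (Ds - {0})" by (simp add: Ds_def)
  have fX: "finite (Xd d)" for d using Z finite_shell finite_subset[of "Xd d" "shell j"] by (auto simp: Xd_def)
  have "Z \<subseteq> (\<Union>d\<in>Ds - {0}. Xd d)"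
  proof
    fix k assume k: "k \<in> Z"
    then obtain d where d: "d \<noteq> 0" "norm (pt d) \<le> Q" "\<bar>incr d k\<bar> \<le> \<tau> \<and> \<sigma> < incr d k - incr d (k - d)" using X by blast
    have "\<bar>real_of_int (fst d)\<bar> \<le> of_int Qi" "\<bar>real_of_int (snd d)\<bar> \<le> of_int Qi"
      using abs_pt_le[of d] d(2) Qi(2) by linarith+
    then have "\<bar>fst d\<bar> \<le> Qi" "\<bar>snd d\<bar> \<le> Qi" by linarith+
    then have "d \<in> Ds" by (cases d) (auto simp: Ds_def abs_le_iff)
    then show "k \<in> (\<Union>d\<in>Ds - {0}. Xd d)" using d k by (auto simp: Xd_def)
  qed
  then have "card Z \<le> card (\<Union>d\<in>Ds - {0}. Xd d)" using fD fX by (intro card_mono) auto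
  also have "\<dots> \<le> (\<Sum>d\<in>Ds - {0}. card (Xd d))" by (rule card_UN_le[OF fD])
  finally have "real (card Z) \<le> (\<Sum>d\<in>Ds - {0}. real (card (Xd d)))" by (simp flip: of_nat_sum)
  also have "\<dots> \<le> (\<Sum>d\<in>Ds - {0}. (10 ^ 6 * Q ^ 14) * (3 * Q ^ 7))" by (intro sum_mono card1)
  also have "\<dots> = real (card (Ds - {0})) * ((10 ^ 6 * Q ^ 14) * (3 * Q ^ 7))" by simp
  also have "\<dots> \<le> (9 * Q ^ 2) * ((10 ^ 6 * Q ^ 14) * (3 * Q ^ 7))"
  proof (intro mult_right_mono)
    have "card (Ds - {0}) \<le> card Ds" by (intro card_mono) (auto simp: Ds_def)
    also have "card Ds = nat (2 * Qi + 1) * nat (2 * Qi + 1)" by (simp add: Ds_def card_cartesian_product)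
    finally have "real (card (Ds - {0})) \<le> real (nat (2 * Qi + 1)) * real (nat (2 * Qi + 1))" by (simp flip: of_nat_mult)
    also have "\<dots> \<le> of_int (3 * Qi) * of_int (3 * Qi)" using Qi by (intro mult_mono) auto
    also have "\<dots> = 9 * Q ^ 2" by (simp add: Qi(2)[symmetric] power2_eq_square)
    finally show "real (card (Ds - {0})) \<le> 9 * Q ^ 2" .
  qed (use Q1 in auto)
  also have "\<dots> = 27 * 10 ^ 6 * (Q ^ 2 * Q ^ 14 * Q ^ 7)" by simp
  also have "Q ^ 2 * Q ^ 14 * Q ^ 7 = Q ^ 23" by (simp flip: power_add)
  also have "27 * 10 ^ 6 * Q ^ 23 \<le> 10 ^ 8 * Q ^ 23" using Q1 by (intro mult_right_mono) auto
  finally show ?thesis .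
qed

text \<open>\<open>X\<close> collects the points with a large second difference, \<open>G\<close>
  those with a step \<open>d\<close> but small second differences, \<open>B\<close> those without
  such a step. In \<open>power_bound\<close> their exponents are 23 + 12 against 36, 24 + 12 against
  38 and 24 + 11 against 36. Staying below \<open>sqrt R\<close> keeps the depth
  \<open>r0 / R\<close> under the threshold \<open>\<sigma>\<close>, so that
  \<open>prof_second_difference\<close> is effective.\<close>

lemma near_shell:
  assumes A: "A > 0"
  obtains C where "C > 0" "\<forall>R j Z P. 2 \<le> R \<longrightarrow> Z \<subseteq> shell j \<longrightarrow> (2 ^ j) ^ 12 \<le> sqrt R \<longrightarrow>
    (\<forall>k\<in>Z. slow R (A * R * prof (pt k) (r0 / R)) (P k)) \<longrightarrow>
    integral {R - 1/2 .. R + sqrt R + 1/2} (\<lambda>t. (norm (\<Sum>k\<in>Z. ee (t * rho (pt k)) * P k t))\<^sup>2) \<le> C * (R * sqrt R) / 2 ^ j"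
proof -
  obtain C0 where C0: "C0 > 0" "\<forall>j Z x s. Z \<subseteq> shell j \<longrightarrow> 1 \<le> s \<longrightarrow> s \<le> (2 ^ j) ^ 12 \<longrightarrow>
    (\<forall>k\<in>Z. x \<le> rho (pt k) \<and> rho (pt k) < x + 1) \<longrightarrow>
    (\<forall>k\<in>Z. \<forall>k'\<in>Z. k \<noteq> k' \<longrightarrow> s \<le> norm (pt k - pt k')) \<longrightarrow>
    real (card Z) \<le> C0 * (2 ^ j) ^ 12 / s" by (rule cluster_count)
  obtain C1 where C1: "C1 > 0" "\<And>j Z y w. Z \<subseteq> shell j \<Longrightarrow> w \<le> 1 \<Longrightarrow>
    real (card {k \<in> Z. y \<le> rho (pt k) \<and> rho (pt k) < y + w}) \<le> C1 * (2 ^ j) ^ 12"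
    using rho_count by blast
  obtain C2 where C2: "C2 > 0"
    "\<forall>R j Z \<beta> P n D. 2 \<le> R \<longrightarrow> Z \<subseteq> shell j \<longrightarrow> (\<forall>k\<in>Z. slow R \<beta> (P k)) \<longrightarrow>
      real (card Z) \<le> n \<longrightarrow>
      (\<forall>y. real (card {k \<in> Z. y \<le> rho (pt k) \<and> rho (pt k) < y + (r0 / 2) / sqrt R}) \<le> D) \<longrightarrow>
      integral {R - 1/2 .. R + sqrt R + 1/2} (\<lambda>t. (norm (\<Sum>k\<in>Z. ee (t * rho (pt k)) * P k t))\<^sup>2) \<le> C2 * sqrt R * \<beta>\<^sup>2 * n * D"
    by (rule mean_square_shell)
  define c where "c = r0 / (2 * (r0 + r1))"
  have c: "c > 0" using r0 r1_pos by (simp add: c_def)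
  define CX where "CX = C2 * (A * M)\<^sup>2 * 10 ^ 8 * C1"
  define CG where "CG = C2 * (3 * A / c)\<^sup>2 * 10 ^ 9 * C1"
  define CB where "CB = C2 * (A * M)\<^sup>2 * 10 ^ 9 * C0"
  have CC: "CX > 0" "CG > 0" "CB > 0" using A M0 c C0 C1 C2 by (auto simp: CX_def CG_def CB_def)
  show thesis
  proof (rule that[of "3 * (CX + CG + CB)"], use CC in simp, intro allI impI)
    fix R j Z P
    assume R: "2 \<le> R" and Z: "Z \<subseteq> shell j" and QR: "(2 ^ j) ^ 12 \<le> sqrt R"
      and P: "\<forall>k\<in>Z. slow R (A * R * prof (pt k) (r0 / R)) (P k)"
    define Q :: real where "Q = 2 ^ j"
    have Q: "Q \<ge> 1" "Q > 0" by (simp_all add: Q_def)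
    have QR': "Q ^ 12 \<le> sqrt R" using QR by (simp add: Q_def)
    have sR: "sqrt R > 0" "sqrt R \<ge> 1" using R by auto
    \<comment> \<open>The threshold between steep and flat: \<open>\<tau> / \<sigma>\<close>, of
      order \<open>Q^7\<close>, limits the steep points on a line, and
      \<open>\<sigma> R / Q^12\<close> is the size \<open>sqrt R / Q^19\<close> of a flat
      amplitude.\<close>
    define \<sigma> where "\<sigma> = 1 / (sqrt R * Q ^ 7)"
    \<comment> \<open>The width of a frequency cluster; its factor \<open>r0 / 2\<close> is the
      deviation that \<open>cross_lower\<close> tolerates.\<close>
    define \<tau> where "\<tau> = (r0 / 2) / sqrt R"
    have \<sigma>: "\<sigma> > 0" using sR Q by (simp add: \<sigma>_def)
    have \<tau>: "0 \<le> \<tau>" "\<tau> \<le> r0 / 2" "\<tau> \<le> 1" "\<tau> / \<sigma> \<le> Q ^ 7 / 2"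
    proof -
      show "0 \<le> \<tau>" using r0 sR by (simp add: \<tau>_def)
      have "r0 / 2 / sqrt R \<le> r0 / 2 / 1" using r0 sR by (intro divide_left_mono) auto
      then show 1: "\<tau> \<le> r0 / 2" by (simp add: \<tau>_def)
      then show "\<tau> \<le> 1" using r0 by simp
      have "\<tau> / \<sigma> = r0 / 2 * Q ^ 7" using sR by (simp add: \<tau>_def \<sigma>_def)
      also have "\<dots> \<le> 1 / 2 * Q ^ 7" using r0 Q by (intro mult_right_mono) auto
      finally show "\<tau> / \<sigma> \<le> Q ^ 7 / 2" by simp
    qed
    define nbr where "nbr k d \<longleftrightarrow> d \<noteq> 0 \<and> norm (pt d) \<le> Q \<and> \<bar>incr d k\<bar> \<le> \<tau>" for k d
    define X where "X = {k \<in> Z. \<exists>d. nbr k d \<and> \<sigma> < incr d k - incr d (k - d)}"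
    define G where "G = {k \<in> Z - X. \<exists>d. nbr k d}"
    define B where "B = {k \<in> Z. \<not> (\<exists>d. nbr k d)}"
    have fZ: "finite Z" using finite_subset[OF Z finite_shell] .
    have sub: "X \<subseteq> Z" "G \<subseteq> Z" "B \<subseteq> Z" by (auto simp: X_def G_def B_def)
    have subs: "X \<subseteq> shell j" "G \<subseteq> shell j" "B \<subseteq> shell j" using sub Z by auto
    have part: "Z = X \<union> G \<union> B" "X \<inter> G = {}" "(X \<union> G) \<inter> B = {}" by (auto simp: X_def G_def B_def)
    have sl: "slow R (A * M * sqrt R / Q ^ 18) (P k)" if "k \<in> Z" for k
      unfolding Q_def by (rule slow_bound_shell[OF A R]) (use that Z P in auto)
    have cnt: "real (card {k \<in> W. y \<le> rho (pt k) \<and> rho (pt k) < y + (r0 / 2) / sqrt R}) \<le> C1 * Q ^ 12"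
      if "W \<subseteq> shell j" for W y
      unfolding Q_def using \<tau>(3) by (intro C1(2)[OF that]) (simp add: \<tau>_def)
    define J where "J = {R - 1/2 .. R + sqrt R + 1/2}"
    define F where "F W t = (\<Sum>k\<in>W. ee (t * rho (pt k)) * P k t)" for W t
    have iX: "integral J (\<lambda>t. (norm (F X t))\<^sup>2) \<le> CX * (R * sqrt R) / Q"
    proof -
      have "integral J (\<lambda>t. (norm (F X t))\<^sup>2) \<le> C2 * sqrt R * (A * M * sqrt R / Q ^ 18)\<^sup>2 * (10 ^ 8 * Q ^ 23) * (C1 * Q ^ 12)"
        unfolding J_def F_def
      proof (rule C2(2)[rule_format, OF R subs(1)])
        show "slow R (A * M * sqrt R / Q ^ 18) (P k)" if "k \<in> X" for k by (rule sl) (use that sub in blast)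
        show "real (card X) \<le> 10 ^ 8 * Q ^ 23"
          unfolding Q_def
          by (rule card_steep_shell[OF \<sigma> \<tau>(1) _ subs(1)]) (use \<tau>(4) in \<open>auto simp: X_def nbr_def Q_def\<close>)
      qed (rule cnt[OF subs(1)])
      also have "\<dots> \<le> (C2 * (A * M)\<^sup>2 * 10 ^ 8 * C1) * (R * sqrt R) / Q"
        by (rule power_bound[OF Q(1)]) (use C1 C2 R in auto)
      finally show ?thesis by (simp add: CX_def)
    qed
    have iG: "integral J (\<lambda>t. (norm (F G t))\<^sup>2) \<le> CG * (R * sqrt R) / Q"
    proof -
      have "integral J (\<lambda>t. (norm (F G t))\<^sup>2) \<le> C2 * sqrt R * (3 * A / c * sqrt R / Q ^ 19)\<^sup>2 * (10 ^ 9 * Q ^ 24) * (C1 * Q ^ 12)"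
        unfolding J_def F_def
      proof (rule C2(2)[rule_format, OF R subs(2)])
        show "real (card G) \<le> 10 ^ 9 * Q ^ 24" unfolding Q_def by (rule card_shell[OF subs(2)])
        fix k assume k: "k \<in> G"
        have ks: "k \<in> shell j" using k subs by auto
        obtain d where d: "nbr k d" using k by (auto simp: G_def)
        have dle: "incr d k - incr d (k - d) \<le> \<sigma>" 
        proof (rule ccontr)
          assume "\<not> ?thesis"
          then have "k \<in> X" using k d unfolding G_def X_def by (auto simp del: split_paired_Ex simp: not_le)
          then show False using k unfolding G_def by blast
        qed
        have nk: "Q ^ 12 \<le> norm (pt k)" using ks by (simp add: shell_def Q_def)
        have n1: "1 \<le> norm (pt d)" using d by (intro norm_pt_ge_1) (simp add: nbr_def)
        have "Q ^ 1 \<le> Q ^ 12" using Q(1) by (intro power_increasing) auto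
        then have n2: "norm (pt d) \<le> norm (pt k)" using d nk by (simp add: nbr_def)
        have "c * (norm (pt k) * norm (pt d)) \<le> \<bar>perp (pt k) \<bullet> pt d\<bar>"
          unfolding c_def by (rule cross_lower[OF n1 n2]) (use d \<tau> in \<open>simp add: nbr_def incr_def pt_add\<close>)
        moreover have "Q ^ 12 * 1 \<le> norm (pt k) * norm (pt d)" using nk n1 Q by (intro mult_mono) auto
        then have "c * Q ^ 12 \<le> c * (norm (pt k) * norm (pt d))" using c by (intro mult_left_mono) auto
        ultimately have cr: "c * Q ^ 12 \<le> \<bar>perp (pt k) \<bullet> pt d\<bar>" by linarith
        have u: "r0 / R \<in> {0..width (pt k)}"
        proof -
          have "r0 / R \<le> r0 / 1" using r0 R by (intro divide_left_mono) auto
          also have "\<dots> \<le> 2 * r0 * norm (pt k)" using r0 norm_shell(1)[OF ks] by simp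
          also have "\<dots> \<le> width (pt k)" by (rule width_ge)
          finally show ?thesis using r0 R by simp
        qed
        \<comment> \<open>The chord at depth \<open>r0 / R\<close> is tested against the transversal
          step \<open>d\<close>, for which \<open>|perp k \<bullet> d|\<close> is at least
          \<open>c Q^12\<close>.\<close>
        have "prof (pt k) (r0 / R) * (c * Q ^ 12) \<le> prof (pt k) (r0 / R) * \<bar>perp (pt k) \<bullet> pt d\<bar>"
          by (rule mult_left_mono[OF cr prof_nonneg])
        also have "\<dots> \<le> rho (pt k + pt d) + rho (pt k - pt d) - 2 * rho (pt k) + 2 * (r0 / R)"
          by (rule prof_second_difference[OF norm_shell(2)[OF ks] u])
        also have "\<dots> \<le> \<sigma> + 2 * \<sigma>"
        proof -
          have "rho (pt k + pt d) + rho (pt k - pt d) - 2 * rho (pt k) = incr d k - incr d (k - d)"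
            by (simp add: incr_def pt_add pt_diff)
          moreover have "r0 / R \<le> \<sigma>"
          proof -
            have "Q ^ 7 \<le> Q ^ 12" using Q(1) by (intro power_increasing) auto
            then have "sqrt R * Q ^ 7 \<le> sqrt R * sqrt R" using QR' sR by (intro mult_left_mono) auto
            then have "sqrt R * Q ^ 7 \<le> R" using R by simp
            then have "1 / R \<le> \<sigma>" unfolding \<sigma>_def using sR Q R by (intro divide_left_mono) auto
            moreover have "r0 / R \<le> 1 / R" using r0 R by (intro divide_right_mono) auto
            ultimately show ?thesis by linarith
          qed
          ultimately show ?thesis using dle by linarith
        qed
        finally have "prof (pt k) (r0 / R) * (c * Q ^ 12) \<le> 3 * \<sigma>" by simp
        then have "prof (pt k) (r0 / R) \<le> 3 * \<sigma> / (c * Q ^ 12)" using c Q by (simp add: pos_le_divide_eq)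
        then have "A * R * prof (pt k) (r0 / R) \<le> A * R * (3 * \<sigma> / (c * Q ^ 12))"
          using A R by (intro mult_left_mono) auto
        also have "\<dots> = 3 * A / c * (R / sqrt R) / (Q ^ 7 * Q ^ 12)"
        proof -
          have "A * R * (3 * (1 / (s * p)) / (c * q)) = 3 * A / c * (R / s) / (p * q)" for s p q :: real
            by (simp add: mult_ac)
          then show ?thesis unfolding \<sigma>_def .
        qed
        also have "R / sqrt R = sqrt R" using R by (simp add: real_div_sqrt)
        also have "Q ^ 7 * Q ^ 12 = Q ^ 19" by (simp flip: power_add)
        finally have le: "A * R * prof (pt k) (r0 / R) \<le> 3 * A / c * sqrt R / Q ^ 19" .
        have sl0: "slow R (A * R * prof (pt k) (r0 / R)) (P k)" using bspec[OF P, of k] k sub by blast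
        show "slow R (3 * A / c * sqrt R / Q ^ 19) (P k)" by (rule slow_mono[OF sl0 le]) (use R in simp)
      qed (rule cnt[OF subs(2)])
      also have "\<dots> \<le> (C2 * (3 * A / c)\<^sup>2 * 10 ^ 9 * C1) * (R * sqrt R) / Q"
        by (rule power_bound[OF Q(1)]) (use C1 C2 R in auto)
      finally show ?thesis by (simp add: CG_def)
    qed
    have iB: "integral J (\<lambda>t. (norm (F B t))\<^sup>2) \<le> CB * (R * sqrt R) / Q"
    proof -
      have "integral J (\<lambda>t. (norm (F B t))\<^sup>2) \<le> C2 * sqrt R * (A * M * sqrt R / Q ^ 18)\<^sup>2 * (10 ^ 9 * Q ^ 24) * (C0 * Q ^ 11)"
        unfolding J_def F_def
      proof (rule C2(2)[rule_format, OF R subs(3)])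
        show "slow R (A * M * sqrt R / Q ^ 18) (P k)" if "k \<in> B" for k by (rule sl) (use that sub in blast)
        show "real (card B) \<le> 10 ^ 9 * Q ^ 24" unfolding Q_def by (rule card_shell[OF subs(3)])
        fix y
        define W where "W = {k \<in> B. y \<le> rho (pt k) \<and> rho (pt k) < y + r0 / 2 / sqrt R}"
        have "real (card W) \<le> C0 * (2 ^ j) ^ 12 / Q"
        proof (rule C0(2)[rule_format, where x = y])
          show "W \<subseteq> shell j" using subs by (auto simp: W_def)
          have "Q ^ 1 \<le> Q ^ 12" using Q(1) by (intro power_increasing) auto
          then show "Q \<le> (2 ^ j) ^ 12" by (simp add: Q_def)
          show "y \<le> rho (pt k) \<and> rho (pt k) < y + 1" if "k \<in> W" for k
            using that \<tau>(3) by (auto simp: W_def \<tau>_def)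
          \<comment> \<open>Two close points of a cluster would differ by a step that nearly
            preserves \<open>rho\<close>, which \<open>B\<close> excludes.\<close>
          show "Q \<le> norm (pt k - pt k')" if k: "k \<in> W" "k' \<in> W" "k \<noteq> k'" for k k'
          proof (rule ccontr)
            assume "\<not> Q \<le> norm (pt k - pt k')"
            then have "norm (pt (k' - k)) \<le> Q" by (simp add: pt_diff norm_minus_commute)
            moreover have "\<bar>incr (k' - k) k\<bar> \<le> \<tau>" using k by (auto simp: W_def incr_def \<tau>_def abs_le_iff)
            ultimately have "nbr k (k' - k)" using k by (simp add: nbr_def)
            then show False using k(1) unfolding W_def B_def by blast
          qed
        qed (rule Q(1))
        also have "\<dots> = C0 * (Q ^ 12 / Q)" by (simp add: Q_def)
        also have "Q ^ 12 / Q = Q ^ 11" using Q by (simp add: power_eq_if)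
        finally show "real (card {k \<in> B. y \<le> rho (pt k) \<and> rho (pt k) < y + r0 / 2 / sqrt R}) \<le> C0 * Q ^ 11"
          by (simp add: W_def)
      qed
      also have "\<dots> \<le> (C2 * (A * M)\<^sup>2 * 10 ^ 9 * C0) * (R * sqrt R) / Q"
        by (rule power_bound[OF Q(1)]) (use C0 C2 R in auto)
      finally show ?thesis by (simp add: CB_def)
    qed
    have cF: "continuous_on J (F W)" if "W \<subseteq> Z" for W
      unfolding F_def using that by (intro continuous_intros slow_continuous[OF sl]) blast
    have "integral J (\<lambda>t. (norm (F Z t))\<^sup>2) \<le> integral J (\<lambda>t. 3 * ((norm (F X t))\<^sup>2 + (norm (F G t))\<^sup>2 + (norm (F B t))\<^sup>2))"
    proof (rule integral_le)
      fix t
      have "F Z t = F X t + F G t + F B t"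
        unfolding F_def part(1)
        using part(2,3) finite_subset[OF sub(1) fZ] finite_subset[OF sub(2) fZ] finite_subset[OF sub(3) fZ]
        by (simp add: sum.union_disjoint)
      then have "norm (F Z t) \<le> norm (F X t) + norm (F G t) + norm (F B t)"
        using norm_triangle_ineq[of "F X t + F G t" "F B t"] norm_triangle_ineq[of "F X t" "F G t"] by simp
      then have "(norm (F Z t))\<^sup>2 \<le> (norm (F X t) + norm (F G t) + norm (F B t))\<^sup>2" by (intro power_mono) auto
      also have "\<dots> \<le> 3 * ((norm (F X t))\<^sup>2 + (norm (F G t))\<^sup>2 + (norm (F B t))\<^sup>2)"
      proof -
        have eq: "3 * (a\<^sup>2 + b\<^sup>2 + e\<^sup>2) - (a + b + e)\<^sup>2 = (a - b)\<^sup>2 + (b - e)\<^sup>2 + (a - e)\<^sup>2" for a b e :: real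
          by (simp add: power2_eq_square algebra_simps)
        have "0 \<le> 3 * (a\<^sup>2 + b\<^sup>2 + e\<^sup>2) - (a + b + e)\<^sup>2" for a b e :: real
          unfolding eq by (intro add_nonneg_nonneg zero_le_power2)
        from this[of "norm (F X t)" "norm (F G t)" "norm (F B t)"] show ?thesis by linarith
      qed
      finally show "(norm (F Z t))\<^sup>2 \<le> 3 * ((norm (F X t))\<^sup>2 + (norm (F G t))\<^sup>2 + (norm (F B t))\<^sup>2)" .
    qed (use cF sub in \<open>auto simp: J_def intro!: integrable_continuous_real continuous_intros\<close>)
    also have "\<dots> = 3 * (integral J (\<lambda>t. (norm (F X t))\<^sup>2) + integral J (\<lambda>t. (norm (F G t))\<^sup>2) + integral J (\<lambda>t. (norm (F B t))\<^sup>2))"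
    proof -
      have "(\<lambda>t. (norm (F W t))\<^sup>2) integrable_on J" if "W \<subseteq> Z" for W
        using cF[OF that] unfolding J_def by (intro integrable_continuous_real continuous_intros)
      then show ?thesis using sub by (simp add: integral_add integrable_add)
    qed
    also have "\<dots> \<le> 3 * (CX * (R * sqrt R) / Q + CG * (R * sqrt R) / Q + CB * (R * sqrt R) / Q)"
      by (intro mult_left_mono add_mono iX iG iB) simp
    also have "\<dots> = 3 * (CX + CG + CB) * (R * sqrt R) / Q"
      by (simp add: add_divide_distrib algebra_simps)
    finally show "integral {R - 1/2 .. R + sqrt R + 1/2} (\<lambda>t. (norm (\<Sum>k\<in>Z. ee (t * rho (pt k)) * P k t))\<^sup>2)
        \<le> 3 * (CX + CG + CB) * (R * sqrt R) / 2 ^ j"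
      by (simp add: J_def F_def Q_def)
  qed
qed

end

section \<open>Summation over dyadic shells\<close>

lemma geometric_head:
  fixes x s :: real
  assumes x: "x \<ge> 2" and s: "s > 0"
  shows "(\<Sum>j<J. if x ^ j \<le> s then x ^ j / s else 0) \<le> 2"
proof -
  \<comment> \<open>The second conjunct carries the induction: the partial sum is at most twice its
    largest possible term \<open>x^(J-1) / s\<close>.\<close>
  have "(\<Sum>j<J. if x ^ j \<le> s then x ^ j / s else 0) \<le> 2 \<and>
    (\<Sum>j<J. if x ^ j \<le> s then x ^ j / s else 0) * x \<le> 2 * (x ^ J / s)"
  proof (induction J)
    case 0
    then show ?case using x s by simp
  next
    case (Suc J)
    define T where "T = (\<Sum>j<J. if x ^ j \<le> s then x ^ j / s else 0)"
    define u where "u = x ^ J / s"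
    have u0: "u > 0" using x s by (simp add: u_def)
    have ux: "x ^ Suc J / s = x * u" by (simp add: u_def)
    have IH: "T \<le> 2" "T * x \<le> 2 * u" using Suc.IH by (simp_all add: T_def u_def)
    show ?case
    proof (cases "x ^ J \<le> s")
      case True
      have u1: "u \<le> 1" using True s by (simp add: u_def)
      have T0: "T \<ge> 0" unfolding T_def using x s by (intro sum_nonneg) auto
      have "T * 2 \<le> T * x" using T0 x by (intro mult_left_mono) auto
      then have Tu: "T \<le> u" using IH by linarith
      then have "(T + u) * x \<le> (u + u) * x" using x by (intro mult_right_mono) auto
      also have "(u + u) * x = 2 * (x * u)" by (simp add: algebra_simps)
      finally have "(T + u) * x \<le> 2 * (x * u)" .
      moreover have S: "(\<Sum>j<Suc J. if x ^ j \<le> s then x ^ j / s else 0) = T + u" using True by (simp add: T_def u_def)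
      ultimately show ?thesis unfolding S ux using Tu u1 by simp
    next
      case False
      have "1 * u \<le> x * u" using x u0 by (intro mult_right_mono) auto
      then have "T * x \<le> 2 * (x * u)" using IH by linarith
      moreover have S: "(\<Sum>j<Suc J. if x ^ j \<le> s then x ^ j / s else 0) = T" using False by (simp add: T_def)
      ultimately show ?thesis unfolding S ux using IH by simp
    qed
  qed
  then show ?thesis by blast
qed

lemma geometric_tail:
  fixes x s :: real
  assumes x: "x \<ge> 2" and s: "s > 0"
  shows "(\<Sum>j<J. if x ^ j \<le> s then 0 else s / x ^ j) \<le> 2"
proof -
  \<comment> \<open>Either no term has appeared yet, or a reserve \<open>2 s / x^J\<close> is left
    for the rest of the geometric series.\<close>
  have "(\<Sum>j<J. if x ^ j \<le> s then 0 else s / x ^ j) = 0 \<or>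
    (\<Sum>j<J. if x ^ j \<le> s then 0 else s / x ^ j) \<le> 2 - 2 * (s / x ^ J)"
  proof (induction J)
    case (Suc J)
    define T where "T = (\<Sum>j<J. if x ^ j \<le> s then 0 else s / x ^ j)"
    define u where "u = s / x ^ J"
    have u0: "u > 0" using x s by (simp add: u_def)
    have ux: "s / x ^ Suc J = u / x" by (simp add: u_def)
    have uh: "u / x \<le> u / 2" using u0 x by (intro divide_left_mono) auto
    have IH: "T = 0 \<or> T \<le> 2 - 2 * u" using Suc.IH by (simp add: T_def u_def)
    show ?case
    proof (cases "x ^ J \<le> s")
      case True
      then have S: "(\<Sum>j<Suc J. if x ^ j \<le> s then 0 else s / x ^ j) = T" by (simp add: T_def)
      show ?thesis unfolding S ux using IH uh u0 by linarith
    next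
      case False
      then have S: "(\<Sum>j<Suc J. if x ^ j \<le> s then 0 else s / x ^ j) = T + u" by (simp add: T_def u_def)
      have "u \<le> 1" using False x s by (simp add: u_def divide_le_eq_1)
      then show ?thesis unfolding S ux using IH uh u0 by linarith
    qed
  qed simp
  moreover have "s / x ^ J \<ge> 0" using x s by simp
  ultimately show ?thesis by linarith
qed

text \<open>Cauchy-Schwarz with weights \<open>\<alpha> j\<close>: the shells are added through
  summability of their bounds alone, without orthogonality between them.\<close>

lemma mean_square_sum:
  fixes g :: "nat \<Rightarrow> real \<Rightarrow> complex"
  assumes cont: "\<And>j. j < J \<Longrightarrow> continuous_on {l..u} (g j)"
    and \<alpha>: "\<And>j. j < J \<Longrightarrow> \<alpha> j > 0" and A: "(\<Sum>j<J. \<alpha> j) \<le> A" and V: "V \<ge> 0"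
    and bd: "\<And>j. j < J \<Longrightarrow> integral {l..u} (\<lambda>t. (norm (g j t))\<^sup>2) \<le> V * (\<alpha> j)\<^sup>2"
  shows "integral {l..u} (\<lambda>t. (norm (\<Sum>j<J. g j t))\<^sup>2) \<le> A\<^sup>2 * V"
proof -
  have A0: "A \<ge> 0" "(\<Sum>j<J. \<alpha> j) \<ge> 0"
  proof -
    show "(\<Sum>j<J. \<alpha> j) \<ge> 0" using \<alpha> by (intro sum_nonneg) (auto intro: less_imp_le)
    then show "A \<ge> 0" using A by linarith
  qed
  have i: "(\<lambda>t. (norm (g j t))\<^sup>2) integrable_on {l..u}" if "j < J" for j
    by (intro integrable_continuous_real continuous_intros cont that)
  have i': "(\<lambda>t. (norm (g j t))\<^sup>2 / \<alpha> j) integrable_on {l..u}" if "j < J" for j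
    using \<alpha>[OF that] by (intro integrable_continuous_real continuous_intros cont that) auto
  have "integral {l..u} (\<lambda>t. (norm (\<Sum>j<J. g j t))\<^sup>2) \<le> integral {l..u} (\<lambda>t. A * (\<Sum>j<J. (norm (g j t))\<^sup>2 / \<alpha> j))"
  proof (rule integral_le)
    show "(\<lambda>t. (norm (\<Sum>j<J. g j t))\<^sup>2) integrable_on {l..u}"
      by (intro integrable_continuous_real continuous_intros cont) auto
    show "(\<lambda>t. A * (\<Sum>j<J. (norm (g j t))\<^sup>2 / \<alpha> j)) integrable_on {l..u}"
      using \<alpha> by (intro integrable_continuous_real continuous_intros cont) force+
    fix t
    have "(norm (\<Sum>j<J. g j t))\<^sup>2 \<le> (\<Sum>j<J. norm (g j t))\<^sup>2" by (intro power_mono norm_sum) auto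
    also have "(\<Sum>j<J. norm (g j t)) = (\<Sum>j<J. sqrt (\<alpha> j) * (norm (g j t) / sqrt (\<alpha> j)))"
      using \<alpha> by (intro sum.cong) force+
    also have "\<dots>\<^sup>2 \<le> (\<Sum>j<J. (sqrt (\<alpha> j))\<^sup>2) * (\<Sum>j<J. (norm (g j t) / sqrt (\<alpha> j))\<^sup>2)"
      by (rule Cauchy_Schwarz_ineq_sum)
    also have "\<dots> = (\<Sum>j<J. \<alpha> j) * (\<Sum>j<J. (norm (g j t))\<^sup>2 / \<alpha> j)"
      using \<alpha> by (intro arg_cong2[of _ _ _ _ "(*)"] sum.cong) (auto simp: power_divide less_imp_le)
    also have "\<dots> \<le> A * (\<Sum>j<J. (norm (g j t))\<^sup>2 / \<alpha> j)"
      using A \<alpha> by (intro mult_right_mono sum_nonneg) (auto simp: less_imp_le)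
    finally show "(norm (\<Sum>j<J. g j t))\<^sup>2 \<le> A * (\<Sum>j<J. (norm (g j t))\<^sup>2 / \<alpha> j)" .
  qed
  also have "\<dots> = A * (\<Sum>j<J. integral {l..u} (\<lambda>t. (norm (g j t))\<^sup>2 / \<alpha> j))"
    using i' by (subst integral_mult_right, subst integral_sum) auto
  also have "\<dots> \<le> A * (\<Sum>j<J. V * \<alpha> j)"
  proof (intro mult_left_mono sum_mono A0)
    fix j assume j: "j \<in> {..<J}"
    have "integral {l..u} (\<lambda>t. (norm (g j t))\<^sup>2 / \<alpha> j) = integral {l..u} (\<lambda>t. (norm (g j t))\<^sup>2) / \<alpha> j"
      by (rule integral_divide)
    also have "\<dots> \<le> V * (\<alpha> j)\<^sup>2 / \<alpha> j" using bd \<alpha> j by (intro divide_right_mono) (auto simp: less_imp_le)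
    also have "\<dots> = V * \<alpha> j" using \<alpha>[of j] j by (simp add: power2_eq_square)
    finally show "integral {l..u} (\<lambda>t. (norm (g j t))\<^sup>2 / \<alpha> j) \<le> V * \<alpha> j" .
  qed
  also have "\<dots> = A * (V * (\<Sum>j<J. \<alpha> j))" by (simp add: sum_distrib_left)
  also have "\<dots> \<le> A * (V * A)" using A A0 V by (intro mult_left_mono) auto
  finally show ?thesis by (simp add: power2_eq_square mult_ac)
qed

lemma shell_disjoint: "i \<noteq> j \<Longrightarrow> shell i \<inter> shell j = {}"
proof -
  have *: "shell i \<inter> shell j = {}" if "i < j" for i j
  proof -
    have "(2::real) ^ Suc i \<le> 2 ^ j" using that by (intro power_increasing) auto
    then have "(2 * 2 ^ i :: real) ^ 12 \<le> (2 ^ j) ^ 12" by (intro power_mono) auto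
    then show ?thesis unfolding shell_def by force
  qed
  show "i \<noteq> j \<Longrightarrow> shell i \<inter> shell j = {}" using *[of i j] *[of j i] by (metis Int_commute linorder_neqE_nat)
qed

lemma shell_exists:
  assumes "n \<noteq> 0"
  obtains j where "n \<in> shell j"
proof -
  obtain m where m: "norm (pt n) < 2 ^ m" using real_arch_pow[of 2 "norm (pt n)"] by auto
  have "(2::real) ^ m \<le> (2 * 2 ^ m) ^ 12"
  proof -
    have "(2::real) ^ m \<le> (2 ^ m) ^ 12" using power_increasing[of 1 12 "(2::real) ^ m"] by simp
    also have "\<dots> \<le> (2 * 2 ^ m) ^ 12" by (intro power_mono) auto
    finally show ?thesis .
  qed
  then have ex: "\<exists>j. norm (pt n) < (2 * 2 ^ j) ^ 12" using m by (meson less_le_trans)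
  define j where "j = (LEAST j. norm (pt n) < (2 * 2 ^ j) ^ 12)"
  have j: "norm (pt n) < (2 * 2 ^ j) ^ 12" unfolding j_def by (rule LeastI_ex[OF ex])
  have "(2 ^ j) ^ 12 \<le> norm (pt n)"
  proof (cases j)
    case 0
    then show ?thesis using norm_pt_ge_1[OF assms] by simp
  next
    case (Suc i)
    then have "\<not> norm (pt n) < (2 * 2 ^ i) ^ 12" unfolding j_def by (intro not_less_Least) simp
    then show ?thesis using Suc by simp
  qed
  then show thesis using j by (intro that[of j]) (simp add: shell_def)
qed

context curved_domain
begin

text \<open>Shells of inner radius up to \<open>sqrt R\<close> decay by the gain of
  \<open>near_shell\<close>; beyond that the kernel weight \<open>R / |k|^2\<close> provides the
  decay.\<close>

lemma shell_sum:
  assumes A: "A > 0" and B: "B > 0"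
  obtains C where "C > 0" "\<forall>R Z J W P. 2 \<le> R \<longrightarrow> finite Z \<longrightarrow>
    (\<forall>k\<in>Z. \<bar>W k\<bar> \<le> 1 \<and> \<bar>W k\<bar> \<le> B * R / (norm (pt k))\<^sup>2) \<longrightarrow>
    (\<forall>k\<in>Z. slow R (A * R * prof (pt k) (r0 / R)) (P k)) \<longrightarrow>
    integral {R - 1/2 .. R + sqrt R + 1/2} (\<lambda>t. (norm (\<Sum>j<J. \<Sum>k\<in>Z \<inter> shell j. ee (t * rho (pt k)) * (of_real (W k) * P k t)))\<^sup>2) \<le> C * (R * sqrt R)"
proof -
  obtain C1 where C1: "C1 > 0" "\<forall>R j Z P. 2 \<le> R \<longrightarrow> Z \<subseteq> shell j \<longrightarrow> (2 ^ j) ^ 12 \<le> sqrt R \<longrightarrow>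
    (\<forall>k\<in>Z. slow R (A * R * prof (pt k) (r0 / R)) (P k)) \<longrightarrow>
    integral {R - 1/2 .. R + sqrt R + 1/2} (\<lambda>t. (norm (\<Sum>k\<in>Z. ee (t * rho (pt k)) * P k t))\<^sup>2) \<le> C1 * (R * sqrt R) / 2 ^ j"
    by (rule near_shell[OF A])
  obtain C2 where C2: "C2 > 0" "\<forall>R j Z w P. 2 \<le> R \<longrightarrow> Z \<subseteq> shell j \<longrightarrow> 0 \<le> w \<longrightarrow>
    (\<forall>k\<in>Z. slow R (w * (A * R * prof (pt k) (r0 / R))) (P k)) \<longrightarrow>
    integral {R - 1/2 .. R + sqrt R + 1/2} (\<lambda>t. (norm (\<Sum>k\<in>Z. ee (t * rho (pt k)) * P k t))\<^sup>2) \<le> C2 * (R * sqrt R) * w\<^sup>2"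
    by (rule far_shell[OF A])
  define C3 where "C3 = C1 + C2 * B\<^sup>2"
  have C3: "C3 > 0" "C1 \<le> C3" "C2 * B\<^sup>2 \<le> C3" using C1 C2 by (auto simp: C3_def add_pos_nonneg)
  show thesis
  proof (rule that[of "36 * C3"], use C3 in simp, intro allI impI)
    fix R Z W P and J :: nat
    assume R: "2 \<le> R" and Z: "finite Z"
      and W: "\<forall>k\<in>Z. \<bar>W k\<bar> \<le> 1 \<and> \<bar>W k\<bar> \<le> B * R / (norm (pt k))\<^sup>2"
      and P: "\<forall>k\<in>Z. slow R (A * R * prof (pt k) (r0 / R)) (P k)"
    define Y where "Y = sqrt (sqrt R)"
    have Y: "Y > 0" "Y\<^sup>2 = sqrt R" "Y ^ 4 = R"
    proof -
      show "Y > 0" "Y\<^sup>2 = sqrt R" using R by (simp_all add: Y_def)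
      then have "Y ^ 4 = (sqrt R)\<^sup>2" by (metis power_mult numeral_Bit0 power2_eq_square mult_2 power_add)
      then show "Y ^ 4 = R" using R by simp
    qed
    define q where "q j = ((2::real) ^ j) ^ 6" for j
    have q: "q j > 0" "q j = 64 ^ j" for j by (simp_all add: q_def power_mult[symmetric] mult.commute[of j] power_mult)
    have q12: "((2::real) ^ j) ^ 12 = (q j)\<^sup>2" for j by (simp add: q_def flip: power_mult)
    have near_iff: "q j \<le> Y \<longleftrightarrow> (2 ^ j) ^ 12 \<le> sqrt R" for j
      unfolding q12 Y(2)[symmetric] using q(1)[of j] Y(1) by (simp add: power_mono_iff)
    \<comment> \<open>Root mean square bounds per shell: \<open>(3/4)^j\<close> dominates
      \<open>2^(-j/2)\<close>, and \<open>(Y / q j)^4\<close> is \<open>R\<close> over the squared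
      inner radius, since \<open>q j\<close> is the square root of that radius and
      \<open>Y = R^(1/4)\<close>.\<close>
    define \<alpha> where "\<alpha> j = (if q j \<le> Y then (3/4) ^ j else (Y / q j) ^ 4)" for j
    have \<alpha>0: "\<alpha> j > 0" for j using q(1) Y(1) by (simp add: \<alpha>_def)
    have geo: "(\<Sum>j<J. (3/4::real) ^ j) \<le> 4"
    proof -
      have "(\<Sum>j<J. (3/4::real) ^ j) = (1 - (3/4) ^ J) / (1 - 3/4)" by (subst sum_gp_strict) simp
      then show ?thesis by simp
    qed
    have "(\<Sum>j<J. \<alpha> j) \<le> (\<Sum>j<J. (3/4) ^ j + (if 64 ^ j \<le> Y then 0 else Y / 64 ^ j))"
    proof (intro sum_mono)
      fix j
      show "\<alpha> j \<le> (3/4) ^ j + (if 64 ^ j \<le> Y then 0 else Y / 64 ^ j)"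
      proof (cases "q j \<le> Y")
        case False
        then have "Y / q j \<le> 1" "0 \<le> Y / q j" using Y(1) q(1)[of j] by (auto simp: less_imp_le)
        then have "(Y / q j) ^ 4 \<le> (Y / q j) ^ 1" by (intro power_decreasing) auto
        then show ?thesis using False by (simp add: \<alpha>_def q(2) add_increasing)
      qed (simp add: \<alpha>_def q(2))
    qed
    also have "\<dots> \<le> 4 + 2" unfolding sum.distrib using geo geometric_tail[of 64 Y J] Y(1) by (intro add_mono) auto
    finally have \<alpha>6: "(\<Sum>j<J. \<alpha> j) \<le> 6" by simp
    have sl: "slow R (A * R * prof (pt k) (r0 / R)) (\<lambda>t. of_real (W k) * P k t)" if k: "k \<in> Z" for k
    proof (rule slow_mono[OF slow_scale[OF bspec[OF P k]]])
      have "\<bar>W k\<bar> * (A * R * prof (pt k) (r0 / R)) \<le> 1 * (A * R * prof (pt k) (r0 / R))"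
        using W k A R prof_nonneg by (intro mult_right_mono) auto
      then show "\<bar>W k\<bar> * (A * R * prof (pt k) (r0 / R)) \<le> A * R * prof (pt k) (r0 / R)" by simp
    qed (use R in simp)
    have "integral {R - 1/2 .. R + sqrt R + 1/2} (\<lambda>t. (norm (\<Sum>j<J. \<Sum>k\<in>Z \<inter> shell j. ee (t * rho (pt k)) * (of_real (W k) * P k t)))\<^sup>2) \<le> 6\<^sup>2 * (C3 * (R * sqrt R))"
    proof (rule mean_square_sum[OF _ \<alpha>0 \<alpha>6])
      show "continuous_on {R - 1 / 2..R + sqrt R + 1 / 2} (\<lambda>t. \<Sum>k\<in>Z \<inter> shell j. ee (t * rho (pt k)) * (of_real (W k) * P k t))" for j
        by (intro continuous_intros slow_continuous[OF sl]) blast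
      show "0 \<le> C3 * (R * sqrt R)" using C3 R by simp
      fix j
      show "integral {R - 1 / 2..R + sqrt R + 1 / 2} (\<lambda>t. (norm (\<Sum>k\<in>Z \<inter> shell j. ee (t * rho (pt k)) * (of_real (W k) * P k t)))\<^sup>2) \<le> C3 * (R * sqrt R) * (\<alpha> j)\<^sup>2"
      proof (cases "q j \<le> Y")
        case True
        have "integral {R - 1 / 2..R + sqrt R + 1 / 2} (\<lambda>t. (norm (\<Sum>k\<in>Z \<inter> shell j. ee (t * rho (pt k)) * (of_real (W k) * P k t)))\<^sup>2) \<le> C1 * (R * sqrt R) / 2 ^ j"
          by (rule C1(2)[rule_format, OF R]) (use True near_iff sl in auto)
        also have "\<dots> \<le> C3 * (R * sqrt R) * (\<alpha> j)\<^sup>2"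
        proof -
          have "(1/2::real) ^ j \<le> (9/16) ^ j" by (intro power_mono) auto
          also have "(9/16::real) ^ j = ((3/4)\<^sup>2) ^ j" by (simp add: power2_eq_square)
          also have "\<dots> = (\<alpha> j)\<^sup>2" using True by (simp add: \<alpha>_def power_mult[symmetric] mult.commute)
          finally have "C1 * (R * sqrt R) * (1/2) ^ j \<le> C3 * (R * sqrt R) * (\<alpha> j)\<^sup>2"
            using C3 R by (intro mult_mono mult_right_mono) auto
          then show ?thesis by (simp add: power_one_over)
        qed
        finally show ?thesis .
      next
        case False
        define w where "w = B * R / ((2 ^ j) ^ 12)\<^sup>2"
        have "(((2::real) ^ j) ^ 12)\<^sup>2 = q j ^ 4" by (simp only: q12) (simp flip: power_mult)
        then have w: "w = B * \<alpha> j" using False by (simp only: w_def \<alpha>_def power_divide Y(3)) simp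
        then have w: "w \<ge> 0" "w = B * \<alpha> j" using B \<alpha>0[of j] by auto
        have "integral {R - 1 / 2..R + sqrt R + 1 / 2} (\<lambda>t. (norm (\<Sum>k\<in>Z \<inter> shell j. ee (t * rho (pt k)) * (of_real (W k) * P k t)))\<^sup>2) \<le> C2 * (R * sqrt R) * w\<^sup>2"
        proof (rule C2(2)[rule_format, OF R Int_lower2 w(1)])
          fix k assume k: "k \<in> Z \<inter> shell j"
          have "((2 ^ j) ^ 12)\<^sup>2 \<le> (norm (pt k))\<^sup>2" using k by (intro power_mono) (auto simp: shell_def)
          then have "B * R / (norm (pt k))\<^sup>2 \<le> w" unfolding w_def using B R norm_shell(2)[of k j] k by (intro divide_left_mono) auto
          then have "\<bar>W k\<bar> \<le> w" using W k by force
          then have le: "\<bar>W k\<bar> * (A * R * prof (pt k) (r0 / R)) \<le> w * (A * R * prof (pt k) (r0 / R))"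
            using A R prof_nonneg by (intro mult_right_mono) auto
          show "slow R (w * (A * R * prof (pt k) (r0 / R))) (\<lambda>t. of_real (W k) * P k t)"
            by (rule slow_mono[OF slow_scale[OF bspec[OF P]] le]) (use k R in auto)
        qed
        also have "\<dots> = (C2 * B\<^sup>2) * (R * sqrt R) * (\<alpha> j)\<^sup>2" by (simp add: w(2) power_mult_distrib mult_ac)
        also have "\<dots> \<le> C3 * (R * sqrt R) * (\<alpha> j)\<^sup>2" using C3 R by (intro mult_right_mono) auto
        finally show ?thesis .
      qed
    qed
    then show "integral {R - 1/2 .. R + sqrt R + 1/2} (\<lambda>t. (norm (\<Sum>j<J. \<Sum>k\<in>Z \<inter> shell j. ee (t * rho (pt k)) * (of_real (W k) * P k t)))\<^sup>2) \<le> 36 * C3 * (R * sqrt R)"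
      by simp
  qed
qed

lemma norm_powr_shell:
  assumes k: "k \<in> shell j"
  shows "(2 ^ j) ^ 18 \<le> norm (pt k) powr (3/2)"
proof -
  define Q :: real where "Q = 2 ^ j"
  have Q: "Q > 0" by (simp add: Q_def)
  have "Q ^ 12 \<le> norm (pt k)" using k by (simp add: shell_def Q_def)
  then have "norm (pt k) powr (3/2) \<ge> (Q ^ 12) powr (3/2)" using Q by (intro powr_mono2) auto
  moreover have "(Q ^ 12) powr (3/2) = Q ^ 18"
  proof -
    have "Q ^ 12 = Q powr 12" "Q ^ 18 = Q powr 18" using Q by (simp_all add: powr_numeral)
    then show ?thesis using powr_powr[of Q 12 "3/2"] by simp
  qed
  ultimately show ?thesis by (simp add: Q_def)
qed

text \<open>\<open>Q^24\<close> points times \<open>Q^-18\<close> make \<open>Q^6\<close>, the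
  square root of the radius; this grows until the radius is \<open>sqrt R\<close>, where the weight
  takes over, and \<open>R^(1/4)\<close> is the result. As the remainder of one coefficient is of
  order \<open>R^(1/4) |k|^(-3/2)\<close>, all remainders together are of order
  \<open>R^(1/2)\<close>.\<close>

lemma weighted_sum_shells:
  assumes B: "B > 0" and R: "2 \<le> R" and Z: "finite Z"
    and W: "\<forall>k\<in>Z. \<bar>W k\<bar> \<le> 1 \<and> \<bar>W k\<bar> \<le> B * R / (norm (pt k))\<^sup>2"
  shows "(\<Sum>j<J. \<Sum>k\<in>Z \<inter> shell j. \<bar>W k\<bar> / norm (pt k) powr (3/2)) \<le> 10 ^ 9 * (2 + 2 * B) * sqrt (sqrt R)"
proof -
  define Y where "Y = sqrt (sqrt R)"
  have Y: "Y > 0" "Y ^ 4 = R"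
  proof -
    show "Y > 0" using R by (simp add: Y_def)
    have "Y ^ 4 = (Y\<^sup>2)\<^sup>2" by simp
    then show "Y ^ 4 = R" using R by (simp add: Y_def)
  qed
  define q where "q j = (64::real) ^ j" for j :: nat
  have q: "q j > 0" for j by (simp add: q_def)
  have q1: "q j = (2 ^ j) ^ 6" for j
  proof -
    have "(2::real) ^ (6 * j) = (2 ^ 6) ^ j" by (rule power_mult)
    then show ?thesis by (simp add: q_def power_mult[symmetric] mult.commute)
  qed
  have qq: "(2 ^ j) ^ 12 = q j ^ 2" "(2 ^ j) ^ 18 = q j ^ 3" "(2 ^ j) ^ 24 = q j ^ 4" for j
    unfolding q1 by (simp_all flip: power_mult)
  have "(\<Sum>k\<in>Z \<inter> shell j. \<bar>W k\<bar> / norm (pt k) powr (3/2)) \<le> 10 ^ 9 * (Y * (if 64 ^ j \<le> Y then 64 ^ j / Y else 0) + B * Y * (if 64 ^ j \<le> Y then 0 else Y / 64 ^ j))" for j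
  proof -
    define w where "w = (if q j \<le> Y then 1 else B * (Y / q j) ^ 4)"
    have w0: "w \<ge> 0" using B by (simp add: w_def)
    have "\<bar>W k\<bar> / norm (pt k) powr (3/2) \<le> w / q j ^ 3" if k: "k \<in> Z \<inter> shell j" for k
    proof (intro frac_le)
      show "\<bar>W k\<bar> \<le> w"
      proof (cases "q j \<le> Y")
        case True then show ?thesis using W k by (auto simp: w_def)
      next
        case False
        have "q j ^ 2 \<le> norm (pt k)" using k unfolding qq(1)[symmetric] shell_def by blast
        then have "(q j ^ 2)\<^sup>2 \<le> (norm (pt k))\<^sup>2" using q[of j] by (intro power_mono) auto
        then have "B * R / (norm (pt k))\<^sup>2 \<le> B * R / (q j ^ 2)\<^sup>2"
          using B R q[of j] norm_shell(2)[of k j] k by (intro divide_left_mono) auto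
        also have "\<dots> = w" using False Y(2) by (simp add: w_def power_divide)
        finally show ?thesis using W k by force
      qed
      show "q j ^ 3 \<le> norm (pt k) powr (3/2)" using norm_powr_shell[of k j] k by (simp add: qq)
    qed (use w0 q in auto)
    then have "(\<Sum>k\<in>Z \<inter> shell j. \<bar>W k\<bar> / norm (pt k) powr (3/2)) \<le> (\<Sum>k\<in>Z \<inter> shell j. w / q j ^ 3)" by (rule sum_mono)
    also have "\<dots> = real (card (Z \<inter> shell j)) * (w / q j ^ 3)" by simp
    also have "\<dots> \<le> (10 ^ 9 * q j ^ 4) * (w / q j ^ 3)"
      using card_shell[of "Z \<inter> shell j" j] w0 q[of j] by (intro mult_right_mono) (auto simp: qq)
    also have "\<dots> = 10 ^ 9 * (q j * w)"
    proof -
      have "q j ^ 4 = q j * q j ^ 3" by (simp flip: power_Suc)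
      then show ?thesis using q[of j] by simp
    qed
    also have "q j * w \<le> Y * (if 64 ^ j \<le> Y then 64 ^ j / Y else 0) + B * Y * (if 64 ^ j \<le> Y then 0 else Y / 64 ^ j)"
    proof (cases "q j \<le> Y")
      case True
      then show ?thesis using Y(1) by (simp add: w_def q_def)
    next
      case False
      define z where "z = Y / q j"
      have z: "0 \<le> z" "z \<le> 1" using False Y q[of j] by (auto simp: z_def)
      have "q j * z = Y" using q[of j] by (simp add: z_def)
      then have "q j * w = B * Y * z ^ 3" using False by (simp add: w_def z_def[symmetric] power4_eq_xxxx power3_eq_cube)
      also have "\<dots> \<le> B * Y * z ^ 1" using z B Y by (intro mult_left_mono power_decreasing) auto
      finally show ?thesis using False by (simp add: q_def z_def)
    qed
    finally show ?thesis by simp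
  qed
  then have "(\<Sum>j<J. \<Sum>k\<in>Z \<inter> shell j. \<bar>W k\<bar> / norm (pt k) powr (3/2)) \<le>
     (\<Sum>j<J. 10 ^ 9 * (Y * (if 64 ^ j \<le> Y then 64 ^ j / Y else 0) + B * Y * (if 64 ^ j \<le> Y then 0 else Y / 64 ^ j)))"
    by (rule sum_mono)
  also have "\<dots> = 10 ^ 9 * (Y * (\<Sum>j<J. if 64 ^ j \<le> Y then 64 ^ j / Y else 0) + B * Y * (\<Sum>j<J. if 64 ^ j \<le> Y then 0 else Y / 64 ^ j))"
    by (simp only: sum_distrib_left[symmetric] sum.distrib)
  also have "\<dots> \<le> 10 ^ 9 * (Y * 2 + B * Y * 2)"
    using Y B by (intro mult_left_mono add_mono geometric_head geometric_tail) auto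
  finally show ?thesis by (simp add: Y_def algebra_simps)
qed

end

section \<open>The smoothed error as a sum over shells\<close>

lemma kernel_weight_le:
  fixes s :: "int \<Rightarrow> real"
  assumes a: "a > 0" and s1: "\<And>m. \<bar>s m\<bar> \<le> 1" and s2: "\<And>m. m \<noteq> 0 \<Longrightarrow> \<bar>s m\<bar> \<le> 1 / (of_int m * a)\<^sup>2" and k: "k \<noteq> 0"
  shows "\<bar>s (fst k) * s (snd k)\<bar> \<le> 2 / (norm (pt k) * a)\<^sup>2"
proof -
  \<comment> \<open>The larger coordinate carries at least half of the squared norm and its factor
    supplies the decay; the other factor is at most 1.\<close>
  have key: "\<bar>s m\<bar> * \<bar>s n\<bar> \<le> 2 / (x * a\<^sup>2)"
    if mn: "\<bar>n\<bar> \<le> \<bar>m\<bar>" "m \<noteq> 0" and x: "x = (of_int m)\<^sup>2 + (of_int n)\<^sup>2" for m n and x :: real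
  proof -
    have "\<bar>real_of_int n\<bar> \<le> \<bar>real_of_int m\<bar>" using mn by linarith
    then have n2: "(real_of_int n)\<^sup>2 \<le> (real_of_int m)\<^sup>2" by (simp add: abs_le_square_iff)
    have m0: "(real_of_int m)\<^sup>2 > 0" using mn by simp
    have "\<bar>s m\<bar> * \<bar>s n\<bar> \<le> 1 / (of_int m * a)\<^sup>2 * 1" using s1 s2 mn by (intro mult_mono) auto
    also have "\<dots> = 2 / (2 * (of_int m)\<^sup>2 * a\<^sup>2)" by (simp add: power_mult_distrib)
    also have "\<dots> \<le> 2 / (x * a\<^sup>2)"
    proof (intro divide_left_mono mult_right_mono mult_pos_pos)
      show "x \<le> 2 * (real_of_int m)\<^sup>2" using n2 x by linarith
      have "0 \<le> (real_of_int n)\<^sup>2" by simp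
      then show "0 < x" using m0 x by linarith
    qed (use a m0 mn in auto)
    finally show ?thesis .
  qed
  have nk: "(norm (pt k))\<^sup>2 = (of_int (fst k))\<^sup>2 + (of_int (snd k))\<^sup>2" by (simp add: pt_def norm_Pair)
  have "\<bar>s (fst k)\<bar> * \<bar>s (snd k)\<bar> \<le> 2 / ((norm (pt k))\<^sup>2 * a\<^sup>2)"
  proof (cases "\<bar>snd k\<bar> \<le> \<bar>fst k\<bar>")
    case True
    then have "fst k \<noteq> 0" using k by (auto simp: prod_eq_iff)
    then show ?thesis using key[OF True _ nk] by simp
  next
    case False
    then have "\<bar>fst k\<bar> \<le> \<bar>snd k\<bar>" "snd k \<noteq> 0" by auto
    then show ?thesis using key[of "fst k" "snd k" "(norm (pt k))\<^sup>2"] nk by (simp add: mult.commute add.commute)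
  qed
  then show ?thesis by (simp add: abs_mult power_mult_distrib)
qed

lemma finite_shell_cover:
  assumes "finite Z" "0 \<notin> Z"
  obtains J where "Z \<subseteq> (\<Union>j<J. shell j)"
proof -
  have "\<forall>k\<in>Z. \<exists>j. k \<in> shell j" using assms shell_exists by metis
  then obtain f where f: "\<And>k. k \<in> Z \<Longrightarrow> k \<in> shell (f k)" by metis
  obtain J where "\<forall>n\<in>f ` Z. n < J" using finite_nat_set_iff_bounded[of "f ` Z"] assms(1) by auto
  then show thesis using f by (intro that[of J]) blast
qed

lemma sum_over_shells:
  fixes h :: "int \<times> int \<Rightarrow> 'a::comm_monoid_add"
  assumes Z: "finite Z" and J: "Z \<subseteq> (\<Union>j<J. shell j)"
  shows "sum h Z = (\<Sum>j<J. \<Sum>k\<in>Z \<inter> shell j. h k)"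
proof -
  have "sum h (\<Union>j\<in>{..<J}. Z \<inter> shell j) = (\<Sum>j<J. \<Sum>k\<in>Z \<inter> shell j. h k)"
    by (rule sum.UNION_disjoint) (use Z shell_disjoint in auto)
  moreover have "(\<Union>j\<in>{..<J}. Z \<inter> shell j) = Z" using J by auto
  ultimately show ?thesis by simp
qed

context curved_domain
begin

text \<open>The majorant \<open>U\<close> consists of two oscillating sums, one for each end of the
  slices, and of a remainder of order \<open>sqrt R\<close>. It is continuous and controlled on the
  widened window, so it can later be integrated at shifted times.\<close>

lemma smooth_majorant:
  obtains C where "C > 0" "\<forall>R N s. 2 \<le> R \<longrightarrow> s 0 = 1 \<longrightarrow> (\<forall>m. s (- m) = s m) \<longrightarrow> (\<forall>m. \<bar>s m\<bar> \<le> 1) \<longrightarrow>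
    (\<forall>m. m \<noteq> 0 \<longrightarrow> \<bar>s m\<bar> \<le> 1 / (of_int m * (r0 / (10 * sqrt R)))\<^sup>2) \<longrightarrow>
    (\<exists>U. continuous_on {R - 1/2 .. R + sqrt R + 1/2} U \<and>
      (\<forall>t\<in>{R - 1/2 .. R + sqrt R + 1/2}. \<bar>smooth_count N s t - t\<^sup>2 * measure lborel K\<bar> \<le> U t) \<and>
      integral {R - 1/2 .. R + sqrt R + 1/2} (\<lambda>t. (U t)\<^sup>2) \<le> C * (R * sqrt R))"
proof -
  define A where "A = 32 * pi / r0"
  \<comment> \<open>\<open>B * R\<close> is twice the square of the inverse smoothing scale
    \<open>10 sqrt R / r0\<close>, as in \<open>kernel_weight_le\<close>.\<close>
  define B where "B = 200 / r0\<^sup>2"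
  have AB: "A > 0" "B > 0" using r0 by (auto simp: A_def B_def)
  obtain C1 where C1: "C1 > 0" "\<forall>R Z J W P. 2 \<le> R \<longrightarrow> finite Z \<longrightarrow>
    (\<forall>k\<in>Z. \<bar>W k\<bar> \<le> 1 \<and> \<bar>W k\<bar> \<le> B * R / (norm (pt k))\<^sup>2) \<longrightarrow>
    (\<forall>k\<in>Z. slow R (A * R * prof (pt k) (r0 / R)) (P k)) \<longrightarrow>
    integral {R - 1/2 .. R + sqrt R + 1/2} (\<lambda>t. (norm (\<Sum>j<J. \<Sum>k\<in>Z \<inter> shell j. ee (t * rho (pt k)) * (of_real (W k) * P k t)))\<^sup>2) \<le> C1 * (R * sqrt R)"
    by (rule shell_sum[OF AB])
  define c where "c = 16 / r0 * (M * sqrt r0) * (10 ^ 9 * (2 + 2 * B)) + 1"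
  have c: "c > 0" using r0 M0 AB by (simp add: c_def add_nonneg_pos)
  define C where "C = 3 * (2 * C1 + 2 * c\<^sup>2)"
  have C: "C > 0" using C1 c by (simp add: C_def add_pos_pos)
  show thesis
  proof (rule that[OF C], intro allI impI)
    fix R N s
    assume R: "2 \<le> (R::real)" and s: "s 0 = (1::real)" "\<forall>m. s (- m) = s m" "\<forall>m. \<bar>s m\<bar> \<le> 1"
      "\<forall>m. m \<noteq> 0 \<longrightarrow> \<bar>s m\<bar> \<le> 1 / (of_int m * (r0 / (10 * sqrt R)))\<^sup>2"
    define I where "I = {R - 1/2 .. R + sqrt R + 1/2}"
    have sR: "sqrt R \<ge> 1" "sqrt R \<le> R"
    proof -
      show "sqrt R \<ge> 1" using R by simp
      then have "sqrt R * 1 \<le> sqrt R * sqrt R" by (intro mult_left_mono) auto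
      then show "sqrt R \<le> R" using R by simp
    qed
    define Z where "Z = {- int N..int N} \<times> {- int N..int N} - {0}"
    define W where "W k = s (fst k) * s (snd k)" for k
    have Z: "finite Z" "0 \<notin> Z" by (auto simp: Z_def)
    have Zm: "- k \<in> Z \<longleftrightarrow> k \<in> Z" for k by (cases k) (auto simp: Z_def zero_prod_def)
    have Wm: "W (- k) = W k" for k using s(2) by (simp add: W_def)
    have Wb: "\<forall>k\<in>Z. \<bar>W k\<bar> \<le> 1 \<and> \<bar>W k\<bar> \<le> B * R / (norm (pt k))\<^sup>2"
    proof (intro ballI conjI)
      fix k assume k: "k \<in> Z"
      have "\<bar>s (fst k)\<bar> * \<bar>s (snd k)\<bar> \<le> 1 * 1" using s(3) by (intro mult_mono) auto
      then show "\<bar>W k\<bar> \<le> 1" by (simp add: W_def abs_mult)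
      have "\<bar>W k\<bar> \<le> 2 / (norm (pt k) * (r0 / (10 * sqrt R)))\<^sup>2"
        unfolding W_def by (rule kernel_weight_le) (use r0 R s k Z in auto)
      also have "\<dots> = B * R / (norm (pt k))\<^sup>2" using R by (simp add: B_def power_mult_distrib power_divide)
      finally show "\<bar>W k\<bar> \<le> B * R / (norm (pt k))\<^sup>2" .
    qed
    \<comment> \<open>Lets the approximation errors of all frequencies add up to at most 1.\<close>
    define \<epsilon> where "\<epsilon> = 1 / (real (card Z) + 1)"
    have \<epsilon>: "\<epsilon> > 0" "real (card Z) * \<epsilon> \<le> 1" by (auto simp: \<epsilon>_def divide_simps)
    define e1 where "e1 = 16 * sqrt R / r0 * (M * sqrt (r0 / sqrt R))"
    have "\<exists>P Q. slow R (A * R * prof (pt k) (r0 / R)) P \<and> slow R (A * R * prof (pt (- k)) (r0 / R)) Q \<and>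
      (\<forall>t. 0 < t \<longrightarrow> t \<le> 4 * R \<longrightarrow> norm (of_real (4 * pi\<^sup>2) * coef (pt k) t - ee (t * rho (pt k)) * P t - ee (- (t * rho (pt (- k)))) * Q t)
        \<le> e1 / norm (pt k) powr (3/2) + \<epsilon>)" if k: "k \<in> Z" for k
    proof -
      have n: "1 \<le> norm (pt k)" using k Z by (intro norm_pt_ge_1) auto
      have R1: "R \<ge> 1" using R by simp
      show ?thesis
        by (rule coef_structure[OF n R1 \<epsilon>(1)], rule exI, rule exI)
          (auto simp: A_def e1_def pt_minus mult_ac)
    qed
    then obtain P Q where PQ: "\<And>k. k \<in> Z \<Longrightarrow> slow R (A * R * prof (pt k) (r0 / R)) (P k)"
      "\<And>k. k \<in> Z \<Longrightarrow> slow R (A * R * prof (pt (- k)) (r0 / R)) (Q k)"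
      "\<And>k t. k \<in> Z \<Longrightarrow> 0 < t \<Longrightarrow> t \<le> 4 * R \<Longrightarrow> norm (of_real (4 * pi\<^sup>2) * coef (pt k) t - ee (t * rho (pt k)) * P k t - ee (- (t * rho (pt (- k)))) * Q k t)
        \<le> e1 / norm (pt k) powr (3/2) + \<epsilon>"
      by metis
    obtain J where J: "Z \<subseteq> (\<Union>j<J. shell j)" using finite_shell_cover[OF Z] .
    define F where "F t = (\<Sum>j<J. \<Sum>k\<in>Z \<inter> shell j. ee (t * rho (pt k)) * (of_real (W k) * P k t))" for t
    \<comment> \<open>Taken at \<open>- k\<close> and conjugated, the terms of the far ends have the
      form of those of the near ends, and \<open>shell_sum\<close> applies again.\<close>
    define G where "G t = (\<Sum>j<J. \<Sum>k\<in>Z \<inter> shell j. ee (t * rho (pt k)) * (of_real (W k) * cnj (Q (- k) t)))" for t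
    have slQ: "slow R (A * R * prof (pt k) (r0 / R)) (\<lambda>t. cnj (Q (- k) t))" if "k \<in> Z" for k
      using slow_cnj[OF PQ(2)[of "- k"]] that by (simp add: Zm)
    have iF: "integral I (\<lambda>t. (norm (F t))\<^sup>2) \<le> C1 * (R * sqrt R)"
      unfolding I_def F_def by (rule C1(2)[rule_format, OF R Z(1)]) (use Wb PQ in auto)
    have iG: "integral I (\<lambda>t. (norm (G t))\<^sup>2) \<le> C1 * (R * sqrt R)"
      unfolding I_def G_def by (rule C1(2)[rule_format, OF R Z(1)]) (use Wb slQ in auto)
    have cF: "continuous_on I F" unfolding F_def
      by (intro continuous_intros slow_continuous[OF PQ(1)]) blast
    have cG: "continuous_on I G" unfolding G_def
      by (intro continuous_intros slow_continuous[OF slQ]) blast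
    define U where "U t = norm (F t) + norm (G t) + c * sqrt R" for t
    have bound: "\<bar>smooth_count N s t - t\<^sup>2 * measure lborel K\<bar> \<le> U t" if t: "t \<in> I" for t
    proof -
      have t0: "0 < t" "t \<le> 4 * R" using t R sR by (auto simp: I_def)
      define D where "D = (\<Sum>k\<in>Z. of_real (W k) * coef (pt k) t)"
      have "(\<Sum>m\<in>{- int N..int N}. \<Sum>n\<in>{- int N..int N}. of_real (s m * s n) * coef (pt (m, n)) t)
        = (\<Sum>k\<in>{- int N..int N} \<times> {- int N..int N}. of_real (W k) * coef (pt k) t)"
        by (simp add: sum.cartesian_product W_def case_prod_unfold)
      also have "\<dots> = of_real (W 0) * coef (pt 0) t + D"
        unfolding D_def Z_def by (rule sum.remove) (auto simp: zero_prod_def)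
      also have "of_real (W 0) * coef (pt 0) t = of_real (t\<^sup>2 * measure lborel K)"
        using coef_0[OF t0(1)] s(1) by (simp add: W_def pt_def zero_prod_def)
      finally have "smooth_count N s t - t\<^sup>2 * measure lborel K = Re D" unfolding smooth_count_def by simp
      then have S: "\<bar>smooth_count N s t - t\<^sup>2 * measure lborel K\<bar> \<le> norm D" using abs_Re_le_cmod[of D] by simp
      define D1 where "D1 = (\<Sum>k\<in>Z. of_real (W k) * (ee (t * rho (pt k)) * P k t))"
      define D2 where "D2 = (\<Sum>k\<in>Z. of_real (W k) * (ee (- (t * rho (pt (- k)))) * Q k t))"
      have "D1 = F t" unfolding D1_def F_def sum_over_shells[OF Z(1) J] by (simp add: mult_ac)
      then have "norm D1 = norm (F t)" by simp
      moreover have "norm D2 = norm (G t)"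
      proof -
        have "D2 = (\<Sum>k\<in>Z. of_real (W k) * (ee (- (t * rho (pt k))) * Q (- k) t))"
          unfolding D2_def by (rule sum.reindex_bij_witness[of _ uminus uminus]) (auto simp: Zm Wm)
        also have "\<dots> = cnj (\<Sum>k\<in>Z. ee (t * rho (pt k)) * (of_real (W k) * cnj (Q (- k) t)))"
          by (simp add: cnj_sum cnj_ee mult_ac)
        also have "\<dots> = cnj (G t)" unfolding G_def sum_over_shells[OF Z(1) J] ..
        finally show ?thesis by simp
      qed
      moreover have "norm (of_real (4 * pi\<^sup>2) * D - D1 - D2) \<le> c * sqrt R"
      proof -
        have "of_real (4 * pi\<^sup>2) * D - D1 - D2 = (\<Sum>k\<in>Z. of_real (W k) * (of_real (4 * pi\<^sup>2) * coef (pt k) t - ee (t * rho (pt k)) * P k t - ee (- (t * rho (pt (- k)))) * Q k t))"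
          unfolding D_def D1_def D2_def sum_distrib_left sum_subtractf[symmetric]
          by (intro sum.cong) (auto simp: algebra_simps)
        also have "norm \<dots> \<le> (\<Sum>k\<in>Z. \<bar>W k\<bar> * (e1 / norm (pt k) powr (3/2)) + \<epsilon>)"
        proof (rule sum_norm_le)
          fix k assume k: "k \<in> Z"
          have "\<bar>W k\<bar> * norm (of_real (4 * pi\<^sup>2) * coef (pt k) t - ee (t * rho (pt k)) * P k t - ee (- (t * rho (pt (- k)))) * Q k t)
            \<le> \<bar>W k\<bar> * (e1 / norm (pt k) powr (3/2) + \<epsilon>)" by (rule mult_left_mono[OF PQ(3)[OF k t0]]) simp
          also have "\<dots> \<le> \<bar>W k\<bar> * (e1 / norm (pt k) powr (3/2)) + 1 * \<epsilon>"
            unfolding distrib_left using Wb k \<epsilon> by (intro add_left_mono mult_right_mono) auto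
          finally show "norm (of_real (W k) * (of_real (4 * pi\<^sup>2) * coef (pt k) t - ee (t * rho (pt k)) * P k t - ee (- (t * rho (pt (- k)))) * Q k t)) \<le> \<bar>W k\<bar> * (e1 / norm (pt k) powr (3/2)) + \<epsilon>"
            unfolding norm_mult norm_of_real by simp
        qed
        also have "\<dots> = e1 * (\<Sum>k\<in>Z. \<bar>W k\<bar> / norm (pt k) powr (3/2)) + real (card Z) * \<epsilon>"
          by (simp add: sum.distrib sum_distrib_left mult_ac)
        also have "\<dots> \<le> e1 * (10 ^ 9 * (2 + 2 * B) * sqrt (sqrt R)) + 1"
          unfolding sum_over_shells[OF Z(1) J] using r0 M0 R
          by (intro add_mono mult_left_mono weighted_sum_shells AB R Z Wb \<epsilon>) (simp add: e1_def)
        \<comment> \<open>\<open>e1\<close> and the weighted sum are both of order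
          \<open>R^(1/4)\<close>.\<close>
        also have "\<dots> = (16 / r0 * (M * sqrt r0) * (10 ^ 9 * (2 + 2 * B))) * sqrt R + 1"
        proof -
          have sq: "sqrt (r0 / sqrt R) * sqrt (sqrt R) = sqrt r0" using R by (simp add: real_sqrt_divide)
          have gen: "16 * x / r0 * (M * p) * (L * y) = 16 / r0 * (M * (p * y)) * L * x" for x p y L
            by (simp add: mult_ac)
          show ?thesis unfolding e1_def gen sq ..
        qed
        also have "\<dots> \<le> c * sqrt R" unfolding c_def distrib_right using sR by simp
        finally show ?thesis .
      qed
      moreover have "norm D \<le> norm (of_real (4 * pi\<^sup>2) * D)"
      proof -
        have "1 \<le> 4 * (pi * pi)" using pi_ge_two mult_mono[of 2 pi 2 pi] by simp
        then have "1 * norm D \<le> (4 * pi\<^sup>2) * norm D" by (intro mult_right_mono) (auto simp: power2_eq_square)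
        then show ?thesis unfolding norm_mult norm_of_real by simp
      qed
      moreover have "norm (of_real (4 * pi\<^sup>2) * D) \<le> norm (of_real (4 * pi\<^sup>2) * D - D1 - D2) + norm D1 + norm D2"
      proof -
        have "norm X \<le> norm (X - D2) + norm D2" "norm (X - D2) \<le> norm (X - D1 - D2) + norm D1" for X
          using norm_triangle_ineq[of "X - D2" D2] norm_triangle_ineq[of "X - D1 - D2" D1] by (simp_all add: algebra_simps)
        from this(1)[of "of_real (4 * pi\<^sup>2) * D"] this(2)[of "of_real (4 * pi\<^sup>2) * D"] show ?thesis by linarith
      qed
      ultimately show ?thesis using S unfolding U_def by linarith
    qed
    have cU: "continuous_on I U" unfolding U_def by (intro continuous_intros cF cG)
    have "integral I (\<lambda>t. (U t)\<^sup>2) \<le> integral I (\<lambda>t. 3 * ((norm (F t))\<^sup>2 + (norm (G t))\<^sup>2 + (c * sqrt R)\<^sup>2))"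
    proof (rule integral_le)
      fix t
      have eq: "3 * (a\<^sup>2 + b\<^sup>2 + e\<^sup>2) - (a + b + e)\<^sup>2 = (a - b)\<^sup>2 + (b - e)\<^sup>2 + (a - e)\<^sup>2" for a b e :: real
        by (simp add: power2_eq_square algebra_simps)
      have "0 \<le> 3 * (a\<^sup>2 + b\<^sup>2 + e\<^sup>2) - (a + b + e)\<^sup>2" for a b e :: real
        unfolding eq by (intro add_nonneg_nonneg zero_le_power2)
      from this[of "norm (F t)" "norm (G t)" "c * sqrt R"]
      show "(U t)\<^sup>2 \<le> 3 * ((norm (F t))\<^sup>2 + (norm (G t))\<^sup>2 + (c * sqrt R)\<^sup>2)" unfolding U_def by linarith
    qed (use cU cF cG in \<open>auto simp: I_def intro!: integrable_continuous_real continuous_intros\<close>)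
    also have "\<dots> = 3 * (integral I (\<lambda>t. (norm (F t))\<^sup>2) + integral I (\<lambda>t. (norm (G t))\<^sup>2) + (sqrt R + 1) * (c * sqrt R)\<^sup>2)"
    proof -
      have i: "(\<lambda>t. (norm (F t))\<^sup>2) integrable_on I" "(\<lambda>t. (norm (G t))\<^sup>2) integrable_on I" "(\<lambda>t. (c * sqrt R)\<^sup>2) integrable_on I"
        unfolding I_def by (intro integrable_continuous_real continuous_intros cF[unfolded I_def] cG[unfolded I_def])+
      have "integral I (\<lambda>t. (c * sqrt R)\<^sup>2) = (sqrt R + 1) * (c * sqrt R)\<^sup>2" unfolding I_def using sR by simp
      then show ?thesis using i by (simp only: integral_mult_right integral_add integrable_add)
    qed
    also have "\<dots> \<le> 3 * (C1 * (R * sqrt R) + C1 * (R * sqrt R) + (2 * sqrt R) * (c\<^sup>2 * R))"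
    proof (intro mult_left_mono add_mono iF iG)
      have "(c * sqrt R)\<^sup>2 = c\<^sup>2 * R" using R by (simp add: power_mult_distrib)
      then show "(sqrt R + 1) * (c * sqrt R)\<^sup>2 \<le> 2 * sqrt R * (c\<^sup>2 * R)" using sR R by (simp only:) (intro mult_right_mono, auto)
    qed simp
    also have "\<dots> = C * (R * sqrt R)" by (simp add: C_def algebra_simps)
    finally have "integral I (\<lambda>t. (U t)\<^sup>2) \<le> C * (R * sqrt R)" .
    then show "\<exists>U. continuous_on {R - 1/2 .. R + sqrt R + 1/2} U \<and>
      (\<forall>t\<in>{R - 1/2 .. R + sqrt R + 1/2}. \<bar>smooth_count N s t - t\<^sup>2 * measure lborel K\<bar> \<le> U t) \<and>
      integral {R - 1/2 .. R + sqrt R + 1/2} (\<lambda>t. (U t)\<^sup>2) \<le> C * (R * sqrt R)"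
      using cU bound unfolding I_def by blast
  qed
qed

end

section \<open>The mean square of the lattice point error\<close>

context curved_domain
begin

definition err :: "real \<Rightarrow> real" where
  "err t = real (card (Lat t)) - t\<^sup>2 * measure lborel K"

lemma finite_Lat: "t \<ge> 0 \<Longrightarrow> finite (Lat t)"
proof -
  assume t: "t \<ge> 0"
  define B where "B = \<lceil>t * r1\<rceil>"
  have "Lat t \<subseteq> {- B..B} \<times> {- B..B}"
  proof
    fix n assume "n \<in> Lat t"
    then have "pt n \<in> dil t" using closure_subset by (auto simp: Lat_def dil_def)
    then have "norm (pt n) \<le> t * r1" using dil_norm t by auto
    then have "\<bar>real_of_int (fst n)\<bar> \<le> t * r1" "\<bar>real_of_int (snd n)\<bar> \<le> t * r1"
      using abs_pt_le[of n] by linarith+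
    then have "\<bar>fst n\<bar> \<le> B" "\<bar>snd n\<bar> \<le> B" unfolding B_def by linarith+
    then show "n \<in> {- B..B} \<times> {- B..B}" by (cases n) (auto simp: abs_le_iff)
  qed
  then show ?thesis by (rule finite_subset) simp
qed

lemma Lat_mono: "0 < t \<Longrightarrow> t \<le> t' \<Longrightarrow> Lat t \<subseteq> Lat t'"
proof
  fix n assume t: "0 < t" "t \<le> t'" and "n \<in> Lat t"
  then obtain x where x: "x \<in> \<Omega>" "pt n = t *\<^sub>R x" by (auto simp: Lat_def)
  have "(1 - t / t') *\<^sub>R 0 + (t / t') *\<^sub>R x \<in> \<Omega>"
    using t x zero_in by (intro convexD[OF conv]) auto
  then have "(t / t') *\<^sub>R x \<in> \<Omega>" by simp
  moreover have "pt n = t' *\<^sub>R ((t / t') *\<^sub>R x)" using t x by simp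
  ultimately show "n \<in> Lat t'" unfolding Lat_def by blast
qed

text \<open>The lattice count increases with \<open>t\<close>, because \<open>\<Omega>\<close> is
  convex and contains the origin; so the square of the error is built from monotone and continuous
  functions.\<close>

lemma err_square_integrable:
  assumes l: "0 < l"
  shows "(\<lambda>t. (err t)\<^sup>2) integrable_on {l..u}"
proof -
  define N where "N t = real (card (Lat t))" for t
  have Nm: "N t \<le> N t'" if "l \<le> t" "t \<le> t'" for t t'
    unfolding N_def using that l card_mono[OF finite_Lat[of t'] Lat_mono[of t t']] by simp
  have N0: "N t \<ge> 0" for t by (simp add: N_def)
  have "(\<lambda>t. N t * N t) integrable_on {l..u}"
    by (rule integrable_on_mono_on) (auto simp: mono_on_def intro!: mult_mono Nm N0)
  moreover have "(\<lambda>t. N t * t\<^sup>2) integrable_on {l..u}"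
    by (rule integrable_on_mono_on) (use l in \<open>auto simp: mono_on_def intro!: mult_mono Nm N0 power_mono\<close>)
  moreover have "(\<lambda>t. (t\<^sup>2 * measure lborel K)\<^sup>2) integrable_on {l..u}"
    by (intro integrable_continuous_real continuous_intros)
  ultimately have "(\<lambda>t. N t * N t - (2 * measure lborel K) * (N t * t\<^sup>2) + (t\<^sup>2 * measure lborel K)\<^sup>2) integrable_on {l..u}"
    by (intro integrable_add integrable_diff integrable_on_mult_right)
  moreover have "(\<lambda>t. N t * N t - (2 * measure lborel K) * (N t * t\<^sup>2) + (t\<^sup>2 * measure lborel K)\<^sup>2) = (\<lambda>t. (err t)\<^sup>2)"
    by (auto simp: err_def N_def power2_eq_square algebra_simps)
  ultimately show ?thesis by simp
qed

text \<open>The smoothed errors at \<open>t + b\<close> and \<open>t - b\<close> enclose the error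
  at \<open>t\<close>, while the areas change by \<open>O(b t)\<close>. This is of the admissible
  size \<open>sqrt R\<close> exactly when \<open>b\<close> is of order \<open>R^(-1/2)\<close>,
  which fixes the smoothing scale.\<close>

lemma mean_square_sqrt:
  obtains C where "C > 0" "\<And>R. 2 \<le> R \<Longrightarrow> integral {R..R + sqrt R} (\<lambda>t. (err t)\<^sup>2) \<le> C * (R * sqrt R)"
proof -
  obtain C1 where C1: "C1 > 0" "\<forall>R N s. 2 \<le> R \<longrightarrow> s 0 = 1 \<longrightarrow> (\<forall>m. s (- m) = s m) \<longrightarrow> (\<forall>m. \<bar>s m\<bar> \<le> 1) \<longrightarrow>
    (\<forall>m. m \<noteq> 0 \<longrightarrow> \<bar>s m\<bar> \<le> 1 / (of_int m * (r0 / (10 * sqrt R)))\<^sup>2) \<longrightarrow>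
    (\<exists>U. continuous_on {R - 1/2 .. R + sqrt R + 1/2} U \<and>
      (\<forall>t\<in>{R - 1/2 .. R + sqrt R + 1/2}. \<bar>smooth_count N s t - t\<^sup>2 * measure lborel K\<bar> \<le> U t) \<and>
      integral {R - 1/2 .. R + sqrt R + 1/2} (\<lambda>t. (U t)\<^sup>2) \<le> C1 * (R * sqrt R))"
    by (rule smooth_majorant)
  define V where "V = measure lborel K"
  have V: "V \<ge> 0" by (simp add: V_def)
  define c where "c = 1 + 3 * V"
  define C where "C = 3 * (2 * C1 + c\<^sup>2)"
  have C: "C > 0" using C1 by (simp add: C_def add_pos_nonneg)
  show thesis
  proof (rule that[OF C])
    fix R :: real assume R: "2 \<le> R"
    define s where "s = sqrt R"
    have s: "s \<ge> 1" "s * s = R" "s > 0" using R by (auto simp: s_def)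
    have sR: "s \<le> R" using s mult_left_mono[of 1 s s] by simp
    \<comment> \<open>The constant 10 turns the shift \<open>5 a / r0\<close> into
      \<open>1 / (2 sqrt R)\<close>, which is at most 1/2.\<close>
    define a where "a = r0 / (10 * s)"
    have a: "0 < a" "a \<le> 1/6"
    proof -
      show "0 < a" using r0 s by (simp add: a_def)
      have "r0 / (10 * s) \<le> 1 / (10 * 1)" using r0 s by (intro frac_le mult_mono) auto
      then show "a \<le> 1/6" by (simp add: a_def)
    qed
    define b where "b = 1 / (2 * s)"
    have ab: "5 * a / r0 = b" using r0 s by (simp add: a_def b_def)
    have b: "0 < b" "b \<le> 1/2" "b * s = 1/2" using s by (auto simp: b_def divide_simps)
    have R1: "1 \<le> R" using R by simp
    obtain N \<sigma> where \<sigma>: "\<sigma> 0 = 1" "\<And>m. \<sigma> (- m) = \<sigma> m" "\<And>m. \<bar>\<sigma> m\<bar> \<le> 1"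
      "\<And>m. m \<noteq> 0 \<Longrightarrow> \<bar>\<sigma> m\<bar> \<le> 1 / (of_int m * a)\<^sup>2"
      and up: "\<And>t. 5 * a / r0 < t \<Longrightarrow> t \<le> 4 * R \<Longrightarrow> real (card (Lat t)) - 1 \<le> smooth_count N \<sigma> (t + 5 * a / r0)"
      and dn: "\<And>t. 5 * a / r0 < t \<Longrightarrow> t \<le> 4 * R \<Longrightarrow> smooth_count N \<sigma> (t - 5 * a / r0) \<le> real (card (Lat t)) + 1"
      by (rule sandwich[OF R1 a]) (rule that)
    define I where "I = {R - 1/2 .. R + s + 1/2}"
    have "\<exists>U. continuous_on I U \<and> (\<forall>t\<in>I. \<bar>smooth_count N \<sigma> t - t\<^sup>2 * V\<bar> \<le> U t) \<and> integral I (\<lambda>t. (U t)\<^sup>2) \<le> C1 * (R * s)"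
      unfolding I_def s_def V_def by (rule C1(2)[rule_format, OF R]) (use \<sigma> in \<open>auto simp: a_def s_def\<close>)
    then obtain U where U: "continuous_on I U" "\<And>t. t \<in> I \<Longrightarrow> \<bar>smooth_count N \<sigma> t - t\<^sup>2 * V\<bar> \<le> U t"
      "integral I (\<lambda>t. (U t)\<^sup>2) \<le> C1 * (R * s)" by blast
    have bound: "\<bar>err t\<bar> \<le> U (t + b) + U (t - b) + c * s" if t: "t \<in> {R..R + s}" for t
    proof -
      have tb: "b < t" "t \<le> 4 * R" "t + b \<in> I" "t - b \<in> I" using t b sR R by (auto simp: I_def)
      have "b * t \<le> b * (2 * R)" using t b sR by (intro mult_left_mono) auto
      also have "\<dots> = s" using b(3) s(2) by (metis mult.assoc mult.commute mult.left_commute times_divide_eq_left mult_1 nonzero_mult_div_cancel_left zero_neq_numeral)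
      finally have bt: "b * t \<le> s" .
      have bb: "b * b \<le> 1 * s" using b s by (intro mult_mono) auto
      have U0: "0 \<le> U (t + b)" "0 \<le> U (t - b)" using U(2)[OF tb(3)] U(2)[OF tb(4)] by linarith+
      have e1: "(t + b)\<^sup>2 * V \<le> t\<^sup>2 * V + 3 * s * V"
      proof -
        have "(t + b)\<^sup>2 \<le> t\<^sup>2 + 3 * s" using bt bb by (simp add: power2_eq_square algebra_simps)
        then have "(t + b)\<^sup>2 * V \<le> (t\<^sup>2 + 3 * s) * V" using V by (rule mult_right_mono)
        then show ?thesis by (simp add: algebra_simps)
      qed
      have e2: "t\<^sup>2 * V - 3 * s * V \<le> (t - b)\<^sup>2 * V"
      proof -
        have "(t - b)\<^sup>2 = t\<^sup>2 - 2 * (b * t) + b * b" by (simp add: power2_eq_square algebra_simps)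
        then have "t\<^sup>2 - 3 * s \<le> (t - b)\<^sup>2" using bt s(3) zero_le_square[of b] by linarith
        then have "(t\<^sup>2 - 3 * s) * V \<le> (t - b)\<^sup>2 * V" using V by (rule mult_right_mono)
        then show ?thesis by (simp add: algebra_simps)
      qed
      have cs: "1 + 3 * s * V \<le> c * s" using s by (simp add: c_def algebra_simps)
      have "err t \<le> U (t + b) + (1 + 3 * s * V)"
        using up[unfolded ab, OF tb(1,2)] U(2)[OF tb(3)] e1 unfolding err_def V_def[symmetric] by linarith
      moreover have "- err t \<le> U (t - b) + (1 + 3 * s * V)"
        using dn[unfolded ab, OF tb(1,2)] U(2)[OF tb(4)] e2 unfolding err_def V_def[symmetric] by linarith
      ultimately show ?thesis using U0 cs by linarith
    qed
    have cUp: "continuous_on {R..R + s} (\<lambda>t. U (t + d))" if "\<bar>d\<bar> \<le> 1/2" for d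
      by (rule continuous_on_compose2[OF U(1)]) (use that in \<open>auto simp: I_def intro!: continuous_intros\<close>)
    have shift: "integral {R..R + s} (\<lambda>t. (U (t + d))\<^sup>2) \<le> C1 * (R * s)" if d: "\<bar>d\<bar> \<le> 1/2" for d
    proof -
      have cU2: "continuous_on I (\<lambda>t. (U t)\<^sup>2)" by (intro continuous_intros U)
      have sub: "{R + d..R + s + d} \<subseteq> I" using d by (auto simp: I_def)
      have "integral {R..R + s} (\<lambda>t. (U (t + d))\<^sup>2) = integral {R + d..R + s + d} (\<lambda>t. (U t)\<^sup>2)"
        using integral_shift[OF continuous_on_subset[OF cU2 sub]] by (simp add: o_def)
      also have "\<dots> \<le> integral I (\<lambda>t. (U t)\<^sup>2)"
        using cU2 continuous_on_subset[OF cU2 sub] sub unfolding I_def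
        by (intro integral_subset_le integrable_continuous_real) auto
      finally show ?thesis using U(3) by linarith
    qed
    have "integral {R..R + s} (\<lambda>t. (err t)\<^sup>2) \<le> integral {R..R + s} (\<lambda>t. 3 * ((U (t + b))\<^sup>2 + (U (t + (- b)))\<^sup>2 + (c * s)\<^sup>2))"
    proof (rule integral_le)
      show "(\<lambda>t. (err t)\<^sup>2) integrable_on {R..R + s}" using R by (intro err_square_integrable) simp
      show "(\<lambda>t. 3 * ((U (t + b))\<^sup>2 + (U (t + (- b)))\<^sup>2 + (c * s)\<^sup>2)) integrable_on {R..R + s}"
        using b by (intro integrable_continuous_real continuous_intros cUp) auto
      fix t assume t: "t \<in> {R..R + s}"
      have eq: "3 * (p\<^sup>2 + q\<^sup>2 + e\<^sup>2) - (p + q + e)\<^sup>2 = (p - q)\<^sup>2 + (q - e)\<^sup>2 + (p - e)\<^sup>2" for p q e :: real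
        by (simp add: power2_eq_square algebra_simps)
      have nn: "0 \<le> 3 * (p\<^sup>2 + q\<^sup>2 + e\<^sup>2) - (p + q + e)\<^sup>2" for p q e :: real
        unfolding eq by (intro add_nonneg_nonneg zero_le_power2)
      have "(err t)\<^sup>2 = \<bar>err t\<bar>\<^sup>2" by simp
      also have "\<dots> \<le> (U (t + b) + U (t + (- b)) + c * s)\<^sup>2" using bound[OF t] by (intro power_mono) auto
      finally show "(err t)\<^sup>2 \<le> 3 * ((U (t + b))\<^sup>2 + (U (t + (- b)))\<^sup>2 + (c * s)\<^sup>2)"
        using nn[of "U (t + b)" "U (t + (- b))" "c * s"] by linarith
    qed
    also have "\<dots> = 3 * (integral {R..R + s} (\<lambda>t. (U (t + b))\<^sup>2) + integral {R..R + s} (\<lambda>t. (U (t + (- b)))\<^sup>2) + s * (c * s)\<^sup>2)"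
    proof -
      have i: "(\<lambda>t. (U (t + d))\<^sup>2) integrable_on {R..R + s}" if "\<bar>d\<bar> \<le> 1/2" for d
        by (intro integrable_continuous_real continuous_intros cUp that)
      have i3: "(\<lambda>t. (c * s)\<^sup>2) integrable_on {R..R + s}" "integral {R..R + s} (\<lambda>t. (c * s)\<^sup>2) = s * (c * s)\<^sup>2"
        using s by auto
      show ?thesis using i[of b] i[of "- b"] b i3 by (simp only: integral_mult_right integral_add integrable_add abs_minus_cancel abs_of_pos)
    qed
    also have "\<dots> \<le> 3 * (C1 * (R * s) + C1 * (R * s) + s * (c * s)\<^sup>2)"
      using b(1,2) s(3) by (intro mult_left_mono add_mono shift) auto
    also have "\<dots> = C * (R * s)" unfolding C_def s(2)[symmetric] by (simp add: power2_eq_square algebra_simps)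
    finally show "integral {R..R + sqrt R} (\<lambda>t. (err t)\<^sup>2) \<le> C * (R * sqrt R)" by (simp add: s_def)
  qed
qed

text \<open>Because \<open>sqrt R \<le> h\<close>, at most \<open>2 h / sqrt R\<close> windows of
  length \<open>sqrt R\<close> cover the interval. They start between \<open>R\<close> and
  \<open>3 R\<close>, where \<open>mean_square_sqrt\<close> gives a comparable bound.\<close>

lemma mean_square_window:
  obtains C where "C > 0" "\<And>R h. 2 \<le> R \<Longrightarrow> sqrt R \<le> h \<Longrightarrow> h \<le> R \<Longrightarrow> integral {R..R + h} (\<lambda>t. (err t)\<^sup>2) \<le> C * (h * R)"
proof -
  obtain C where C: "C > 0" "\<And>R. 2 \<le> R \<Longrightarrow> integral {R..R + sqrt R} (\<lambda>t. (err t)\<^sup>2) \<le> C * (R * sqrt R)"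
    using mean_square_sqrt by blast
  have C24: "24 * C > 0" using C by simp
  show thesis
  proof (rule that[OF C24])
    fix R h :: real assume R: "2 \<le> R" and h: "sqrt R \<le> h" "h \<le> R"
    define s where "s = sqrt R"
    have s: "s \<ge> 1" "s * s = R" "s > 0" using R by (auto simp: s_def)
    define n where "n = nat \<lceil>h / s\<rceil>"
    have hs: "h / s \<ge> 1" using h s by (simp add: s_def)
    have n: "h / s \<le> n" "n \<le> h / s + 1" using hs unfolding n_def by linarith+
    have hn: "h \<le> n * s" "n * s \<le> 2 * h"
    proof -
      show "h \<le> n * s" using n(1) s by (simp add: pos_divide_le_eq)
      have "real n \<le> h / s + h / s" using n hs by linarith
      then have "n * s \<le> (h / s + h / s) * s" using s by (intro mult_right_mono) auto
      then show "n * s \<le> 2 * h" using s by simp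
    qed
    have int: "(\<lambda>t. (err t)\<^sup>2) integrable_on {l..u}" if "R \<le> l" for l u
      using that R by (intro err_square_integrable) simp
    have step: "integral {R + i * s..R + (i + 1) * s} (\<lambda>t. (err t)\<^sup>2) \<le> 12 * C * (R * s)" if i: "i < n" for i :: nat
    proof -
      define T where "T = R + i * s"
      have "real i * s \<le> n * s" using i s by (intro mult_right_mono) auto
      moreover have "0 \<le> real i * s" using s by simp
      ultimately have T: "R \<le> T" "T \<le> 3 * R" using hn(2) h unfolding T_def by linarith+
      have "s \<le> sqrt T" unfolding s_def using T by simp
      then have "integral {T..T + s} (\<lambda>t. (err t)\<^sup>2) \<le> integral {T..T + sqrt T} (\<lambda>t. (err t)\<^sup>2)"
        using T by (intro integral_subset_le int) auto
      also have "\<dots> \<le> C * (T * sqrt T)" using T R by (intro C(2)) auto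
      also have "\<dots> \<le> C * ((3 * R) * (2 * s))"
      proof (intro mult_left_mono mult_mono)
        have "sqrt T \<le> sqrt (4 * R)" using T R by simp
        then show "sqrt T \<le> 2 * s" by (simp add: real_sqrt_mult s_def)
      qed (use T R C s in auto)
      also have "\<dots> \<le> 12 * C * (R * s)" using C R s by simp
      finally show ?thesis by (simp add: T_def algebra_simps)
    qed
    have "integral {R..R + m * s} (\<lambda>t. (err t)\<^sup>2) \<le> m * (12 * C * (R * s))" if "m \<le> n" for m :: nat
      using that
    proof (induction m)
      case (Suc m)
      have "integral {R..R + m * s} (\<lambda>t. (err t)\<^sup>2) + integral {R + m * s..R + (m + 1) * s} (\<lambda>t. (err t)\<^sup>2) = integral {R..R + (m + 1) * s} (\<lambda>t. (err t)\<^sup>2)"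
        using s by (intro Henstock_Kurzweil_Integration.integral_combine int) (auto simp: algebra_simps)
      then show ?case using Suc step[of m] by (simp add: algebra_simps)
    qed simp
    from this[of n] have "integral {R..R + n * s} (\<lambda>t. (err t)\<^sup>2) \<le> n * (12 * C * (R * s))" by simp
    moreover have "integral {R..R + h} (\<lambda>t. (err t)\<^sup>2) \<le> integral {R..R + n * s} (\<lambda>t. (err t)\<^sup>2)"
      using hn by (intro integral_subset_le int) auto
    moreover have "n * (12 * C * (R * s)) = 12 * C * R * (n * s)" by simp
    moreover have "12 * C * R * (n * s) \<le> 12 * C * R * (2 * h)" using hn C R by (intro mult_left_mono) auto
    ultimately show "integral {R..R + h} (\<lambda>t. (err t)\<^sup>2) \<le> 24 * C * (h * R)" by (simp add: mult_ac)
  qed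
qed

end

section \<open>Transfer from \<open>real ^ 2\<close> to pairs, and the conclusion\<close>

definition to_prod :: "real ^ 2 \<Rightarrow> real \<times> real" where
  "to_prod v = (v $ 1, v $ 2)"

lemma inner_to_prod: "to_prod u \<bullet> to_prod v = u \<bullet> v"
  by (simp add: to_prod_def inner_prod_def inner_vec_def sum_2)

lemma linear_to_prod: "linear to_prod"
  by (rule linearI) (simp_all add: to_prod_def)

lemma norm_to_prod: "norm (to_prod v) = norm v"
  by (simp add: norm_eq_sqrt_inner inner_to_prod)

lemma to_prod_diff: "to_prod u - to_prod v = to_prod (u - v)"
  by (simp add: linear_diff[OF linear_to_prod])

lemma to_prod_scale: "to_prod (c *\<^sub>R v) = c *\<^sub>R to_prod v"
  by (simp add: linear_scale[OF linear_to_prod])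

lemma to_prod_eq_iff: "to_prod u = to_prod v \<longleftrightarrow> u = v"
  by (auto simp: to_prod_def vec_eq_iff forall_2)

lemma to_prod_vector: "to_prod (vector [x, y]) = (x, y)"
  by (simp add: to_prod_def)

lemma surj_to_prod: "surj to_prod"
  by (metis surj_def surj_pair to_prod_vector)

lemma continuous_on_to_prod: "continuous_on S to_prod"
  by (rule linear_continuous_on) (simp add: linear_to_prod linear_conv_bounded_linear[symmetric])

lemma distr_to_prod: "distr lborel borel to_prod = lborel"
proof (rule lborel_eqI[symmetric])
  fix l u :: "real \<times> real" assume lu: "\<And>b. b \<in> Basis \<Longrightarrow> l \<bullet> b \<le> u \<bullet> b"
  have m: "to_prod \<in> borel_measurable borel" by (rule borel_measurable_continuous_onI[OF continuous_on_to_prod])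
  have lu': "fst l \<le> fst u" "snd l \<le> snd u"
    using lu[of "(1, 0)"] lu[of "(0, 1)"] by (auto simp: Basis_prod_def inner_prod_def)
  define l' u' :: "real ^ 2" where "l' = vector [fst l, snd l]" and "u' = vector [fst u, snd u]"
  have B: "(Basis :: (real ^ 2) set) = {axis 1 1, axis 2 1}"
    by (auto simp: Basis_vec_def UNIV_2)
  have ne: "axis 1 (1::real) \<noteq> (axis 2 1 :: real ^ 2)" by (simp add: axis_eq_axis)
  have "to_prod -` box l u = box l' u'"
    by (auto simp: to_prod_def box_def Basis_prod_def inner_prod_def l'_def u'_def B inner_axis)
  then have "emeasure (distr lborel borel to_prod) (box l u) = emeasure lborel (box l' u')"
    using m by (simp add: emeasure_distr)
  also have "\<dots> = (\<Prod>b\<in>Basis. (u' - l') \<bullet> b)"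
    by (rule emeasure_lborel_box) (use lu' in \<open>auto simp: B inner_axis l'_def u'_def\<close>)
  also have "(\<Prod>b\<in>Basis. (u' - l') \<bullet> b) = (fst u - fst l) * (snd u - snd l)"
    using ne by (simp add: B inner_axis l'_def u'_def inner_diff_left)
  also have "\<dots> = (\<Prod>b\<in>Basis. (u - l) \<bullet> b)"
    by (simp add: Basis_prod_def inner_prod_def)
  finally show "emeasure (distr lborel borel to_prod) (box l u) = (\<Prod>b\<in>Basis. (u - l) \<bullet> b)" .
qed simp

text \<open>A segment parallel to a chord extends to a chord, whose length the hypothesis bounds.\<close>
lemma segment_bound:
  fixes \<Omega> :: "(real ^ 2) set"
  assumes bd: "bounded \<Omega>" and op: "open \<Omega>"
    and M: "\<And>\<theta> \<delta>. \<theta> \<in> sphere 0 1 \<Longrightarrow> \<delta> > 0 \<Longrightarrow> chord_diam \<Omega> \<theta> \<delta> / sqrt \<delta> \<le> M"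
    and p: "p \<in> \<Omega>" and q: "q \<in> \<Omega>" and pq: "p \<bullet> k = q \<bullet> k"
  shows "norm k * (norm (p - q))\<^sup>2 \<le> M\<^sup>2 * (Sup ((\<lambda>x. x \<bullet> k) ` \<Omega>) - p \<bullet> k)"
proof -
  have bdd: "bdd_above ((\<lambda>x. x \<bullet> k) ` \<Omega>)" for k
  proof -
    have "bounded ((\<lambda>x. x \<bullet> k) ` \<Omega>)"
      by (rule bounded_linear_image[OF bd]) (simp add: bounded_linear_inner_left)
    then show ?thesis by (rule bounded_imp_bdd_above)
  qed
  have sup: "x \<bullet> k \<le> Sup ((\<lambda>x. x \<bullet> k) ` \<Omega>)" if "x \<in> \<Omega>" for x k
    using that by (intro cSup_upper[OF _ bdd]) auto
  show ?thesis
  proof (cases "k = 0 \<or> p = q")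
    case True
    then show ?thesis using sup[OF p, of k] by auto
  next
    case False
    then have k: "k \<noteq> 0" and pq': "p - q \<noteq> 0" by auto
    define \<theta> where "\<theta> = (1 / norm k) *\<^sub>R k"
    have \<theta>: "\<theta> \<in> sphere 0 1" using k by (simp add: \<theta>_def)
    have S: "support_fn \<Omega> \<theta> = Sup ((\<lambda>x. x \<bullet> \<theta>) ` \<Omega>)"
      unfolding support_fn_def by (rule arg_cong[of _ _ Sup]) auto
    define \<delta> where "\<delta> = support_fn \<Omega> \<theta> - p \<bullet> \<theta>"
    \<comment> \<open>The hypothesis speaks of positive \<open>\<delta>\<close> only; openness lets
      \<open>p\<close> move a little in direction \<open>\<theta>\<close>.\<close>
    have \<delta>: "\<delta> > 0"
    proof -
      obtain e where e: "e > 0" "ball p e \<subseteq> \<Omega>" using op p openE by blast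
      have "p + (e / 2) *\<^sub>R \<theta> \<in> \<Omega>" using e \<theta> by (intro subsetD[OF e(2)]) (auto simp: dist_norm)
      from sup[OF this, of \<theta>] have "p \<bullet> \<theta> + e / 2 \<le> support_fn \<Omega> \<theta>"
        using \<theta> by (simp add: S inner_add_left dot_square_norm)
      then show ?thesis using e by (simp add: \<delta>_def)
    qed
    have int: "p \<in> interior \<Omega>" "q \<in> interior \<Omega>" using p q op by (auto simp: interior_open)
    obtain d where d: "0 < d" "p + d *\<^sub>R (p - q) \<in> frontier \<Omega>"
      using ray_to_frontier[OF bd int(1) pq'] by metis
    obtain d' where d': "0 < d'" "q + d' *\<^sub>R (q - p) \<in> frontier \<Omega>"
      using ray_to_frontier[OF bd int(2), of "q - p"] pq' by (metis eq_iff_diff_eq_0)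
    have lev: "p \<bullet> \<theta> = q \<bullet> \<theta>" using pq by (simp add: \<theta>_def)
    have ch: "p + d *\<^sub>R (p - q) \<in> chord_set \<Omega> \<theta> \<delta>" "q + d' *\<^sub>R (q - p) \<in> chord_set \<Omega> \<theta> \<delta>"
      using d d' lev by (auto simp: chord_set_def \<delta>_def inner_add_left inner_diff_left)
    have "bounded (chord_set \<Omega> \<theta> \<delta>)"
      using compact_imp_bounded[OF compact_frontier_bounded[OF bd]]
      by (rule bounded_subset) (auto simp: chord_set_def)
    then have "dist (p + d *\<^sub>R (p - q)) (q + d' *\<^sub>R (q - p)) \<le> chord_diam \<Omega> \<theta> \<delta>"
      unfolding chord_diam_def using ch by (rule diameter_bounded_bound)
    moreover have "p + d *\<^sub>R (p - q) - (q + d' *\<^sub>R (q - p)) = (1 + d + d') *\<^sub>R (p - q)"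
      by (simp add: algebra_simps)
    ultimately have "(1 + d + d') * norm (p - q) \<le> chord_diam \<Omega> \<theta> \<delta>" using d d' by (simp add: dist_norm)
    moreover have "1 * norm (p - q) \<le> (1 + d + d') * norm (p - q)" using d d' by (intro mult_right_mono) auto
    moreover have "chord_diam \<Omega> \<theta> \<delta> \<le> M * sqrt \<delta>" using M[OF \<theta> \<delta>] \<delta> by (simp add: pos_divide_le_eq)
    ultimately have "norm (p - q) \<le> M * sqrt \<delta>" by linarith
    then have "(norm (p - q))\<^sup>2 \<le> (M * sqrt \<delta>)\<^sup>2" by (intro power_mono) auto
    then have "(norm (p - q))\<^sup>2 \<le> M\<^sup>2 * \<delta>" using \<delta> by (simp add: power_mult_distrib)
    then have "norm k * (norm (p - q))\<^sup>2 \<le> norm k * (M\<^sup>2 * \<delta>)" by (intro mult_left_mono) auto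
    also have "\<dots> = M\<^sup>2 * (norm k * \<delta>)" by simp
    also have "\<dots> \<le> M\<^sup>2 * (Sup ((\<lambda>x. x \<bullet> k) ` \<Omega>) - p \<bullet> k)"
    proof (intro mult_left_mono)
      have "support_fn \<Omega> \<theta> \<le> Sup ((\<lambda>x. x \<bullet> k) ` \<Omega>) / norm k"
        unfolding S using p k sup[of _ k] by (intro cSup_least) (auto simp: \<theta>_def divide_right_mono)
      then have "norm k * support_fn \<Omega> \<theta> \<le> Sup ((\<lambda>x. x \<bullet> k) ` \<Omega>)" using k by (simp add: pos_le_divide_eq mult.commute)
      moreover have "norm k * (p \<bullet> \<theta>) = p \<bullet> k" using k by (simp add: \<theta>_def)
      ultimately show "norm k * \<delta> \<le> Sup ((\<lambda>x. x \<bullet> k) ` \<Omega>) - p \<bullet> k" by (simp add: \<delta>_def right_diff_distrib)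
    qed simp
    finally show ?thesis .
  qed
qed

theorem theorem1p2:
  fixes \<Omega> :: "(real ^ 2) set"
  assumes "bounded \<Omega>" and "open \<Omega>" and "convex \<Omega>" and "0 \<in> interior \<Omega>"
    and "\<exists>M. \<forall>\<theta>\<in>sphere 0 1. \<forall>\<delta>>0. chord_diam \<Omega> \<theta> \<delta> / sqrt \<delta> \<le> M"
  shows "\<exists>C. \<forall>R h. 2 \<le> R \<and> sqrt R \<le> h \<and> h \<le> R \<longrightarrow> mean_error \<Omega> R h \<le> C * sqrt R"
proof -
  obtain M0 where M0: "\<forall>\<theta>\<in>sphere 0 1. \<forall>\<delta>>0. chord_diam \<Omega> \<theta> \<delta> / sqrt \<delta> \<le> M0" using assms(5) by blast
  \<comment> \<open>The maximum makes the constant positive, as the locale demands;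
    \<open>min e 1\<close> does the same for the bound 1 on the inner radius.\<close>
  define M where "M = max M0 1"
  have M: "chord_diam \<Omega> \<theta> \<delta> / sqrt \<delta> \<le> M" if "\<theta> \<in> sphere 0 1" "\<delta> > 0" for \<theta> \<delta>
  proof -
    have "chord_diam \<Omega> \<theta> \<delta> / sqrt \<delta> \<le> M0" using M0 that by blast
    then show ?thesis unfolding M_def by linarith
  qed
  define \<Omega>' where "\<Omega>' = to_prod ` \<Omega>"
  obtain e where e: "e > 0" "ball 0 e \<subseteq> \<Omega>" using assms(4) mem_interior by blast
  obtain r where r: "r > 0" "\<And>x. x \<in> \<Omega> \<Longrightarrow> norm x \<le> r" using assms(1) bounded_pos by metis
  have op': "open \<Omega>'" unfolding \<Omega>'_def by (rule open_surjective_linear_image[OF assms(2) linear_to_prod surj_to_prod])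
  have cv': "convex \<Omega>'" unfolding \<Omega>'_def by (rule convex_linear_image[OF linear_to_prod assms(3)])
  interpret curved_domain \<Omega>' M "min e 1" "r + 1"
  proof
    show "ball 0 (min e 1) \<subseteq> \<Omega>'"
    proof
      fix z :: "real \<times> real" assume z: "z \<in> ball 0 (min e 1)"
      obtain v where v: "z = to_prod v" using surj_to_prod by (metis surjD)
      then have "v \<in> \<Omega>" using z e by (auto simp: norm_to_prod)
      then show "z \<in> \<Omega>'" using v by (simp add: \<Omega>'_def)
    qed
    show "\<Omega>' \<subseteq> ball 0 (r + 1)" using r by (force simp: \<Omega>'_def norm_to_prod)
    fix p q k assume pq: "p \<in> \<Omega>'" "q \<in> \<Omega>'" "p \<bullet> k = q \<bullet> k"
    obtain p' q' where p': "p' \<in> \<Omega>" "p = to_prod p'" "q' \<in> \<Omega>" "q = to_prod q'" using pq by (auto simp: \<Omega>'_def)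
    obtain k' where k': "k = to_prod k'" using surj_to_prod by (metis surjD)
    have "norm k' * (norm (p' - q'))\<^sup>2 \<le> M\<^sup>2 * (Sup ((\<lambda>x. x \<bullet> k') ` \<Omega>) - p' \<bullet> k')"
      using assms(1,2) M p' pq(3) by (intro segment_bound) (auto simp: k' inner_to_prod)
    then show "norm k * (norm (p - q))\<^sup>2 \<le> M\<^sup>2 * (Sup ((\<lambda>x. x \<bullet> k) ` \<Omega>') - p \<bullet> k)"
      by (simp add: p' k' \<Omega>'_def image_image inner_to_prod norm_to_prod to_prod_diff)
  qed (use op' cv' e in \<open>auto simp: M_def\<close>)
  have count: "lattice_count \<Omega> t = card (Lat t)" for t
  proof -
    have "to_prod ` ((\<lambda>x. t *\<^sub>R x) ` \<Omega> \<inter> lattice2) = pt ` Lat t"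
    proof (intro equalityI subsetI)
      fix z assume "z \<in> to_prod ` ((\<lambda>x. t *\<^sub>R x) ` \<Omega> \<inter> lattice2)"
      then obtain x where x: "x \<in> \<Omega>" "t *\<^sub>R x \<in> lattice2" "z = to_prod (t *\<^sub>R x)" by auto
      obtain m n where mn: "(t *\<^sub>R x) $ 1 = of_int m" "(t *\<^sub>R x) $ 2 = of_int n"
        using x(2) unfolding lattice2_def by (metis (mono_tags, lifting) Ints_cases mem_Collect_eq)
      have z: "z = pt (m, n)" using x(3) mn by (simp add: to_prod_def pt_def)
      moreover have "pt (m, n) \<in> (\<lambda>x. t *\<^sub>R x) ` \<Omega>'" using x z by (auto simp: \<Omega>'_def to_prod_scale)
      ultimately show "z \<in> pt ` Lat t" by (auto simp: Lat_def)
    next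
      fix z assume "z \<in> pt ` Lat t"
      then obtain n where n0: "z = pt n" "pt n \<in> (\<lambda>x. t *\<^sub>R x) ` \<Omega>'" unfolding Lat_def by blast
      then obtain x where n: "z = pt n" "pt n = t *\<^sub>R to_prod x" "x \<in> \<Omega>" unfolding \<Omega>'_def by blast
      then have eq: "to_prod (t *\<^sub>R x) = (of_int (fst n), of_int (snd n))" by (simp add: to_prod_scale pt_def)
      then have "t *\<^sub>R x \<in> lattice2" by (simp add: lattice2_def forall_2 to_prod_def)
      then show "z \<in> to_prod ` ((\<lambda>x. t *\<^sub>R x) ` \<Omega> \<inter> lattice2)" using n by (auto simp: to_prod_scale[symmetric])
    qed
    then have "card (to_prod ` ((\<lambda>x. t *\<^sub>R x) ` \<Omega> \<inter> lattice2)) = card (pt ` Lat t)" by simp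
    then show ?thesis
      by (simp add: lattice_count_def card_image inj_on_def to_prod_eq_iff pt_inject)
  qed
  \<comment> \<open>\<open>err\<close> is defined with the area of the closure; the boundary of a
    convex set is a null set.\<close>
  have area: "measure lebesgue \<Omega> = measure lborel (closure \<Omega>')"
  proof -
    have pre: "to_prod -` \<Omega>' = \<Omega>" by (auto simp: \<Omega>'_def to_prod_eq_iff)
    have "measure lebesgue \<Omega> = measure lborel \<Omega>" using assms(2) by (intro measure_completion) simp
    also have "\<dots> = measure (distr lborel borel to_prod) \<Omega>'"
      using op' borel_measurable_continuous_onI[OF continuous_on_to_prod] by (simp add: measure_distr pre)
    also have "\<dots> = measure lborel \<Omega>'" by (simp only: distr_to_prod)
    also have "\<dots> = measure lebesgue \<Omega>'" using op' by (intro measure_completion[symmetric]) simp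
    also have "\<dots> = measure lebesgue (closure \<Omega>')"
      using measure_closure[OF bounded_Omega negligible_convex_frontier[OF cv']] by simp
    also have "\<dots> = measure lborel (closure \<Omega>')" by (intro measure_completion) simp
    finally show ?thesis .
  qed
  have err: "lattice_error \<Omega> t = err t" for t by (simp add: lattice_error_def err_def count area)
  obtain C where C: "C > 0" "\<And>R h. 2 \<le> R \<Longrightarrow> sqrt R \<le> h \<Longrightarrow> h \<le> R \<Longrightarrow> integral {R..R + h} (\<lambda>t. (err t)\<^sup>2) \<le> C * (h * R)"
    using mean_square_window by blast
  have "mean_error \<Omega> R h \<le> sqrt C * sqrt R" if Rh: "2 \<le> R" "sqrt R \<le> h" "h \<le> R" for R h
  proof -
    have h: "h > 0" using Rh by (auto intro: less_le_trans[of 0 "sqrt R"])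
    have "(1 / h) * integral {R..R + h} (\<lambda>t. (err t)\<^sup>2) \<le> (1 / h) * (C * (h * R))"
      using C(2)[OF Rh] h by (intro mult_left_mono) auto
    also have "\<dots> = C * R" using h by simp
    finally have "sqrt ((1 / h) * integral {R..R + h} (\<lambda>t. (err t)\<^sup>2)) \<le> sqrt (C * R)" by (rule real_sqrt_le_mono)
    then show ?thesis unfolding mean_error_def by (simp add: err real_sqrt_mult)
  qed
  then show ?thesis by blast
qed

end
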